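(* Let $\lambda>0$. The inequality $$L_\lambda^+(x)\le G_\lambda^+(x)\le M_\lambda^+(x)$$ holds for all real $x$. Moreover: (i) Let $L$ be an entire function of exponential type at most $2\pi$, real-valued on $\mathbb{R}$, which satisfies $L(x)\le G_\lambda^+(x)$ for all real $x$. Then $$\int_{-\infty}^\infty\big\{G_\lambda^+(x)-L(x)\big\}\,dx\;\ge\;-\frac{\theta_3(0,i\lambda)}{2}+\frac12+\frac{1}{2\sqrt\lambda},$$ with equality if and only if $L=L_\lambda^+$. (ii) Let $M$ be an entire function of exponential type at most $2\pi$, real-valued on $\mathbb{R}$, which satisfies $M(x)\ge G_\lambda^+(x)$ for all real $x$. Then $$\int_{-\infty}^\infty\big\{M(x)-G_\lambda^+(x)\big\}\,dx\;\ge\;\frac{\theta_3(0,i\lambda)}{2}+\frac12-\frac{1}{2\sqrt\lambda},$$ with equality if and only if $M=M_\lambda^+$.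
   Context: An entire function $K$ is of exponential type at most $2\pi\delta$ if for every $\epsilon>0$ there is $C_\epsilon>0$ with $|K(z)|\le C_\epsilon e^{(2\pi\delta+\epsilon)|z|}$ for all $z\in\mathbb{C}$. $G_\lambda(z)=e^{-\pi\lambda z^2}$ and $G_\lambda'$ is its derivative in $z$. The truncated Gaussian is given on the real line by $G_\lambda^+(x)=e^{-\pi\lambda x^2}$ for $x>0$, $G_\lambda^+(0)=\tfrac12$, and $G_\lambda^+(x)=0$ for $x<0$. $L_\lambda^+$ and $M_\lambda^+$ are the entire functions of exponential type $2\pi$ that extend (the singularities being removable) $$L_\lambda^+(z)=\frac{\sin^2\pi z}{\pi^2}\sum_{n=1}^\infty\left\{\frac{G_\lambda(n)}{(z-n)^2}+\frac{G_\lambda'(n)}{z-n}-\frac{G_\lambda'(n)}{z}\right\},\qquad M_\lambda^+(z)=L_\lambda^+(z)+\frac{\sin^2\pi z}{\pi^2z^2}.$$ For $\Im\tau>0$, with $q=e^{\pi i\tau}$, $\theta_3(z,\tau)=\sum_{n=-\infty}^\infty q^{n^2}e^{2\pi i nz}$. *)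

theory Defs
  imports "HOL-Complex_Analysis.Complex_Analysis" "HOL-Real_Asymp.Real_Asymp"
begin

(* "of exponential type at most 2 * pi * \<delta>"; being entire is a separate hypothesis. *)
definition exp_type_le :: "(complex \<Rightarrow> complex) \<Rightarrow> real \<Rightarrow> bool" where
  "exp_type_le K \<delta> \<longleftrightarrow>
     (\<forall>\<epsilon>>0. \<exists>C>0. \<forall>z. cmod (K z) \<le> C * exp ((2 * pi * \<delta> + \<epsilon>) * cmod z))"

definition gauss :: "real \<Rightarrow> complex \<Rightarrow> complex" where
  "gauss lam z = exp (- of_real (pi * lam) * z\<^sup>2)"

definition trunc_gauss :: "real \<Rightarrow> real \<Rightarrow> real" where
  "trunc_gauss lam x =
     (if x > 0 then exp (- pi * lam * x\<^sup>2) else if x = 0 then 1 / 2 else 0)"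

(* The summation index starts at 1 in the series, hence Suc n. As x / 0 = 0, the formula has
   the wrong values at integers; remove_sings replaces them by the limits. *)
definition L_plus :: "real \<Rightarrow> complex \<Rightarrow> complex" where
  "L_plus lam = remove_sings (\<lambda>z. (sin (of_real pi * z))\<^sup>2 / (of_real pi)\<^sup>2 *
     (\<Sum>n. gauss lam (of_nat (Suc n)) / (z - of_nat (Suc n))\<^sup>2
         + deriv (gauss lam) (of_nat (Suc n)) / (z - of_nat (Suc n))
         - deriv (gauss lam) (of_nat (Suc n)) / z))"

definition M_plus :: "real \<Rightarrow> complex \<Rightarrow> complex" where
  "M_plus lam = remove_sings (\<lambda>z. L_plus lam z +
     (sin (of_real pi * z))\<^sup>2 / ((of_real pi)\<^sup>2 * z\<^sup>2))"

definition theta3 :: "complex \<Rightarrow> complex \<Rightarrow> complex" where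
  "theta3 z \<tau> = (\<Sum>\<^sub>\<infinity>n::int. exp (of_real pi * \<i> * \<tau>) powi (n\<^sup>2) *
     exp (2 * of_real pi * \<i> * of_int n * z))"

lemma deriv_gauss: "deriv (gauss lam) z = - 2 * of_real (pi * lam) * z * gauss lam z"
  unfolding gauss_def by (rule DERIV_imp_deriv) (auto intro!: derivative_eq_intros)

(* The entire extension of sin (pi w) / (pi w). *)
lemma sinc_extension:
  obtains s :: "complex \<Rightarrow> complex" where
    "s holomorphic_on UNIV" "\<And>w. of_real pi * w * s w = sin (of_real pi * w)"
    "\<And>w. cmod (s w) \<le> exp (pi * \<bar>Im w\<bar>)"
proof -
  let ?f = "\<lambda>w::complex. sin (of_real pi * w) / of_real pi"
  define s where "s = (\<lambda>w. if w = 0 then deriv ?f 0 else (?f w - ?f 0) / (w - 0))"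
  have der: "(?f has_field_derivative cos (of_real pi * w)) (at w within S)" for w S
    by (auto intro!: derivative_eq_intros)
  have hol: "s holomorphic_on UNIV"
    unfolding s_def by (rule pole_lemma) (auto intro!: holomorphic_intros)
  have "deriv ?f 0 = 1"
    using DERIV_imp_deriv[OF der[of 0 UNIV]] by simp
  then have eq: "of_real pi * w * s w = sin (of_real pi * w)" and s0: "s 0 = 1" for w
    by (auto simp: s_def)
  have bd: "cmod (s w) \<le> exp (pi * \<bar>Im w\<bar>)" for w
  proof (cases "w = 0")
    case True
    then show ?thesis by (simp add: s0)
  next
    case False
    let ?S = "{z. \<bar>Im z\<bar> \<le> \<bar>Im w\<bar>}"
    have cos_bd: "cmod (cos (of_real pi * z)) \<le> exp (pi * \<bar>Im w\<bar>)" if "z \<in> ?S" for z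
    proof -
      have "cmod (cos (of_real pi * z))
          \<le> (cmod (exp (\<i> * (of_real pi * z))) + cmod (exp (- (\<i> * (of_real pi * z))))) / 2"
        unfolding cos_exp_eq norm_divide norm_numeral by (intro divide_right_mono norm_triangle_ineq) simp
      also have "\<dots> \<le> (exp (pi * \<bar>Im w\<bar>) + exp (pi * \<bar>Im w\<bar>)) / 2"
        using that mult_left_mono[of "- Im z" "\<bar>Im w\<bar>" pi] mult_left_mono[of "Im z" "\<bar>Im w\<bar>" pi]
        by (intro divide_right_mono add_mono) (auto simp: norm_exp_eq_Re)
      finally show ?thesis by simp
    qed
    have "?S = {z. Im z \<le> \<bar>Im w\<bar>} \<inter> {z. Im z \<ge> - \<bar>Im w\<bar>}"
      by auto
    then have "convex ?S"
      by (simp add: convex_Int convex_halfspace_Im_le convex_halfspace_Im_ge)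
    then have "cmod (?f w - ?f 0) \<le> exp (pi * \<bar>Im w\<bar>) * cmod (w - 0)"
      by (rule field_differentiable_bound[where f' = "\<lambda>z. cos (of_real pi * z)"])
         (use der cos_bd in auto)
    then show ?thesis
      using False by (simp add: s_def norm_divide norm_mult divide_simps mult_ac)
  qed
  show ?thesis using that hol eq bd by blast
qed

lemma eventually_not_Ints: "eventually (\<lambda>w. w \<notin> \<int>) (at (z::complex))"
proof -
  have "\<not> z islimpt \<int>"
    by (intro discrete_imp_not_islimpt[of 1]) (auto elim!: Ints_cases simp: dist_of_int)
  then show ?thesis
    by (simp add: islimpt_iff_eventually)
qed

lemma remove_sings_eq_entire:
  assumes "E holomorphic_on UNIV" "eventually (\<lambda>w. f w = E w) (at z)"
  shows "remove_sings f z = E z"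
proof (rule remove_sings_eqI)
  have "isCont E z"
    using assms(1) holomorphic_on_imp_continuous_on continuous_on_eq_continuous_at open_UNIV by blast
  then show "f \<midarrow>z\<rightarrow> E z"
    using assms(2) by (simp add: isCont_def tendsto_cong)
qed

(* L_plus and M_plus (below) are entire, of the required type, and extend the given formulas. *)
lemma L_plus_entire_aux:
  assumes lam: "lam > 0"
  shows "L_plus lam holomorphic_on UNIV"
    and "exp_type_le (L_plus lam) 1"
    and "z \<notin> \<int> \<Longrightarrow> L_plus lam z = (sin (of_real pi * z))\<^sup>2 / (of_real pi)\<^sup>2 *
     (\<Sum>n. gauss lam (of_nat (Suc n)) / (z - of_nat (Suc n))\<^sup>2
         + deriv (gauss lam) (of_nat (Suc n)) / (z - of_nat (Suc n))
         - deriv (gauss lam) (of_nat (Suc n)) / z)"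
proof -
  obtain s :: "complex \<Rightarrow> complex" where hol: "s holomorphic_on UNIV"
    and eq: "\<And>w. of_real pi * w * s w = sin (of_real pi * w)"
    and bd: "\<And>w. cmod (s w) \<le> exp (pi * \<bar>Im w\<bar>)"
    using sinc_extension by metis
  define F where "F z = (sin (of_real pi * z))\<^sup>2 / (of_real pi)\<^sup>2 *
     (\<Sum>n. gauss lam (of_nat (Suc n)) / (z - of_nat (Suc n))\<^sup>2
         + deriv (gauss lam) (of_nat (Suc n)) / (z - of_nat (Suc n))
         - deriv (gauss lam) (of_nat (Suc n)) / z)" for z
  define t where "t n z = gauss lam (of_nat (Suc n)) * (s (z - of_nat (Suc n)))\<^sup>2
      + deriv (gauss lam) (of_nat (Suc n)) *
          ((z - of_nat (Suc n)) * (s (z - of_nat (Suc n)))\<^sup>2 - z * (s z)\<^sup>2)" for n z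
  define a where "a n = (real (Suc n))\<^sup>2 * exp (- pi * lam * (real (Suc n))\<^sup>2)" for n
  define D where "D = 1 + 4 * pi * lam"
  have D: "D > 0" using lam by (simp add: D_def add_pos_pos)
  have a: "summable a"
  proof (rule summable_comparison_test_bigo)
    show "summable (\<lambda>n. norm (1 / (real n)\<^sup>2))"
      using inverse_power_summable[of 2] by (simp add: field_simps)
    show "a \<in> O(\<lambda>n. 1 / (real n)\<^sup>2)"
      unfolding a_def using lam by real_asymp
  qed
  have tbd: "cmod (t n z) \<le> exp (2 * pi * \<bar>Im z\<bar>) * D * (1 + cmod z) * a n" for n z
  proof -
    define m where "m = real (Suc n)"
    define g where "g = exp (- pi * lam * m\<^sup>2)"
    define e where "e = exp (2 * pi * \<bar>Im z\<bar>)"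
    have m: "m \<ge> 1" and cm: "of_nat (Suc n) = complex_of_real m" by (auto simp: m_def)
    have G: "gauss lam (of_real m) = of_real g"
      by (simp add: gauss_def g_def flip: exp_of_real)
    have sq: "cmod ((s w)\<^sup>2) \<le> e" if "Im w = Im z" for w
    proof -
      have "cmod ((s w)\<^sup>2) \<le> (exp (pi * \<bar>Im w\<bar>))\<^sup>2"
        unfolding norm_power by (rule power_mono[OF bd]) simp
      also have "\<dots> = e" by (simp add: e_def that flip: exp_double)
      finally show ?thesis .
    qed
    have 1: "cmod (of_real g * (s (z - of_real m))\<^sup>2) \<le> g * e"
      using sq[of "z - of_real m"] by (simp add: norm_mult g_def)
    have 2: "cmod ((z - of_real m) * (s (z - of_real m))\<^sup>2) \<le> (cmod z + m) * e"
      unfolding norm_mult using m norm_triangle_ineq4[of z "of_real m"]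
      by (intro mult_mono sq) auto
    have 3: "cmod (z * (s z)\<^sup>2) \<le> cmod z * e"
      unfolding norm_mult by (intro mult_left_mono sq) auto
    have 4: "cmod ((z - of_real m) * (s (z - of_real m))\<^sup>2 - z * (s z)\<^sup>2)
        \<le> (cmod z + m) * e + cmod z * e"
      using norm_triangle_ineq4 2 3 by (rule order_trans[OF _ add_mono])
    have 5: "cmod (- 2 * of_real (pi * lam) * of_real m * of_real g) = 2 * pi * lam * m * g"
      using lam m by (simp add: norm_mult g_def abs_mult)
    have "cmod (t n z) \<le> g * e + 2 * pi * lam * m * g * ((cmod z + m) * e + cmod z * e)"
      unfolding t_def cm deriv_gauss G
      using lam m mult_left_mono[OF 4, of "2 * pi * lam * m * g"] 1
      by (intro order_trans[OF norm_triangle_ineq] add_mono)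
         (simp_all only: norm_mult[of "- 2 * of_real (pi * lam) * of_real m * of_real g"] 5, simp add: g_def)
    also have "\<dots> = e * g * (1 + 2 * pi * lam * (m * m + 2 * (m * cmod z)))"
      by (simp add: algebra_simps)
    also have "\<dots> \<le> e * g * (m\<^sup>2 * (D * (1 + cmod z)))"
    proof (rule mult_left_mono)
      have mm: "1 \<le> m\<^sup>2" "m \<le> m\<^sup>2" using m self_le_power[of m 2] by auto
      have "m * cmod z \<le> m\<^sup>2 * cmod z" using mm by (intro mult_right_mono) auto
      then have "2 * pi * lam * (m * m + 2 * (m * cmod z))
          \<le> 2 * pi * lam * (m\<^sup>2 + 2 * (m\<^sup>2 * cmod z))"
        using lam by (intro mult_left_mono) (auto simp: power2_eq_square)
      moreover have "m\<^sup>2 * (D * (1 + cmod z)) = m\<^sup>2 + m\<^sup>2 * cmod z + 2 * pi * lam * m\<^sup>2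
          + 2 * pi * lam * (m\<^sup>2 + 2 * (m\<^sup>2 * cmod z))"
        by (simp add: D_def algebra_simps)
      moreover have "0 \<le> m\<^sup>2 * cmod z" "0 \<le> 2 * pi * lam * m\<^sup>2" using lam by auto
      ultimately show "1 + 2 * pi * lam * (m * m + 2 * (m * cmod z)) \<le> m\<^sup>2 * (D * (1 + cmod z))"
        using mm(1) by linarith
    qed (auto simp: e_def g_def)
    finally show ?thesis by (simp add: e_def g_def a_def m_def mult_ac)
  qed
  define E where "E z = (\<Sum>n. t n z)" for z
  have tsum: "summable (\<lambda>n. t n z)" for z
    by (rule summable_comparison_test'[OF summable_mult[OF a] tbd])
  have Ehol: "E holomorphic_on UNIV"
  proof (rule holomorphic_uniform_sequence[OF open_UNIV])
    show "(\<lambda>z. \<Sum>i<n. t i z) holomorphic_on UNIV" for n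
    proof -
      have "(\<lambda>z. s (z - of_nat m)) holomorphic_on UNIV" for m
        by (rule holomorphic_on_compose_gen[OF _ hol, unfolded o_def]) (auto intro!: holomorphic_intros)
      then show ?thesis
        unfolding t_def using hol by (auto intro!: holomorphic_intros simp del: of_nat_Suc)
    qed
    fix z :: complex
    define R where "R = cmod z + 1"
    have "cmod (t n w) \<le> (exp (2 * pi * R) * D * (1 + R)) * a n" if "w \<in> cball z 1" for n w
    proof -
      have w: "cmod w \<le> R"
        using that norm_triangle_sub[of w z] by (auto simp: R_def dist_norm norm_minus_commute)
      then have "\<bar>Im w\<bar> \<le> R" using abs_Im_le_cmod[of w] by linarith
      with w have "exp (2 * pi * \<bar>Im w\<bar>) * D * (1 + cmod w) * a n
          \<le> exp (2 * pi * R) * D * (1 + R) * a n"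
        using D by (intro mult_right_mono mult_mono) (auto simp: a_def)
      then show ?thesis using tbd[of n w] by linarith
    qed
    then have "uniform_limit (cball z 1) (\<lambda>n w. \<Sum>i<n. t i w) E sequentially"
      unfolding E_def by (rule Weierstrass_m_test) (assumption | rule summable_mult[OF a])+
    then show "\<exists>d>0. cball z d \<subseteq> UNIV \<and> uniform_limit (cball z d) (\<lambda>n w. \<Sum>i<n. t i w) E sequentially"
      by (intro exI[of _ 1]) auto
  qed
  have FE: "F z = E z" if z: "z \<notin> \<int>" for z
  proof -
    let ?c = "(sin (of_real pi * z))\<^sup>2 / (of_real pi)\<^sup>2"
    have sinm: "(sin (of_real pi * (z - of_nat m)))\<^sup>2 = (sin (of_real pi * z))\<^sup>2" for m
    proof -
      have c: "(cos (of_real pi * of_nat m :: complex))\<^sup>2 = 1"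
        and "sin (of_real pi * of_nat m :: complex) = 0"
        using sin_cos_squared_add[of "of_real pi * of_nat m :: complex"]
          sin_npi_complex'[of m] by (simp_all add: mult.commute)
      then show ?thesis
        by (simp add: right_diff_distrib sin_diff power_mult_distrib)
    qed
    have sw: "(s w)\<^sup>2 = (sin (of_real pi * w))\<^sup>2 / (of_real pi)\<^sup>2 / w\<^sup>2" if "w \<noteq> 0" for w
      using that by (simp add: eq[symmetric] power_mult_distrib)
    have ne: "z \<noteq> 0" "z - of_nat m \<noteq> 0" for m using z by auto
    have cancel: "w * (b / w\<^sup>2) = b / w" if "w \<noteq> 0" for b w :: complex
      using that by (simp add: power2_eq_square)
    have t: "t n z = ?c * (gauss lam (of_nat (Suc n)) / (z - of_nat (Suc n))\<^sup>2
         + deriv (gauss lam) (of_nat (Suc n)) / (z - of_nat (Suc n))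
         - deriv (gauss lam) (of_nat (Suc n)) / z)" for n
      unfolding t_def sw[OF ne(1)] sw[OF ne(2)] sinm cancel[OF ne(1)] cancel[OF ne(2)]
      by (simp add: ring_distribs mult_ac del: of_nat_Suc)
    show ?thesis
    proof (cases "?c = 0")
      case True
      then show ?thesis unfolding F_def E_def t by simp
    next
      case False
      have "summable (\<lambda>n. ?c * (gauss lam (of_nat (Suc n)) / (z - of_nat (Suc n))\<^sup>2
         + deriv (gauss lam) (of_nat (Suc n)) / (z - of_nat (Suc n))
         - deriv (gauss lam) (of_nat (Suc n)) / z))"
        using tsum[of z] unfolding t .
      then have "summable (\<lambda>n. gauss lam (of_nat (Suc n)) / (z - of_nat (Suc n))\<^sup>2
         + deriv (gauss lam) (of_nat (Suc n)) / (z - of_nat (Suc n))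
         - deriv (gauss lam) (of_nat (Suc n)) / z)"
        using False by (simp only: summable_cmult_iff) simp
      then show ?thesis unfolding F_def E_def t by (rule suminf_mult[symmetric])
    qed
  qed
  have LE: "L_plus lam = E"
  proof
    fix z
    have "eventually (\<lambda>w. F w = E w) (at z)"
      using eventually_not_Ints by eventually_elim (rule FE)
    then show "L_plus lam z = E z"
      unfolding L_plus_def F_def[symmetric] by (rule remove_sings_eq_entire[OF Ehol])
  qed
  show "L_plus lam holomorphic_on UNIV" using Ehol LE by simp
  show "L_plus lam z = (sin (of_real pi * z))\<^sup>2 / (of_real pi)\<^sup>2 *
     (\<Sum>n. gauss lam (of_nat (Suc n)) / (z - of_nat (Suc n))\<^sup>2
         + deriv (gauss lam) (of_nat (Suc n)) / (z - of_nat (Suc n))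
         - deriv (gauss lam) (of_nat (Suc n)) / z)" if "z \<notin> \<int>"
    using FE[OF that] unfolding LE F_def by simp
  have Ebd: "cmod (E z) \<le> exp (2 * pi * cmod z) * (1 + cmod z) * (D * suminf a)" for z
  proof -
    have "cmod (E z) \<le> (\<Sum>n. exp (2 * pi * \<bar>Im z\<bar>) * D * (1 + cmod z) * a n)"
      unfolding E_def by (rule norm_suminf_le) (use tbd summable_mult[OF a] in auto)
    also have "\<dots> = exp (2 * pi * \<bar>Im z\<bar>) * (D * (1 + cmod z) * suminf a)"
      by (subst suminf_mult[OF a]) (simp only: mult_ac)
    also have "\<dots> \<le> exp (2 * pi * cmod z) * (D * (1 + cmod z) * suminf a)"
      using D abs_Im_le_cmod[of z] suminf_nonneg[OF a]
      by (intro mult_right_mono) (auto simp: a_def)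
    finally show ?thesis by (simp add: mult_ac)
  qed
  show "exp_type_le (L_plus lam) 1"
    unfolding exp_type_le_def LE
  proof (intro allI impI)
    fix \<epsilon> :: real
    assume e: "\<epsilon> > 0"
    define C where "C = (1 + 1 / \<epsilon>) * (D * suminf a + 1)"
    have S: "0 \<le> D * suminf a" using D suminf_nonneg[OF a] by (auto simp: a_def)
    have "C > 0" using e S by (auto simp: C_def intro!: mult_pos_pos add_pos_pos add_nonneg_pos)
    moreover have "cmod (E z) \<le> C * exp ((2 * pi * 1 + \<epsilon>) * cmod z)" for z
    proof -
      have "1 + cmod z \<le> (1 + 1 / \<epsilon>) * (1 + \<epsilon> * cmod z)"
        using e by (simp add: field_simps)
      also have "\<dots> \<le> (1 + 1 / \<epsilon>) * exp (\<epsilon> * cmod z)"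
        using e by (intro mult_left_mono exp_ge_add_one_self) auto
      finally have "(1 + cmod z) * (D * suminf a) \<le> (1 + 1 / \<epsilon>) * exp (\<epsilon> * cmod z) * (D * suminf a + 1)"
        using e S by (intro mult_mono) auto
      then have "exp (2 * pi * cmod z) * ((1 + cmod z) * (D * suminf a))
          \<le> exp (2 * pi * cmod z) * ((1 + 1 / \<epsilon>) * exp (\<epsilon> * cmod z) * (D * suminf a + 1))"
        by (intro mult_left_mono) auto
      also have "\<dots> = C * exp ((2 * pi * 1 + \<epsilon>) * cmod z)"
      proof -
        have "(2 * pi * 1 + \<epsilon>) * cmod z = 2 * pi * cmod z + \<epsilon> * cmod z"
          by (simp add: distrib_right)
        then show ?thesis by (simp only: C_def exp_add mult_ac)
      qed
      finally show ?thesis using Ebd[of z] by (simp add: mult.assoc)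
    qed
    ultimately show "\<exists>C>0. \<forall>z. cmod (E z) \<le> C * exp ((2 * pi * 1 + \<epsilon>) * cmod z)"
      by blast
  qed
qed

lemmas L_plus_holomorphic = L_plus_entire_aux(1)
lemmas exp_type_le_L_plus = L_plus_entire_aux(2)
lemmas L_plus_eq = L_plus_entire_aux(3)

lemma exp_type_le_add:
  assumes "exp_type_le f \<delta>" "exp_type_le g \<delta>"
  shows "exp_type_le (\<lambda>z. f z + g z) \<delta>"
  unfolding exp_type_le_def
proof (intro allI impI)
  fix \<epsilon> :: real
  assume "\<epsilon> > 0"
  then obtain A B where "A > 0" "B > 0"
    and A: "\<And>z. cmod (f z) \<le> A * exp ((2 * pi * \<delta> + \<epsilon>) * cmod z)"
    and B: "\<And>z. cmod (g z) \<le> B * exp ((2 * pi * \<delta> + \<epsilon>) * cmod z)"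
    using assms unfolding exp_type_le_def by metis
  have "cmod (f z + g z) \<le> (A + B) * exp ((2 * pi * \<delta> + \<epsilon>) * cmod z)" for z
    using norm_triangle_ineq[of "f z" "g z"] A[of z] B[of z] by (simp add: distrib_right)
  then show "\<exists>C>0. \<forall>z. cmod (f z + g z) \<le> C * exp ((2 * pi * \<delta> + \<epsilon>) * cmod z)"
    using \<open>A > 0\<close> \<open>B > 0\<close> by (intro exI[of _ "A + B"]) auto
qed

lemma M_plus_entire_aux:
  assumes lam: "lam > 0"
  shows "M_plus lam holomorphic_on UNIV"
    and "exp_type_le (M_plus lam) 1"
    and "z \<noteq> 0 \<Longrightarrow> M_plus lam z =
      L_plus lam z + (sin (of_real pi * z))\<^sup>2 / ((of_real pi)\<^sup>2 * z\<^sup>2)"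
proof -
  obtain s :: "complex \<Rightarrow> complex" where hol: "s holomorphic_on UNIV"
    and eq: "\<And>w. of_real pi * w * s w = sin (of_real pi * w)"
    and bd: "\<And>w. cmod (s w) \<le> exp (pi * \<bar>Im w\<bar>)"
    using sinc_extension by metis
  define E where "E z = L_plus lam z + (s z)\<^sup>2" for z
  have Ehol: "E holomorphic_on UNIV"
    unfolding E_def using hol L_plus_holomorphic[OF lam] by (intro holomorphic_intros)
  have FE: "L_plus lam z + (sin (of_real pi * z))\<^sup>2 / ((of_real pi)\<^sup>2 * z\<^sup>2) = E z"
    if "z \<noteq> 0" for z
    using that by (simp add: E_def eq[symmetric] power_mult_distrib)
  have ME: "M_plus lam = E"
  proof
    fix z
    show "M_plus lam z = E z"
      unfolding M_plus_def
    proof (rule remove_sings_eq_entire[OF Ehol])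
      have "eventually (\<lambda>w::complex. w \<noteq> 0) (at z)"
        using eventually_not_Ints by eventually_elim auto
      then show "eventually (\<lambda>w. L_plus lam w +
          (sin (of_real pi * w))\<^sup>2 / ((of_real pi)\<^sup>2 * w\<^sup>2) = E w) (at z)"
        by eventually_elim (rule FE)
    qed
  qed
  show "M_plus lam holomorphic_on UNIV" using Ehol ME by simp
  show "M_plus lam z = L_plus lam z + (sin (of_real pi * z))\<^sup>2 / ((of_real pi)\<^sup>2 * z\<^sup>2)"
    if "z \<noteq> 0"
    using FE[OF that] ME by simp
  have "cmod ((s z)\<^sup>2) \<le> 1 * exp ((2 * pi * 1 + \<epsilon>) * cmod z)" if "\<epsilon> > 0" for \<epsilon> z
  proof -
    have "cmod ((s z)\<^sup>2) \<le> (exp (pi * \<bar>Im z\<bar>))\<^sup>2"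
      unfolding norm_power by (rule power_mono[OF bd]) simp
    also have "\<dots> = exp (2 * pi * \<bar>Im z\<bar>)" by (simp flip: exp_double)
    also have "\<dots> \<le> exp ((2 * pi * 1 + \<epsilon>) * cmod z)"
      using that abs_Im_le_cmod[of z] by (auto intro!: mult_mono)
    finally show ?thesis by simp
  qed
  then have "exp_type_le (\<lambda>z. (s z)\<^sup>2) 1"
    unfolding exp_type_le_def using zero_less_one by blast
  then show "exp_type_le (M_plus lam) 1"
    unfolding ME E_def by (intro exp_type_le_add exp_type_le_L_plus[OF lam])
qed

lemmas M_plus_holomorphic = M_plus_entire_aux(1)
lemmas exp_type_le_M_plus = M_plus_entire_aux(2)
lemmas M_plus_eq = M_plus_entire_aux(3)

lemma theta3_i_eq: "theta3 0 (\<i> * of_real lam) = of_real (\<Sum>\<^sub>\<infinity>n::int. exp (- pi * lam * (of_int n)\<^sup>2))"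
proof -
  have 1: "exp (of_real pi * \<i> * (\<i> * of_real lam)) powi (n\<^sup>2) *
      exp (2 * of_real pi * \<i> * of_int n * 0)
    = (complex_of_real (exp (- pi * lam * (of_int n)\<^sup>2)))" for n :: int
  proof -
    have "exp (of_real pi * \<i> * (\<i> * of_real lam)) = complex_of_real (exp (- pi * lam))"
      by (simp add: mult_ac flip: exp_of_real)
    then show ?thesis
      by (simp add: exp_power_int mult_ac flip: of_real_power_int)
  qed
  define f where "f n = exp (- pi * lam * (of_int n)\<^sup>2)" for n :: int
  have "(\<Sum>\<^sub>\<infinity>n. complex_of_real (f n)) = of_real (infsum f UNIV)"
  proof (cases "f summable_on UNIV")
    case True
    then show ?thesis by (intro infsumI has_sum_of_real has_sum_infsum)
  next
    case False
    then have "\<not> (\<lambda>n. complex_of_real (f n)) summable_on UNIV"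
      using summable_on_bounded_linear[OF bounded_linear_Re, of "\<lambda>n. complex_of_real (f n)" UNIV]
      by auto
    with False show ?thesis by (simp add: infsum_not_exists)
  qed
  then show ?thesis unfolding theta3_def 1 f_def .
qed

end

theory Submission
  imports Defs "HOL-Probability.Probability"
begin

text \<open>Write \<open>a = 2 \<pi> \<lambda>\<close> and let \<open>H \<alpha>\<close> be the sum of \<open>(1 - \<alpha> n\<^sup>2) exp (- \<alpha> n\<^sup>2 / 2)\<close> over \<open>n \<ge> 1\<close>. By the
  functional equation of the theta function, \<open>H\<close> is increasing with values in \<open>[- 1 / 2, 0]\<close>. Off the
  integers, \<open>\<pi>\<^sup>2 / (sin (\<pi> x))\<^sup>2\<close> times the gap \<open>G\<^sup>+ - L\<^sup>+\<close> is an integral of \<open>H\<close>, respectively \<open>H + 1 / 2\<close>,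
  against a positive kernel, and monotonicity of \<open>H\<close> puts it between \<open>0\<close> and \<open>1 / x\<^sup>2\<close>. This is the
  inequality for \<open>L\<^sup>+\<close> and for \<open>M\<^sup>+\<close>. Poisson summation shows that the integral of an entire function \<open>F\<close> of
  exponential type \<open>2 \<pi>\<close> below \<open>G\<^sup>+\<close> is at most the sum of the values of \<open>G\<^sup>+\<close> at the integers, and
  that \<open>F\<close> interpolates \<open>G\<^sup>+\<close> there in the case of equality; then it interpolates to second order off \<open>0\<close>,
  which determines \<open>F\<close>. The two bounds add up to \<open>1\<close>, the integral of \<open>M\<^sup>+ - L\<^sup>+\<close>, so both are attained.\<close>

text \<open>Two obstacles shape the argument. Term by term, \<open>H\<close> is visibly increasing
  only for large arguments; for small ones its terms change sign. There the functional equation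
  turns \<open>1 + 2 * H \<alpha>\<close> into a series of positive terms in
  \<open>4 * pi^2 / \<alpha>\<close>, and the two ranges overlap. The second obstacle is the jump of
  the truncated Gaussian at 0. A continuous minorant is at most 0 there and a continuous majorant at
  least 1, so the lattice sums are taken with the value 0 or 1 at the origin, and this yields the
  constants of the theorem. Moreover, touching at all integers prescribes the derivative only at the
  nonzero ones: two candidates may still differ by
  \<open>(\<alpha> + \<beta> * z) * (sin (pi * z))^2 / z\<close>, which only integrability on the
  real line excludes. Poisson summation is obtained from complex analysis: the periodization of a
  decaying function of type below \<open>2 * pi\<close> is entire, 1-periodic and of type below
  \<open>2 * pi\<close>, hence constant. Type exactly \<open>2 * pi\<close> is reached by dilations
  with factors that tend to 1.\<close>

section \<open>Cosine moments and Gaussian integrals\<close>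

text \<open>The product formula for cosines turns vanishing moments against
  \<open>cos (j * y)\<close> into vanishing moments against all polynomials in \<open>cos y\<close>.
  These approximate \<open>D \<circ> arccos\<close> uniformly on \<open>[-1, 1]\<close>, so the
  integral of the square of \<open>D\<close> is 0. This completeness identifies the two sides of the
  theta functional equation.\<close>

lemma continuous_zero_if_cosine_moments_zero:
  fixes D :: "real \<Rightarrow> real"
  assumes cont: "continuous_on {0..pi} D"
    and moments: "\<And>j::nat. integral {0..pi} (\<lambda>y. D y * cos (real j * y)) = 0"
    and x: "x \<in> {0..pi}"
  shows "D x = 0"
proof -
  have mom_pow: "integral {0..pi} (\<lambda>y. D y * cos (real j * y) * cos y ^ m) = 0" for j m
  proof (induction m arbitrary: j)
    case 0
    then show ?case using moments by simp
  next
    case (Suc m)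
    have int: "(\<lambda>y. D y * cos (c * y) * cos y ^ m) integrable_on {0..pi}" for c
      by (intro integrable_continuous_interval continuous_intros cont)
    \<comment> \<open>The absolute value covers \<open>j = 0\<close>, where the frequency
      \<open>j - 1\<close> is negative: cosine is even, so the frequencies stay natural numbers and
      the induction hypothesis applies.\<close>
    have prod: "cos (real j * y) * cos y = (cos (real (Suc j) * y) + cos (\<bar>real j - 1\<bar> * y)) / 2" for y
    proof -
      have "cos (\<bar>real j - 1\<bar> * y) = cos (real j * y - y)"
        by (cases "real j \<ge> 1") (auto simp: algebra_simps cos_diff abs_if)
      then show ?thesis by (simp add: cos_add cos_diff algebra_simps)
    qed
    then have eq: "D y * cos (real j * y) * cos y ^ Suc m = D y * cos (real (Suc j) * y) * cos y ^ m / 2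
      + D y * cos (\<bar>real j - 1\<bar> * y) * cos y ^ m / 2" for y
    proof -
      have "D y * cos (real j * y) * cos y ^ Suc m = D y * (cos (real j * y) * cos y) * cos y ^ m"
        by simp
      then show ?thesis unfolding prod by (simp add: field_simps)
    qed
    have abs: "\<bar>real j - 1\<bar> = real (if j = 0 then 1 else j - 1)" by auto
    have "integral {0..pi} (\<lambda>y. D y * cos (real j * y) * cos y ^ Suc m)
      = integral {0..pi} (\<lambda>y. D y * cos (real (Suc j) * y) * cos y ^ m / 2)
      + integral {0..pi} (\<lambda>y. D y * cos (\<bar>real j - 1\<bar> * y) * cos y ^ m / 2)"
      unfolding eq using int by (intro integral_add integrable_on_divide)
    then show ?case
      unfolding abs using Suc.IH by (simp only: integral_divide)
  qed
  have mom_poly: "integral {0..pi} (\<lambda>y. D y * p (cos y)) = 0" if "real_polynomial_function p" for p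
  proof -
    from that have "\<exists>a n. p = (\<lambda>x. \<Sum>i\<le>n. a i * x ^ i)"
      by (simp only: real_polynomial_function_iff_sum)
    then obtain a n where p: "p = (\<lambda>x. \<Sum>i\<le>n. a i * x ^ i)"
      by blast
    have "integral {0..pi} (\<lambda>y. D y * p (cos y)) = integral {0..pi} (\<lambda>y. \<Sum>i\<le>n. a i * (D y * cos y ^ i))"
      by (simp add: p sum_distrib_left mult_ac)
    also have "\<dots> = (\<Sum>i\<le>n. integral {0..pi} (\<lambda>y. a i * (D y * cos y ^ i)))"
      by (intro integral_sum integrable_continuous_interval continuous_intros cont) auto
    also have "\<dots> = 0"
      using mom_pow[of 0] by simp
    finally show ?thesis .
  qed
  have contE: "continuous_on {-1..1} (D \<circ> arccos)"
    by (rule continuous_on_compose[OF continuous_on_arccos'])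
       (rule continuous_on_subset[OF cont], auto simp: arccos_lbound arccos_ubound)
  have "compact (D ` {0..pi})"
    by (intro compact_continuous_image cont) auto
  then obtain B where B: "\<And>y. y \<in> {0..pi} \<Longrightarrow> \<bar>D y\<bar> \<le> B"
    using compact_imp_bounded bounded_iff by (metis imageI real_norm_def)
  then have B0: "B \<ge> 0" using x by fastforce
  define I where "I = integral {0..pi} (\<lambda>y. D y * D y)"
  have "\<bar>I\<bar> \<le> 0 + e" if e: "e > 0" for e
  proof -
    \<comment> \<open>With this denominator the final error \<open>B * e' * pi\<close> is at most
      \<open>e\<close>; the summand 1 keeps the denominator positive when \<open>B\<close> is
      0.\<close>
    define e' where "e' = e / (B * pi + 1)"
    have e': "e' > 0" using e B0 by (simp add: e'_def add_nonneg_pos)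
    obtain p where p: "real_polynomial_function p" "\<And>t. t \<in> {-1..1} \<Longrightarrow> \<bar>(D \<circ> arccos) t - p t\<bar> < e'"
      using Stone_Weierstrass_real_polynomial_function[OF _ contE e'] by auto
    have pc: "continuous_on S (\<lambda>y. p (cos y))" for S
    proof -
      have "polynomial_function p" using p(1) by (simp only: real_polynomial_function_eq)
      then show ?thesis
        by (rule continuous_on_compose2[OF continuous_on_polymonial_function[where S = UNIV] continuous_on_cos[OF continuous_on_id]]) simp
    qed
    have "I = integral {0..pi} (\<lambda>y. D y * D y) - integral {0..pi} (\<lambda>y. D y * p (cos y))"
      using mom_poly[OF p(1)] by (simp add: I_def)
    also have "\<dots> = integral {0..pi} (\<lambda>y. D y * (D y - p (cos y)))"
      unfolding right_diff_distrib
      by (intro integral_diff[symmetric] integrable_continuous_interval continuous_intros cont pc)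
    also have "norm \<dots> \<le> B * e' * (pi - 0)"
    proof (rule integral_bound)
      fix t assume t: "t \<in> {0..pi}"
      have "\<bar>(D \<circ> arccos) (cos t) - p (cos t)\<bar> < e'" by (rule p(2)) auto
      then have "\<bar>D t - p (cos t)\<bar> < e'" using t by (simp add: arccos_cos)
      then show "norm (D t * (D t - p (cos t))) \<le> B * e'"
        unfolding real_norm_def abs_mult using B[OF t] by (intro mult_mono) auto
    qed (auto intro!: continuous_intros cont pc)
    also have "\<dots> \<le> e"
    proof -
      have "B * pi \<le> B * pi + 1" by simp
      then have "e * (B * pi) \<le> e * (B * pi + 1)" using e by (intro mult_left_mono) auto
      moreover have "0 < B * pi + 1" using B0 by (simp add: add_nonneg_pos)
      ultimately show ?thesis unfolding e'_def by (simp add: divide_le_eq mult_ac)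
    qed
    finally show ?thesis by simp
  qed
  then have "\<bar>I\<bar> \<le> 0" by (rule field_le_epsilon)
  then have "((\<lambda>y. D y * D y) has_integral 0) {0..pi}"
    unfolding I_def using integrable_continuous_interval[OF continuous_on_mult[OF cont cont]]
    by (simp add: has_integral_integrable_integral)
  then have "D x * D x = 0"
    using x cont by (intro has_integral_0_cbox_imp_0[where f="\<lambda>y. D y * D y" and a=0 and b=pi])
      (auto intro!: continuous_intros simp: not_le)
  then show ?thesis by simp
qed

text \<open>Uniform convergence by the Weierstrass test. It serves both the moments of the theta
  series and the integral of a periodization.\<close>

lemma integral_sums_Weierstrass:
  fixes v :: "nat \<Rightarrow> real \<Rightarrow> 'a :: euclidean_space"
  assumes cont: "\<And>n. continuous_on {a..b} (v n)"
    and bound: "\<And>n y. y \<in> {a..b} \<Longrightarrow> norm (v n y) \<le> M n"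
    and M: "summable M"
  shows "(\<lambda>n. integral {a..b} (v n)) sums integral {a..b} (\<lambda>y. \<Sum>n. v n y)"
    and "continuous_on {a..b} (\<lambda>y. \<Sum>n. v n y)"
proof -
  have ul: "uniform_limit {a..b} (\<lambda>n y. \<Sum>i<n. v i y) (\<lambda>y. \<Sum>n. v n y) sequentially"
    by (rule Weierstrass_m_test[OF bound M])
  have c: "continuous_on {a..b} (\<lambda>y. \<Sum>i<n. v i y)" for n
    by (intro continuous_on_sum cont)
  show "continuous_on {a..b} (\<lambda>y. \<Sum>n. v n y)"
    by (rule uniform_limit_theorem[OF _ ul]) (auto simp: c)
  obtain I J where I: "\<And>n. ((\<lambda>y. \<Sum>i<n. v i y) has_integral I n) {a..b}"
    and J: "((\<lambda>y. \<Sum>n. v n y) has_integral J) {a..b}" and IJ: "I \<longlonglongrightarrow> J"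
    using uniform_limit_integral[OF ul c] by auto
  have "I = (\<lambda>n. \<Sum>i<n. integral {a..b} (v i))"
  proof
    fix n
    show "I n = (\<Sum>i<n. integral {a..b} (v i))"
      using integral_unique[OF I[of n]]
      by (simp add: integral_sum integrable_continuous_interval[OF cont])
  qed
  then show "(\<lambda>n. integral {a..b} (v n)) sums integral {a..b} (\<lambda>y. \<Sum>n. v n y)"
    using IJ integral_unique[OF J] by (simp add: sums_def)
qed

text \<open>As \<open>real (Suc n)\<close> is at least 1, the power with exponent 6 dominates the
  others, so one asymptotic estimate covers them all.\<close>

lemma summable_power_mult_gauss:
  assumes "al > (0::real)" "k \<le> 6"
  shows "summable (\<lambda>n. real (Suc n) ^ k * exp (- al * (real (Suc n))\<^sup>2 / 2))"
proof (rule summable_comparison_test_bigo)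
  show "summable (\<lambda>n. norm (1 / (real n)\<^sup>2))"
    using inverse_power_summable[of 2] by (simp add: field_simps)
  have "(\<lambda>n. real (Suc n) ^ 6 * exp (- al * (real (Suc n))\<^sup>2 / 2)) \<in> O(\<lambda>n. 1 / (real n)\<^sup>2)"
    using assms(1) by real_asymp
  moreover have "(\<lambda>n. real (Suc n) ^ k * exp (- al * (real (Suc n))\<^sup>2 / 2))
      \<in> O(\<lambda>n. real (Suc n) ^ 6 * exp (- al * (real (Suc n))\<^sup>2 / 2))"
  proof (intro landau_o.big_mono always_eventually allI)
    fix n
    have "real (Suc n) ^ k \<le> real (Suc n) ^ 6" using assms(2) by (intro power_increasing) auto
    then show "norm (real (Suc n) ^ k * exp (- al * (real (Suc n))\<^sup>2 / 2))
        \<le> norm (real (Suc n) ^ 6 * exp (- al * (real (Suc n))\<^sup>2 / 2))"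
      unfolding norm_mult by (intro mult_right_mono) auto
  qed
  ultimately show "(\<lambda>n. real (Suc n) ^ k * exp (- al * (real (Suc n))\<^sup>2 / 2)) \<in> O(\<lambda>n. 1 / (real n)\<^sup>2)"
    using landau_o.big_trans by blast
qed

lemma gauss_integral:
  assumes "al > (0::real)"
  shows "has_bochner_integral lborel (\<lambda>y. exp (- al * y\<^sup>2 / 2)) (sqrt (2 * pi / al))"
proof -
  define c where "c = sqrt al"
  have c: "c > 0" "c\<^sup>2 = al" using assms by (auto simp: c_def)
  have "has_bochner_integral lborel (\<lambda>y. normal_density 0 1 (0 + c * y)) (1 /\<^sub>R \<bar>c\<bar>)"
    using c by (intro lborel_has_bochner_integral_real_affine_iff[THEN iffD1])
      (auto simp: has_bochner_integral_iff)
  then have "has_bochner_integral lborel (\<lambda>y. sqrt (2 * pi) * normal_density 0 1 (0 + c * y)) (sqrt (2 * pi) * (1 /\<^sub>R \<bar>c\<bar>))"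
    by (intro has_bochner_integral_mult_right) 
  moreover have "sqrt (2 * pi) * normal_density 0 1 (0 + c * y) = exp (- al * y\<^sup>2 / 2)" for y
    using c by (simp add: normal_density_def power_mult_distrib)
  moreover have "sqrt (2 * pi) * (1 /\<^sub>R \<bar>c\<bar>) = sqrt (2 * pi / al)"
    using c(1) by (simp add: real_sqrt_divide c_def divide_inverse real_sqrt_mult real_sqrt_inverse)
  ultimately show ?thesis by simp
qed

text \<open>The real part of the characteristic function of the standard normal distribution,
  rescaled by \<open>sqrt tau\<close>.\<close>

lemma gauss_cos_integral:
  assumes "tau > (0::real)"
  shows "has_bochner_integral lborel (\<lambda>y. exp (- y\<^sup>2 / (2 * tau)) * cos (r * y)) (sqrt (2 * pi * tau) * exp (- tau * r\<^sup>2 / 2))"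
proof -
  define c where "c = sqrt tau"
  have c: "c > 0" "c\<^sup>2 = tau" using assms by (auto simp: c_def)
  define h where "h = (\<lambda>x. std_normal_density x * cos (r * c * x))"
  have int: "integrable lborel h"
    unfolding h_def
    by (rule Bochner_Integration.integrable_bound[of _ std_normal_density])
       (auto simp: abs_mult intro!: mult_left_le)
  have intc: "integrable std_normal_distribution (\<lambda>x. iexp (r * c * x))"
    using prob_space.integrable_iexp[OF real_distribution.axioms(1)[OF real_dist_normal_dist], of "\<lambda>x. r * c * x"] by simp
  have "Re (char std_normal_distribution (r * c)) = (\<integral>x. cos (r * c * x) \<partial>std_normal_distribution)"
    unfolding char_def integral_Re[OF intc, symmetric]
    by (simp add: Re_exp)
  also have "\<dots> = integral\<^sup>L lborel h"
    unfolding h_def by (subst integral_density) auto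
  finally have "integral\<^sup>L lborel h = exp (- (r * c)\<^sup>2 / 2)"
    by (simp add: char_std_normal_distribution)
  then have "has_bochner_integral lborel h (exp (- tau * r\<^sup>2 / 2))"
    using int c by (simp add: has_bochner_integral_iff power_mult_distrib mult.commute)
  then have "has_bochner_integral lborel (\<lambda>y. h (0 + (1 / c) * y)) (exp (- tau * r\<^sup>2 / 2) /\<^sub>R \<bar>1 / c\<bar>)"
    using c by (intro lborel_has_bochner_integral_real_affine_iff[THEN iffD1]) auto
  then have "has_bochner_integral lborel (\<lambda>y. sqrt (2 * pi) * h (0 + (1 / c) * y)) (sqrt (2 * pi) * (exp (- tau * r\<^sup>2 / 2) /\<^sub>R \<bar>1 / c\<bar>))"
    by (intro has_bochner_integral_mult_right)
  moreover have "sqrt (2 * pi) * h (0 + (1 / c) * y) = exp (- y\<^sup>2 / (2 * tau)) * cos (r * y)" for y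
    using c by (simp add: h_def normal_density_def power_divide mult.commute[of tau])
  moreover have "sqrt (2 * pi) * (exp (- tau * r\<^sup>2 / 2) /\<^sub>R \<bar>1 / c\<bar>) = sqrt (2 * pi * tau) * exp (- tau * r\<^sup>2 / 2)"
    using c(1) by (simp add: real_sqrt_mult c_def)
  ultimately show ?thesis by (simp only:)
qed

text \<open>Lets the moments of an even function over growing intervals \<open>[0, X]\<close> be
  evaluated from its integral over the whole line.\<close>

lemma integral_even_tendsto:
  fixes h :: "real \<Rightarrow> real"
  assumes int: "integrable lborel h" and even: "\<And>y. h (- y) = h y"
    and X: "filterlim X at_top sequentially" and X0: "\<And>n. X n \<ge> 0"
  shows "(\<lambda>n. integral {0..X n} h) \<longlonglongrightarrow> (\<integral>y. h y \<partial>lborel) / 2"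
proof -
  have [measurable]: "h \<in> borel_measurable borel" using int by auto
  define P where "P = (\<integral>y. indicator {0..} y * h y \<partial>lborel)"
  have ind: "integrable lborel (\<lambda>y. indicator A y * h y)" if "A \<in> sets borel" for A
    using integrable_mult_indicator[of A lborel h] that int by simp
  have "(\<integral>y. h y \<partial>lborel) = (\<integral>y. indicator {0..} y * h y + indicator {..<0} y * h y \<partial>lborel)"
    by (intro Bochner_Integration.integral_cong) (auto simp: indicator_def)
  also have "\<dots> = P + (\<integral>y. indicator {..<0} y * h y \<partial>lborel)"
    unfolding P_def by (intro Bochner_Integration.integral_add ind) auto
  also have "(\<integral>y. indicator {..<0} y * h y \<partial>lborel) = (\<integral>y. indicator {..<0} (0 + (-1) * y) * h (0 + (-1) * y) \<partial>lborel)"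
    by (subst lborel_integral_real_affine[of "-1" _ 0]) auto
  also have "\<dots> = P"
    unfolding P_def
  proof (rule integral_cong_AE)
    have "AE y in lborel. y \<noteq> (0::real)" by (rule AE_lborel_singleton)
    then show "AE y in lborel. indicator {..<0} (0 + (-1) * y) * h (0 + (-1) * y) = indicator {0..} y * h y"
      by eventually_elim (auto simp: indicator_def even)
  qed auto
  finally have half: "(\<integral>y. h y \<partial>lborel) / 2 = P" by simp
  have "integral {0..X n} h = (\<integral>y. indicator {..X n} y *\<^sub>R (indicator {0..} y * h y) \<partial>lborel)" for n
  proof -
    have "integral {0..X n} h = (LINT x : {0..X n} | lborel. h x)"
      by (rule set_borel_integral_eq_integral(2)[symmetric])
         (use ind[of "{0..X n}"] in \<open>auto simp: set_integrable_def\<close>)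
    also have "\<dots> = (\<integral>y. indicator {..X n} y *\<^sub>R (indicator {0..} y * h y) \<partial>lborel)"
      unfolding set_lebesgue_integral_def by (intro Bochner_Integration.integral_cong) (auto simp: indicator_def)
    finally show ?thesis .
  qed
  moreover have "((\<lambda>z. \<integral>y. indicator {..z} y *\<^sub>R (indicator {0..} y * h y) \<partial>lborel) \<longlongrightarrow> P) at_top"
    unfolding P_def by (rule tendsto_integral_at_top) (auto simp: ind)
  ultimately show ?thesis
    unfolding half using filterlim_compose[OF _ X] by simp
qed

section \<open>The theta function and its functional equation\<close>

text \<open>Half of the theta series without its term at 0: \<open>theta3 0 (\<i> * lam)\<close> is
  \<open>1 + 2 * theta_tail (2 * pi * lam)\<close>. The exponent is normalized as in the normal
  density.\<close>

definition theta_tail :: "real \<Rightarrow> real" where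
  "theta_tail al = (\<Sum>n. exp (- al * (real (Suc n))\<^sup>2 / 2))"

text \<open>Up to the factor \<open>- 1 / 2\<close>, the derivative of
  \<open>theta_tail\<close>.\<close>

definition theta_tail2 :: "real \<Rightarrow> real" where
  "theta_tail2 al = (\<Sum>n. (real (Suc n))\<^sup>2 * exp (- al * (real (Suc n))\<^sup>2 / 2))"

lemma integral_cos_cos:
  "integral {0..pi} (\<lambda>y. cos (real (Suc k) * y) * cos (real j * y)) = (if j = Suc k then pi / 2 else 0)"
proof -
  have prim: "((\<lambda>y. cos (of_int m * y)) has_integral (if m = 0 then pi else 0)) {0..pi}" for m :: int
  proof (cases "m = 0")
    case True
    then show ?thesis using has_integral_const_real[of "1::real" 0 pi] by simp
  next
    case False
    have "((\<lambda>y. cos (of_int m * y)) has_integral (sin (of_int m * pi) / of_int m - sin (of_int m * 0) / of_int m)) {0..pi}"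
      by (rule fundamental_theorem_of_calculus)
         (use False in \<open>auto intro!: derivative_eq_intros simp flip: has_real_derivative_iff_has_vector_derivative\<close>)
    moreover have "sin (of_int m * pi) = 0" by (simp add: sin_zero_iff_int2)
    ultimately show ?thesis using False by simp
  qed
  have "((\<lambda>y. (cos (of_int (int (Suc k) - int j) * y) + cos (of_int (int (Suc k) + int j) * y)) / 2) has_integral
      ((if int (Suc k) - int j = 0 then pi else 0) + (if int (Suc k) + int j = 0 then pi else 0)) / 2) {0..pi}"
    by (intro has_integral_divide has_integral_add prim)
  moreover have "(cos (of_int (int (Suc k) - int j) * y) + cos (of_int (int (Suc k) + int j) * y)) / 2
     = cos (real (Suc k) * y) * cos (real j * y)" for y
  proof -
    have "of_int (int (Suc k) - int j) * y = real (Suc k) * y - real j * y"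
      "of_int (int (Suc k) + int j) * y = real (Suc k) * y + real j * y"
      by (simp_all add: algebra_simps)
    then show ?thesis by (simp only: cos_times_cos)
  qed
  ultimately have "((\<lambda>y. cos (real (Suc k) * y) * cos (real j * y)) has_integral
      ((if int (Suc k) - int j = 0 then pi else 0) + (if int (Suc k) + int j = 0 then pi else 0)) / 2) {0..pi}"
    by simp
  then show ?thesis by (auto dest!: integral_unique)
qed

text \<open>Poisson summation for a Gaussian. The two sides are the values at 0 of \<open>S\<close>,
  the sum of the translates of \<open>f\<close> by multiples of \<open>2 * pi\<close>, and of the
  cosine series \<open>T\<close>. Both have the same cosine moments on \<open>[0, pi]\<close>, hence
  they agree there.\<close>

lemma theta_transform:
  assumes tau: "tau > 0"
  shows "1 + 2 * theta_tail (4 * pi\<^sup>2 / tau) = sqrt (tau / (2 * pi)) * (1 + 2 * theta_tail tau)"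
proof -
  define f where "f y = exp (- y\<^sup>2 / (2 * tau))" for y :: real
  \<comment> \<open>As \<open>f\<close> is even, the second summand is the translate of
    \<open>f\<close> by \<open>- 2 * pi * (n + 1)\<close>, so the \<open>u n\<close> together use
    every translate once. In the reflected form both arguments are at least
    \<open>2 * pi * n\<close> for \<open>y\<close> in \<open>[0, pi]\<close>, which gives the
    majorant \<open>2 * f (2 * pi * n)\<close>.\<close>
  define u where "u n y = f (y + 2 * pi * real n) + f (2 * pi * real (Suc n) - y)" for n y
  define S where "S y = (\<Sum>n. u n y)" for y
  define b where "b k = exp (- tau * (real (Suc k))\<^sup>2 / 2)" for k
  define A where "A = sqrt (tau / (2 * pi))"
  define T where "T y = A * (1 + 2 * (\<Sum>k. b k * cos (real (Suc k) * y)))" for y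
  have f_mono: "f y \<le> f z" if "0 \<le> z" "z \<le> y" for y z
    using that tau by (auto simp: f_def divide_right_mono power_mono)
  have f_even: "f (- y) = f y" for y by (simp add: f_def)
  have f_sum: "summable (\<lambda>n. f (2 * pi * real (Suc n)))"
  proof -
    have "f (2 * pi * real (Suc n)) = real (Suc n) ^ 0 * exp (- (4 * pi\<^sup>2 / tau) * (real (Suc n))\<^sup>2 / 2)" for n
      by (simp add: f_def power_mult_distrib)
    then show ?thesis using summable_power_mult_gauss[of "4 * pi\<^sup>2 / tau" 0] tau by simp
  qed
  then have f_sum0: "summable (\<lambda>n. f (2 * pi * real n))" by (subst (asm) summable_Suc_iff)
  have f_cont: "continuous_on X f" for X
    unfolding f_def using tau by (intro continuous_intros) auto
  have u_bound: "norm (u n y) \<le> 2 * f (2 * pi * real n)" if "y \<in> {0..pi}" for n y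
  proof -
    have "0 \<le> f z" for z by (simp add: f_def)
    then have "norm (u n y) = u n y" by (simp add: u_def)
    moreover have "f (y + 2 * pi * real n) \<le> f (2 * pi * real n)"
      "f (2 * pi * real (Suc n) - y) \<le> f (2 * pi * real n)"
      using that pi_gt_zero by (auto intro!: f_mono simp: distrib_left)
    ultimately show ?thesis by (simp add: u_def)
  qed
  have u_cont: "continuous_on X (u n)" for X n
    unfolding u_def by (intro continuous_intros continuous_on_compose2[OF f_cont[of UNIV]]) auto
  note u_sum = summable_mult[OF f_sum0, of 2]
  have b_sum: "summable b"
    unfolding b_def using summable_power_mult_gauss[of tau 0] tau by simp
  have b_nonneg: "0 \<le> b k" for k by (simp add: b_def)
  have S_cont: "continuous_on {0..pi} S"
    unfolding S_def by (rule integral_sums_Weierstrass(2)[OF u_cont u_bound u_sum])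
  have T_cont: "continuous_on {0..pi} T"
    unfolding T_def
    by (intro continuous_intros integral_sums_Weierstrass(2)[OF _ _ b_sum])
       (auto simp: abs_mult b_nonneg intro!: mult_left_le continuous_intros)
  have moments: "integral {0..pi} (\<lambda>y. (S y - T y) * cos (real j * y)) = 0" for j :: nat
  proof -
    let ?c = "\<lambda>y. cos (real j * y)"
    have c_shift: "?c (y + 2 * pi * real n) = ?c y" "?c (2 * pi * real n - y) = ?c y" for y n
    proof -
      have m: "real j * (2 * pi * real n) = of_int (int (j * n)) * (2 * pi)" by simp
      show "?c (y + 2 * pi * real n) = ?c y" "?c (2 * pi * real n - y) = ?c y"
        unfolding distrib_left right_diff_distrib m cos_add cos_diff
        using sin_int_2pin[of "int (j * n)"] cos_int_2pin[of "int (j * n)"] by (simp_all add: mult_ac)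
    qed
    \<comment> \<open>The substitutions \<open>y + 2 * pi * n\<close> and
      \<open>2 * pi * (n + 1) - y\<close> carry \<open>[0, pi]\<close> onto the two halves of one
      period and leave \<open>?c\<close> unchanged. So the moment of \<open>u n\<close> is an
      integral over that period, and the periods fill the half-line.\<close>
    have 1: "integral {0..pi} (\<lambda>y. u n y * ?c y) = integral {2 * pi * real n..2 * pi * real (Suc n)} (\<lambda>y. f y * ?c y)" for n
    proof -
      let ?g = "\<lambda>y. f y * ?c y"
      have g: "?g integrable_on {p..q}" for p q
        by (intro integrable_continuous_interval continuous_intros f_cont)
      have "integral {2 * pi * real n..2 * pi * real (Suc n)} ?g
        = integral {2 * pi * real n..2 * pi * real n + pi} ?g + integral {2 * pi * real n + pi..2 * pi * real (Suc n)} ?g"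
        using pi_gt_zero by (intro Henstock_Kurzweil_Integration.integral_combine[symmetric] g) (auto simp: distrib_left)
      also have "integral {2 * pi * real n..2 * pi * real n + pi} ?g = integral {0..pi} (\<lambda>y. ?g (y + 2 * pi * real n))"
      proof -
        have "(?g has_integral integral {2 * pi * real n..2 * pi * real n + pi} ?g) (cbox (2 * pi * real n) (2 * pi * real n + pi))"
          using integrable_integral[OF g] by simp
        from has_integral_affinity[OF this, of 1 "2 * pi * real n"]
        show ?thesis by (auto dest!: integral_unique simp: algebra_simps)
      qed
      also have "integral {2 * pi * real n + pi..2 * pi * real (Suc n)} ?g = integral {0..pi} (\<lambda>y. ?g (2 * pi * real (Suc n) - y))"
      proof -
        have "(?g has_integral integral {2 * pi * real n + pi..2 * pi * real (Suc n)} ?g) (cbox (2 * pi * real n + pi) (2 * pi * real (Suc n)))"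
          using integrable_integral[OF g] by simp
        from has_integral_affinity[OF this, of "-1" "2 * pi * real (Suc n)"]
        show ?thesis by (auto dest!: integral_unique simp: algebra_simps)
      qed
      also have "integral {0..pi} (\<lambda>y. ?g (y + 2 * pi * real n)) + integral {0..pi} (\<lambda>y. ?g (2 * pi * real (Suc n) - y))
        = integral {0..pi} (\<lambda>y. ?g (y + 2 * pi * real n) + ?g (2 * pi * real (Suc n) - y))"
        by (intro Henstock_Kurzweil_Integration.integral_add[symmetric] integrable_continuous_interval continuous_intros
            continuous_on_compose2[OF f_cont[of UNIV]]) auto
      also have "\<dots> = integral {0..pi} (\<lambda>y. u n y * ?c y)"
        unfolding c_shift u_def by (simp add: algebra_simps)
      finally show ?thesis by simp
    qed
    have 2: "(\<Sum>n<N. integral {0..pi} (\<lambda>y. u n y * ?c y)) = integral {0..2 * pi * real N} (\<lambda>y. f y * ?c y)" for N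
    proof (induction N)
      case (Suc N)
      have "integral {0..2 * pi * real (Suc N)} (\<lambda>y. f y * ?c y) = integral {0..2 * pi * real N} (\<lambda>y. f y * ?c y)
          + integral {2 * pi * real N..2 * pi * real (Suc N)} (\<lambda>y. f y * ?c y)"
        by (intro Henstock_Kurzweil_Integration.integral_combine[symmetric] integrable_continuous_interval continuous_intros f_cont) auto
      then show ?case using Suc 1 by simp
    qed simp
    have bi: "has_bochner_integral lborel (\<lambda>y. f y * ?c y) (sqrt (2 * pi * tau) * exp (- tau * (real j)\<^sup>2 / 2))"
      unfolding f_def by (rule gauss_cos_integral[OF tau])
    have "(\<lambda>N. integral {0..2 * pi * real N} (\<lambda>y. f y * ?c y)) \<longlonglongrightarrow> (\<integral>y. f y * ?c y \<partial>lborel) / 2"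
    proof (rule integral_even_tendsto)
      show "filterlim (\<lambda>N. 2 * pi * real N) at_top sequentially" by real_asymp
    qed (use bi in \<open>auto simp: f_even has_bochner_integral_iff\<close>)
    then have s1: "(\<lambda>n. integral {0..pi} (\<lambda>y. u n y * ?c y)) sums (sqrt (2 * pi * tau) * exp (- tau * (real j)\<^sup>2 / 2) / 2)"
      using bi by (simp add: sums_def 2 has_bochner_integral_iff)
    have uc_bound: "norm (u n y * ?c y) \<le> 2 * f (2 * pi * real n)" if "y \<in> {0..pi}" for n y
      using u_bound[OF that, of n] mult_left_le[of "\<bar>?c y\<bar>" "\<bar>u n y\<bar>"] by (simp add: abs_mult)
    have s2: "(\<lambda>n. integral {0..pi} (\<lambda>y. u n y * ?c y)) sums integral {0..pi} (\<lambda>y. \<Sum>n. u n y * ?c y)"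
      by (intro integral_sums_Weierstrass(1)[OF _ uc_bound u_sum] continuous_intros u_cont)
    have "(\<Sum>n. u n y * ?c y) = S y * ?c y" if "y \<in> {0..pi}" for y
      unfolding S_def by (rule suminf_mult2[symmetric, OF summable_comparison_test'[OF u_sum]]) (use u_bound that in auto)
    then have "integral {0..pi} (\<lambda>y. S y * ?c y) = integral {0..pi} (\<lambda>y. \<Sum>n. u n y * ?c y)"
      by (intro Henstock_Kurzweil_Integration.integral_cong) simp
    with sums_unique2[OF s1 s2]
    have intS: "integral {0..pi} (\<lambda>y. S y * ?c y) = sqrt (2 * pi * tau) * exp (- tau * (real j)\<^sup>2 / 2) / 2"
      by simp
    have bc_bound: "norm (b k * cos (real (Suc k) * y) * ?c y) \<le> b k" for k y
    proof -
      have "\<bar>cos (real (Suc k) * y)\<bar> * \<bar>?c y\<bar> \<le> 1" by (intro mult_le_one) auto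
      then show ?thesis using b_nonneg[of k] by (simp add: abs_mult mult.assoc mult_left_le del: of_nat_Suc)
    qed
    have s3: "(\<lambda>k. integral {0..pi} (\<lambda>y. b k * cos (real (Suc k) * y) * ?c y)) sums
        integral {0..pi} (\<lambda>y. \<Sum>k. b k * cos (real (Suc k) * y) * ?c y)"
      by (intro integral_sums_Weierstrass(1)[OF _ bc_bound b_sum] continuous_intros)
    have t3: "integral {0..pi} (\<lambda>y. b k * cos (real (Suc k) * y) * ?c y) = (if j = Suc k then b k * pi / 2 else 0)" for k
      using integral_cos_cos[of k j] by (simp add: mult.assoc del: of_nat_Suc)
    \<comment> \<open>By orthogonality only \<open>k = j - 1\<close> contributes, because term
      \<open>k\<close> has frequency \<open>k + 1\<close>.\<close>
    have s4: "(\<lambda>k. if j = Suc k then b k * pi / 2 else 0) sums (if j = 0 then 0 else b (j - 1) * pi / 2)"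
    proof (cases j)
      case (Suc i)
      then show ?thesis using sums_single[of i "\<lambda>k. b k * pi / 2"] by (simp add: eq_commute)
    qed simp
    from sums_unique2[OF s4 s3[unfolded t3]]
    have intT1: "integral {0..pi} (\<lambda>y. \<Sum>k. b k * cos (real (Suc k) * y) * ?c y) = (if j = 0 then 0 else b (j - 1) * pi / 2)"
      by simp
    have bsum: "summable (\<lambda>k. b k * cos (real (Suc k) * y))" for y
      by (rule summable_comparison_test'[OF b_sum]) (auto simp: abs_mult b_nonneg intro!: mult_left_le)
    have contT1: "continuous_on {0..pi} (\<lambda>y. \<Sum>k. b k * cos (real (Suc k) * y) * ?c y)"
      by (intro integral_sums_Weierstrass(2)[OF _ bc_bound b_sum] continuous_intros)
    have "integral {0..pi} (\<lambda>y. T y * ?c y) = integral {0..pi} (\<lambda>y. A * ?c y + 2 * A * (\<Sum>k. b k * cos (real (Suc k) * y) * ?c y))"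
      unfolding T_def suminf_mult2[OF bsum, symmetric] by (simp add: algebra_simps del: of_nat_Suc)
    also have "\<dots> = A * integral {0..pi} ?c + 2 * A * integral {0..pi} (\<lambda>y. \<Sum>k. b k * cos (real (Suc k) * y) * ?c y)"
      by (subst Henstock_Kurzweil_Integration.integral_add)
         (auto simp del: of_nat_Suc intro!: integrable_continuous_interval continuous_intros contT1)
    also have "integral {0..pi} ?c = (if j = 0 then pi else 0)"
      using integral_cos_cos[of "j - 1" 0] by (cases j) auto
    also have "A * (if j = 0 then pi else 0) + 2 * A * integral {0..pi} (\<lambda>y. \<Sum>k. b k * cos (real (Suc k) * y) * ?c y)
        = A * pi * exp (- tau * (real j)\<^sup>2 / 2)"
      unfolding intT1 by (cases j) (auto simp: b_def)
    also have "A * pi = sqrt (2 * pi * tau) / 2"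
    proof -
      have "sqrt (2 * pi * tau) = sqrt ((2 * pi)\<^sup>2 * (tau / (2 * pi)))"
        by (simp add: power2_eq_square)
      also have "\<dots> = \<bar>2 * pi\<bar> * A" unfolding A_def real_sqrt_mult[of "(2 * pi)\<^sup>2"] real_sqrt_abs ..
      finally show ?thesis by simp
    qed
    finally have intT: "integral {0..pi} (\<lambda>y. T y * ?c y) = sqrt (2 * pi * tau) * exp (- tau * (real j)\<^sup>2 / 2) / 2"
      by simp
    show ?thesis
      unfolding left_diff_distrib
      by (subst Henstock_Kurzweil_Integration.integral_diff)
         (auto intro!: integrable_continuous_interval continuous_intros S_cont T_cont simp: intS intT)
  qed
  have "S 0 - T 0 = 0"
    by (rule continuous_zero_if_cosine_moments_zero[OF _ moments]) (auto intro!: continuous_intros S_cont T_cont)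
  moreover have "S 0 = 1 + 2 * theta_tail (4 * pi\<^sup>2 / tau)"
  proof -
    have "theta_tail (4 * pi\<^sup>2 / tau) = (\<Sum>n. f (2 * pi * real (Suc n)))"
      by (simp add: theta_tail_def f_def power_mult_distrib)
    moreover have "(\<Sum>n. f (2 * pi * real n)) = 1 + (\<Sum>n. f (2 * pi * real (Suc n)))"
      using suminf_split_head[OF f_sum0] by (simp add: f_def)
    moreover have "S 0 = (\<Sum>n. f (2 * pi * real n)) + (\<Sum>n. f (2 * pi * real (Suc n)))"
      unfolding S_def u_def using suminf_add[OF f_sum0 f_sum] by simp
    ultimately show ?thesis by simp
  qed
  moreover have "T 0 = A * (1 + 2 * theta_tail tau)"
    by (simp add: T_def theta_tail_def b_def)
  ultimately show ?thesis by (simp add: A_def)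
qed

section \<open>Monotonicity and bounds of the Gaussian sum\<close>

text \<open>The function \<open>H\<close> of the overview. It is the image of
  \<open>theta_tail\<close> under the operator \<open>1 + 2 * \<alpha> * d/d\<alpha>\<close>, which
  interacts well with the functional equation.\<close>

definition gauss_sum :: "real \<Rightarrow> real" where
  "gauss_sum al = (\<Sum>n. (1 - al * (real (Suc n))\<^sup>2) * exp (- al * (real (Suc n))\<^sup>2 / 2))"

lemma summable_theta_tail:
  assumes "al > 0"
  shows "summable (\<lambda>n. exp (- al * (real (Suc n))\<^sup>2 / 2))"
    and "summable (\<lambda>n. (real (Suc n))\<^sup>2 * exp (- al * (real (Suc n))\<^sup>2 / 2))"
    and "summable (\<lambda>n. (1 - al * (real (Suc n))\<^sup>2) * exp (- al * (real (Suc n))\<^sup>2 / 2))"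
proof -
  show 0: "summable (\<lambda>n. exp (- al * (real (Suc n))\<^sup>2 / 2))"
    using summable_power_mult_gauss[OF assms, of 0] by simp
  show 2: "summable (\<lambda>n. (real (Suc n))\<^sup>2 * exp (- al * (real (Suc n))\<^sup>2 / 2))"
    using summable_power_mult_gauss[OF assms, of 2] by simp
  show "summable (\<lambda>n. (1 - al * (real (Suc n))\<^sup>2) * exp (- al * (real (Suc n))\<^sup>2 / 2))"
    using summable_diff[OF 0 summable_mult[OF 2, of al]] by (simp only: left_diff_distrib mult_1_left mult.assoc)
qed

lemma gauss_sum_eq:
  assumes "al > 0"
  shows "gauss_sum al = theta_tail al - al * theta_tail2 al"
proof -
  have "theta_tail al - al * theta_tail2 al = (\<Sum>n. exp (- al * (real (Suc n))\<^sup>2 / 2)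
      - al * ((real (Suc n))\<^sup>2 * exp (- al * (real (Suc n))\<^sup>2 / 2)))"
    unfolding theta_tail_def theta_tail2_def
      suminf_mult[OF summable_theta_tail(2)[OF assms], symmetric]
    by (rule suminf_diff[OF summable_theta_tail(1)[OF assms] summable_mult[OF summable_theta_tail(2)[OF assms]]])
  also have "\<dots> = gauss_sum al"
    unfolding gauss_sum_def by (simp only: left_diff_distrib mult_1_left mult.assoc)
  finally show ?thesis by simp
qed

text \<open>Termwise differentiation on the half-line beyond \<open>al / 2\<close>: staying away
  from 0 lets the terms at \<open>al / 2\<close> serve as majorants.\<close>

lemma has_real_derivative_theta_tail:
  assumes al: "al > 0"
  shows "(theta_tail has_real_derivative (- theta_tail2 al / 2)) (at al)"
proof -
  let ?S = "{al / 2<..}"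
  let ?f = "\<lambda>n x. exp (- x * (real (Suc n))\<^sup>2 / 2)"
  let ?f' = "\<lambda>n x. - ((real (Suc n))\<^sup>2 / 2) * exp (- x * (real (Suc n))\<^sup>2 / 2)"
  have "uniformly_convergent_on ?S (\<lambda>n x. \<Sum>i<n. ?f' i x)"
  proof (rule Weierstrass_m_test')
    show "summable (\<lambda>n. (real (Suc n))\<^sup>2 * exp (- (al / 2) * (real (Suc n))\<^sup>2 / 2))"
      using al by (intro summable_theta_tail) auto
    fix n x assume x: "x \<in> ?S"
    have "exp (- x * (real (Suc n))\<^sup>2 / 2) \<le> exp (- (al / 2) * (real (Suc n))\<^sup>2 / 2)"
      using x by (auto intro!: mult_right_mono divide_right_mono)
    then have "(real (Suc n))\<^sup>2 / 2 * exp (- x * (real (Suc n))\<^sup>2 / 2)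
        \<le> (real (Suc n))\<^sup>2 * exp (- (al / 2) * (real (Suc n))\<^sup>2 / 2)"
      by (intro mult_mono) auto
    then show "norm (?f' n x) \<le> (real (Suc n))\<^sup>2 * exp (- (al / 2) * (real (Suc n))\<^sup>2 / 2)"
      by (simp only: norm_mult norm_minus_cancel real_norm_def) simp
  qed
  then have "((\<lambda>x. \<Sum>n. ?f n x) has_real_derivative (\<Sum>n. ?f' n al)) (at al)"
    using al summable_theta_tail(1)[OF al]
    by (intro has_field_derivative_series'(2)[where S = ?S and x0 = al])
       (auto intro!: derivative_eq_intros simp: interior_open)
  moreover have "(\<Sum>n. ?f' n al) = - theta_tail2 al / 2"
  proof -
    have "?f' n al = (- 1 / 2) * ((real (Suc n))\<^sup>2 * exp (- al * (real (Suc n))\<^sup>2 / 2))" for n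
      by simp
    then show ?thesis
      unfolding theta_tail2_def using suminf_mult[OF summable_theta_tail(2)[OF al], of "- 1 / 2"] by simp
  qed
  ultimately show ?thesis unfolding theta_tail_def[abs_def] by simp
qed

text \<open>Apply \<open>1 + 2 * \<alpha> * d/d\<alpha>\<close> to the functional equation. The
  operator annihilates \<open>\<alpha> powr (- 1 / 2)\<close>, so the derivative of the prefactor
  cancels and only the derivative of \<open>theta_tail\<close> at \<open>b\<close> survives, a
  series of positive terms.\<close>

lemma gauss_sum_transform:
  assumes al: "al > 0"
  defines "b \<equiv> 4 * pi\<^sup>2 / al"
  shows "1 + 2 * gauss_sum al = 2 * sqrt (b / (2 * pi)) * b * theta_tail2 b"
proof -
  define q where "q = sqrt (2 * pi / al)"
  have b: "b > 0" using al by (simp add: b_def)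
  have q: "q > 0" "q = sqrt (b / (2 * pi))"
    using al by (auto simp: q_def b_def power2_eq_square)
  \<comment> \<open>The functional equation at \<open>4 * pi^2 / x\<close>, which the involution
    \<open>x \<mapsto> 4 * pi^2 / x\<close> sends back to \<open>x\<close>.\<close>
  have fe: "1 + 2 * theta_tail x = sqrt (2 * pi / x) * (1 + 2 * theta_tail (4 * pi\<^sup>2 / x))" if "x > 0" for x
  proof -
    have "4 * pi\<^sup>2 / (4 * pi\<^sup>2 / x) = x" "4 * pi\<^sup>2 / x / (2 * pi) = 2 * pi / x"
      using that by (auto simp: field_simps power2_eq_square)
    then show ?thesis using theta_transform[of "4 * pi\<^sup>2 / x"] that by simp
  qed
  have sq: "((\<lambda>x. sqrt (2 * pi / x)) has_real_derivative - (q / (2 * al))) (at al)"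
  proof -
    have "((\<lambda>x. sqrt (2 * pi / x)) has_real_derivative inverse (sqrt (2 * pi / al)) / 2 * (- (2 * pi) / al\<^sup>2)) (at al)"
    proof (rule DERIV_chain2[where g = "\<lambda>x. 2 * pi / x"])
      show "(sqrt has_real_derivative inverse (sqrt (2 * pi / al)) / 2) (at (2 * pi / al))"
        using al by (intro DERIV_real_sqrt) simp
      show "((\<lambda>x. 2 * pi / x) has_real_derivative - (2 * pi) / al\<^sup>2) (at al)"
        using al by (auto intro!: derivative_eq_intros simp: power2_eq_square)
    qed
    moreover have "(inverse (sqrt (2 * pi / al)) / 2) * (- (2 * pi) / al\<^sup>2) = - (q / (2 * al))"
    proof -
      have "q * q = 2 * pi / al" using al by (simp add: q_def)
      then have "2 * pi = q * q * al" using al by (simp add: field_simps)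
      then have "(inverse q / 2) * (- (2 * pi) / al\<^sup>2) = (inverse q / 2) * (- (q * q * al) / al\<^sup>2)" by (simp only:)
      also have "\<dots> = - (q / (2 * al))" using q(1) al by (simp add: divide_simps power2_eq_square)
      finally show ?thesis unfolding q_def .
    qed
    ultimately show ?thesis by simp
  qed
  have th: "((\<lambda>x. theta_tail (4 * pi\<^sup>2 / x)) has_real_derivative (- theta_tail2 b / 2) * (- b / al)) (at al)"
  proof (rule DERIV_chain2[where f = theta_tail and g = "\<lambda>x. 4 * pi\<^sup>2 / x"])
    show "(theta_tail has_real_derivative - theta_tail2 b / 2) (at (4 * pi\<^sup>2 / al))"
      using has_real_derivative_theta_tail[OF b] by (simp add: b_def)
    show "((\<lambda>x. 4 * pi\<^sup>2 / x) has_real_derivative - b / al) (at al)"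
      using al by (auto intro!: derivative_eq_intros simp: b_def power2_eq_square)
  qed
  have "((\<lambda>x. sqrt (2 * pi / x) * (1 + 2 * theta_tail (4 * pi\<^sup>2 / x))) has_real_derivative
      (- (q / (2 * al)) * (1 + 2 * theta_tail b) + q * (2 * ((- theta_tail2 b / 2) * (- b / al))))) (at al)"
    by (rule DERIV_cong[OF DERIV_mult[OF sq DERIV_add[OF DERIV_const[of 1] DERIV_cmult[OF th, of 2]]]])
       (simp only: q_def[symmetric] b_def[symmetric], simp add: algebra_simps)
  then have "((\<lambda>x. 1 + 2 * theta_tail x) has_real_derivative
      (- (q / (2 * al)) * (1 + 2 * theta_tail b) + q * (2 * ((- theta_tail2 b / 2) * (- b / al))))) (at al)"
    using al by (elim has_field_derivative_transform_within_open[where S = "{0<..}"]) (auto simp: fe[symmetric])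
  moreover have "((\<lambda>x. 1 + 2 * theta_tail x) has_real_derivative 2 * (- theta_tail2 al / 2)) (at al)"
    by (auto intro!: derivative_eq_intros has_real_derivative_theta_tail al)
  ultimately have "- theta_tail2 al = - (q / (2 * al)) * (1 + 2 * theta_tail b) + q * theta_tail2 b * b / al"
    using DERIV_unique by fastforce
  then have 1: "- (al * theta_tail2 al) = - (q * (1 + 2 * theta_tail b)) / 2 + q * theta_tail2 b * b"
    using al by (simp add: field_simps)
  have "q * (1 + 2 * theta_tail b) = 1 + 2 * theta_tail al"
    using fe[OF al] by (simp add: q_def b_def)
  note 2 = 1[unfolded this]
  have "1 + 2 * (Z - X) = 2 * Y" if "- X = - (1 + 2 * Z) / 2 + Y" for X Y Z :: real
    using that by (simp add: field_simps)
  from this[OF 2] have "1 + 2 * (theta_tail al - al * theta_tail2 al) = 2 * (q * theta_tail2 b * b)" .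
  then show ?thesis
    unfolding gauss_sum_eq[OF al] q(2)[symmetric] by (simp add: mult_ac)
qed

text \<open>In the variable \<open>b = 4 * pi^2 / \<alpha>\<close> each term of the transformed
  series is a multiple of \<open>b powr (3 / 2) * exp (- b * m / 2)\<close> with
  \<open>m = n^2 \<ge> 1\<close>, which decreases for \<open>b \<ge> 3 / m\<close>. Since
  \<open>pi^2 \<ge> 9\<close>, the bound 12 on \<open>\<alpha>\<close> ensures
  \<open>b \<ge> 3\<close>.\<close>

lemma gauss_sum_mono_small:
  assumes "0 < al" "al \<le> al'" "al' \<le> 12"
  shows "gauss_sum al \<le> gauss_sum al'"
proof -
  define b b' where "b = 4 * pi\<^sup>2 / al" and "b' = 4 * pi\<^sup>2 / al'"
  have pi2: "pi\<^sup>2 \<ge> 9" using pi_gt3 power_mono[of 3 pi 2] by simp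
  have b: "b' \<le> b" unfolding b_def b'_def using assms by (intro divide_left_mono) auto
  have b3: "3 \<le> b'"
    using pi2 assms by (simp add: b'_def field_simps)
  \<comment> \<open>Squaring removes the square roots and leaves
    \<open>t ^ 3 * exp (- (t * m))\<close>. The comparison of the cubes is
    \<open>1 + x \<le> exp x\<close> at \<open>x = (b - b') / 3\<close>, raised to the third
    power.\<close>
  have key: "sqrt b * b * exp (- b * m / 2) \<le> sqrt b' * b' * exp (- b' * m / 2)" if m: "m \<ge> 1" for m
  proof (rule power2_le_imp_le)
    have "b / b' \<le> 1 + (b - b') / 3"
    proof -
      have "b / b' = 1 + (b - b') / b'" using b3 by (simp add: field_simps)
      also have "\<dots> \<le> 1 + (b - b') / 3" using b b3 by (intro add_left_mono divide_left_mono) auto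
      finally show ?thesis .
    qed
    also have "\<dots> \<le> exp ((b - b') / 3)" by (rule exp_ge_add_one_self)
    finally have "(b / b') ^ 3 \<le> exp ((b - b') / 3) ^ 3"
      using b b3 by (intro power_mono) auto
    also have "\<dots> = exp (b - b')" by (simp flip: exp_of_nat_mult)
    also have "\<dots> \<le> exp ((b - b') * m)" using b m mult_left_mono[of 1 m "b - b'"] by simp
    finally have "b ^ 3 / b' ^ 3 \<le> exp (b * m) / exp (b' * m)"
      by (simp only: power_divide left_diff_distrib exp_diff)
    then have "b ^ 3 * exp (b' * m) \<le> b' ^ 3 * exp (b * m)"
      using b3 by (simp add: pos_divide_le_eq pos_le_divide_eq mult_ac)
    then have "b ^ 3 * exp (- (b * m)) \<le> b' ^ 3 * exp (- (b' * m))"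
      by (simp add: exp_minus divide_inverse[symmetric] pos_divide_le_eq pos_le_divide_eq)
    moreover have "(sqrt t * t * exp (- t * m / 2))\<^sup>2 = t ^ 3 * exp (- (t * m))" if "t > 0" for t
    proof -
      have "(exp (- t * m / 2))\<^sup>2 = exp (- (t * m))"
        by (simp add: power2_eq_square flip: exp_add)
      then show ?thesis using that
        by (simp add: power_mult_distrib) (simp add: power3_eq_cube power2_eq_square)
    qed
    ultimately show "(sqrt b * b * exp (- b * m / 2))\<^sup>2 \<le> (sqrt b' * b' * exp (- b' * m / 2))\<^sup>2"
      using b b3 by simp
  qed (use b3 in auto)
  have pos: "0 < b" "0 < b'" using b b3 by auto
  have "sqrt b * b * theta_tail2 b \<le> sqrt b' * b' * theta_tail2 b'"
  proof -
    have "(\<Sum>n. sqrt b * b * ((real (Suc n))\<^sup>2 * exp (- b * (real (Suc n))\<^sup>2 / 2)))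
      \<le> (\<Sum>n. sqrt b' * b' * ((real (Suc n))\<^sup>2 * exp (- b' * (real (Suc n))\<^sup>2 / 2)))"
    proof (intro suminf_le summable_mult summable_theta_tail pos)
      fix n
      have "(real (Suc n))\<^sup>2 * (sqrt b * b * exp (- b * (real (Suc n))\<^sup>2 / 2))
        \<le> (real (Suc n))\<^sup>2 * (sqrt b' * b' * exp (- b' * (real (Suc n))\<^sup>2 / 2))"
        by (intro mult_left_mono key) auto
      then show "sqrt b * b * ((real (Suc n))\<^sup>2 * exp (- b * (real (Suc n))\<^sup>2 / 2))
        \<le> sqrt b' * b' * ((real (Suc n))\<^sup>2 * exp (- b' * (real (Suc n))\<^sup>2 / 2))"
        by (simp only: mult_ac)
    qed
    then show ?thesis
      unfolding theta_tail2_def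
      by (simp only: suminf_mult[OF summable_theta_tail(2)[OF pos(1)]] suminf_mult[OF summable_theta_tail(2)[OF pos(2)]])
  qed
  then have "2 * sqrt (b / (2 * pi)) * b * theta_tail2 b \<le> 2 * sqrt (b' / (2 * pi)) * b' * theta_tail2 b'"
    by (simp add: real_sqrt_divide divide_right_mono mult.assoc)
  then show ?thesis
    using gauss_sum_transform[of al] gauss_sum_transform[of al'] assms by (simp add: b_def b'_def)
qed

text \<open>Termwise: \<open>(1 - y) * exp (- y / 2)\<close> has derivative
  \<open>(y - 3) / 2 * exp (- y / 2)\<close>, so it increases for \<open>y \<ge> 3\<close>, and
  \<open>y = \<alpha> * n^2\<close> is at least \<open>\<alpha>\<close>. The proof compares two
  values directly, again by \<open>1 + x \<le> exp x\<close>.\<close>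

lemma gauss_sum_mono_large:
  assumes "3 \<le> al" "al \<le> al'"
  shows "gauss_sum al \<le> gauss_sum al'"
  unfolding gauss_sum_def
proof (intro suminf_le summable_theta_tail)
  fix n
  define m where "m = (real (Suc n))\<^sup>2"
  define y y' where "y = al * m" and "y' = al' * m"
  have m: "m \<ge> 1" by (simp add: m_def)
  have y: "3 \<le> y" "y \<le> y'"
    using mult_mono[of 3 al 1 m] assms m by (auto simp: y_def y'_def mult_right_mono)
  have "(y' - 1) / (y - 1) = 1 + (y' - y) / (y - 1)" using y by (simp add: field_simps)
  also have "\<dots> \<le> 1 + (y' - y) / 2" using y by (intro add_left_mono divide_left_mono) auto
  also have "\<dots> \<le> exp ((y' - y) / 2)" by (rule exp_ge_add_one_self)
  finally have "(y' - 1) / (y - 1) \<le> exp (y' / 2) / exp (y / 2)"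
    by (simp only: diff_divide_distrib exp_diff)
  then have "(y' - 1) * exp (y / 2) \<le> (y - 1) * exp (y' / 2)"
    using y by (simp add: pos_divide_le_eq pos_le_divide_eq mult_ac)
  then have "(y' - 1) * exp (- y' / 2) \<le> (y - 1) * exp (- y / 2)"
    by (simp add: exp_minus divide_inverse[symmetric] pos_divide_le_eq pos_le_divide_eq)
  then show "(1 - al * (real (Suc n))\<^sup>2) * exp (- al * (real (Suc n))\<^sup>2 / 2)
      \<le> (1 - al' * (real (Suc n))\<^sup>2) * exp (- al' * (real (Suc n))\<^sup>2 / 2)"
    unfolding m_def[symmetric] by (simp add: y_def y'_def algebra_simps)
qed (use assms in auto)

text \<open>The ranges up to 12 and from 3 on overlap; a pair that fits into neither is compared
  through 3.\<close>

lemma gauss_sum_mono: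
  assumes "0 < al" "al \<le> al'"
  shows "gauss_sum al \<le> gauss_sum al'"
  using assms gauss_sum_mono_small[of al al'] gauss_sum_mono_large[of al al']
    gauss_sum_mono_small[of al 3] gauss_sum_mono_large[of 3 al']
  by (cases "al' \<le> 12"; cases "3 \<le> al") auto

text \<open>From 1 on, every term is nonpositive; monotonicity carries the sign to smaller
  arguments.\<close>

lemma gauss_sum_nonpos:
  assumes "0 < al"
  shows "gauss_sum al \<le> 0"
proof -
  have ge1: "gauss_sum x \<le> 0" if "x \<ge> 1" for x
  proof -
    have "(1 - x * (real (Suc n))\<^sup>2) * exp (- x * (real (Suc n))\<^sup>2 / 2) \<le> 0" for n
      using mult_mono[of 1 x 1 "(real (Suc n))\<^sup>2"] that by (intro mult_nonpos_nonneg) auto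
    then show ?thesis
      unfolding gauss_sum_def using that
      by (intro order_trans[OF suminf_le[OF _ summable_theta_tail(3) summable_zero]]) auto
  qed
  show ?thesis
    using ge1[of al] ge1[of 1] gauss_sum_mono[of al 1] assms by (cases "al \<ge> 1") auto
qed

text \<open>The transformed series for \<open>1 + 2 * gauss_sum al\<close> has nonnegative
  terms.\<close>

lemma gauss_sum_ge:
  assumes "0 < al"
  shows "gauss_sum al \<ge> - 1 / 2"
proof -
  have "0 \<le> theta_tail2 b" if "b > 0" for b
    unfolding theta_tail2_def by (intro suminf_nonneg summable_theta_tail that) auto
  then have "0 \<le> 2 * sqrt (4 * pi\<^sup>2 / al / (2 * pi)) * (4 * pi\<^sup>2 / al) * theta_tail2 (4 * pi\<^sup>2 / al)"
    using assms by (intro mult_nonneg_nonneg) auto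
  then show ?thesis
    unfolding gauss_sum_transform[OF assms, symmetric] by linarith
qed

section \<open>Integrals of the Gaussian sum against positive kernels\<close>

text \<open>The scheme of the three estimates that follow: a series is written as a sum of integrals
  of \<open>f n\<close>, the majorants \<open>b n\<close> allow the exchange of sum and integral,
  and pointwise bounds on the summed integrand pass to the series.\<close>

lemma sums_integral_bounds:
  fixes f b :: "nat \<Rightarrow> 'a \<Rightarrow> real"
  assumes f: "\<And>n. has_bochner_integral M (f n) (I n)"
    and b: "\<And>n. has_bochner_integral M (b n) (B n)" "\<And>n x. \<bar>f n x\<bar> \<le> b n x" "summable B"
      "\<And>x. summable (\<lambda>n. b n x)"
    and lo: "has_bochner_integral M lo LO" "\<And>x. lo x \<le> (\<Sum>n. f n x)"
    and up: "has_bochner_integral M up UP" "\<And>x. (\<Sum>n. f n x) \<le> up x"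
  shows "summable I" "LO \<le> suminf I" "suminf I \<le> UP"
proof -
  have int: "integrable M (f n)" and I: "integral\<^sup>L M (f n) = I n" for n
    using f by (auto simp: has_bochner_integral_iff)
  have 1: "AE x in M. summable (\<lambda>n. norm (f n x))"
    using b(2) by (intro AE_I2 summable_comparison_test'[OF b(4)]) auto
  have 2: "summable (\<lambda>n. \<integral>x. norm (f n x) \<partial>M)"
  proof (rule summable_comparison_test'[OF b(3)])
    fix n
    have "(\<integral>x. norm (f n x) \<partial>M) \<le> integral\<^sup>L M (b n)"
      using b(1,2) int by (intro integral_mono) (auto simp: has_bochner_integral_iff)
    then show "norm (\<integral>x. norm (f n x) \<partial>M) \<le> B n"
      using b(1) by (simp add: has_bochner_integral_iff integral_nonneg_AE)
  qed
  have S: "I sums (\<integral>x. (\<Sum>n. f n x) \<partial>M)" and int': "integrable M (\<lambda>x. \<Sum>n. f n x)"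
    using sums_integral[OF int 1 2] integrable_suminf[OF int 1 2] by (simp_all add: I)
  show "summable I" using S by (simp add: sums_iff)
  have "LO \<le> (\<integral>x. (\<Sum>n. f n x) \<partial>M)" "(\<integral>x. (\<Sum>n. f n x) \<partial>M) \<le> UP"
    using lo up int' by (auto simp: has_bochner_integral_iff intro!: integral_mono)
  with S show "LO \<le> suminf I" "suminf I \<le> UP" by (simp_all add: sums_iff)
qed

lemma has_bochner_integral_FTC_atLeast:
  fixes f F :: "real \<Rightarrow> real"
  assumes "f \<in> borel_measurable borel" "\<And>x. a \<le> x \<Longrightarrow> DERIV F x :> f x"
    "\<And>x. a \<le> x \<Longrightarrow> 0 \<le> f x" "(F \<longlongrightarrow> T) at_top"
  shows "has_bochner_integral lborel (\<lambda>x. indicator {a..} x * f x) (T - F a)"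
proof (rule has_bochner_integral_nn_integral)
  have "(\<integral>\<^sup>+x. ennreal (indicator {a..} x * f x) \<partial>lborel) = (\<integral>\<^sup>+x. ennreal (f x) * indicator {a..} x \<partial>lborel)"
    by (intro nn_integral_cong) (simp split: split_indicator)
  also have "\<dots> = ennreal (T - F a)"
    by (rule nn_integral_FTC_atLeast[OF assms])
  finally show "(\<integral>\<^sup>+x. ennreal (indicator {a..} x * f x) \<partial>lborel) = ennreal (T - F a)" .
  show "0 \<le> T - F a"
  proof -
    have "F a \<le> F y" if "a \<le> y" for y
      using that
    proof (rule DERIV_nonneg_imp_nondecreasing)
      fix x assume "a \<le> x"
      then show "\<exists>y. DERIV F x :> y \<and> 0 \<le> y" using assms(2,3) by blast
    qed
    then have "eventually (\<lambda>y. F a \<le> F y) at_top"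
      using eventually_ge_at_top[of a] by (rule eventually_mono[rotated])
    then have "F a \<le> T" by (intro tendsto_lowerbound[OF assms(4)]) auto
    then show ?thesis by simp
  qed
  show "(\<lambda>x. indicator {a..} x * f x) \<in> borel_measurable lborel"
    using assms(1) by measurable
  show "AE x in lborel. 0 \<le> indicator {a..} x * f x"
    using assms(3) by (intro AE_I2) (simp split: split_indicator)
qed

lemma has_bochner_integral_exp_atLeast:
  assumes p: "p > (0::real)"
  shows "has_bochner_integral lborel (\<lambda>v. indicator {0..} v * exp (- p * v / 2)) (2 / p)"
    and "has_bochner_integral lborel (\<lambda>v. indicator {0..} v * (v * exp (- p * v / 2))) (4 / p\<^sup>2)"
proof -
  have "has_bochner_integral lborel (\<lambda>v. indicator {0..} v * exp (- p * v / 2)) (0 - (- (2 / p) * exp (- p * 0 / 2)))"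
  proof (rule has_bochner_integral_FTC_atLeast)
    show "((\<lambda>v. - (2 / p) * exp (- p * v / 2)) \<longlongrightarrow> 0) at_top"
      using p by real_asymp
    show "((\<lambda>v. - (2 / p) * exp (- p * v / 2)) has_real_derivative exp (- p * x / 2)) (at x)" for x
      using p by (auto intro!: derivative_eq_intros)
  qed auto
  then show "has_bochner_integral lborel (\<lambda>v. indicator {0..} v * exp (- p * v / 2)) (2 / p)"
    by simp
  have "has_bochner_integral lborel (\<lambda>v. indicator {0..} v * (v * exp (- p * v / 2)))
     (0 - (- (2 / p) * 0 * exp (- p * 0 / 2) - 4 / p\<^sup>2 * exp (- p * 0 / 2)))"
  proof (rule has_bochner_integral_FTC_atLeast)
    show "((\<lambda>v. - (2 / p) * v * exp (- p * v / 2) - 4 / p\<^sup>2 * exp (- p * v / 2)) \<longlongrightarrow> 0) at_top"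
      using p by real_asymp
    show "((\<lambda>v. - (2 / p) * v * exp (- p * v / 2) - 4 / p\<^sup>2 * exp (- p * v / 2))
       has_real_derivative x * exp (- p * x / 2)) (at x)" for x
      using p by (auto intro!: derivative_eq_intros simp: power2_eq_square diff_divide_distrib)
  qed auto
  then show "has_bochner_integral lborel (\<lambda>v. indicator {0..} v * (v * exp (- p * v / 2))) (4 / p\<^sup>2)"
    by simp
qed

text \<open>The number \<open>q n\<close> is the integral over \<open>v \<ge> 0\<close> of
  \<open>exp (- c * v / 2) / 2\<close> times term \<open>n\<close> of
  \<open>gauss_sum (a + v)\<close>. So the series integrates \<open>gauss_sum (a + v)\<close>
  against a positive kernel of mass \<open>1 / c\<close>, and the bounds come from
  \<open>gauss_sum a \<le> gauss_sum (a + v) \<le> 0\<close>.\<close>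

lemma rational_gauss_sum_bounds:
  fixes a c :: real
  assumes a: "a > 0" and c: "c > 0"
  defines "q \<equiv> \<lambda>n. exp (- a * (real (Suc n))\<^sup>2 / 2) *
     ((1 - a * (real (Suc n))\<^sup>2) / (c + (real (Suc n))\<^sup>2) - 2 * (real (Suc n))\<^sup>2 / (c + (real (Suc n))\<^sup>2)\<^sup>2)"
  shows "gauss_sum a / c \<le> suminf q" "suminf q \<le> 0"
proof -
  define m where "m n = (real (Suc n))\<^sup>2" for n
  define g where "g n = exp (- a * m n / 2)" for n
  define f where "f n v = indicator {0..} v * exp (- c * v / 2) / 2 *
      ((1 - (a + v) * m n) * exp (- (a + v) * m n / 2))" for n and v :: real
  \<comment> \<open>The expansion of \<open>f n v\<close> in \<open>v\<close> with all minus signs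
    made plus, so its integral \<open>B n\<close> is again a combination of two explicit Laplace
    integrals.\<close>
  define b where "b n v = g n / 2 * ((1 + a * m n) * (indicator {0..} v * exp (- (c + m n) * v / 2))
      + m n * (indicator {0..} v * (v * exp (- (c + m n) * v / 2))))" for n and v :: real
  define B where "B n = g n / 2 * ((1 + a * m n) * (2 / (c + m n)) + m n * (4 / (c + m n)\<^sup>2))" for n
  have m: "m n \<ge> 1" for n by (simp add: m_def)
  have p: "c + m n > 0" for n using c m[of n] by linarith
  have g0: "0 \<le> g n" for n by (simp add: g_def)
  have f_eq: "f n v = g n / 2 * ((1 - a * m n) * (indicator {0..} v * exp (- (c + m n) * v / 2))
      - m n * (indicator {0..} v * (v * exp (- (c + m n) * v / 2))))" for n v
  proof -
    have "exp (- (a + v) * m n / 2) * exp (- c * v / 2) = g n * exp (- (c + m n) * v / 2)"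
      unfolding g_def exp_add[symmetric] by (simp add: field_simps)
    then have "f n v = indicator {0..} v / 2 * (1 - (a + v) * m n) * (g n * exp (- (c + m n) * v / 2))"
      by (simp add: f_def mult_ac)
    then show ?thesis by (simp add: algebra_simps)
  qed
  have q_eq: "q n = g n / 2 * ((1 - a * m n) * (2 / (c + m n)) - m n * (4 / (c + m n)\<^sup>2))" for n
  proof -
    have "A / s - 2 * M / t = (A * (2 / s) - M * (4 / t)) / 2" for A M s t :: real
      by (simp add: diff_divide_distrib)
    then show ?thesis unfolding q_def g_def m_def[symmetric] by simp
  qed
  have int_f: "has_bochner_integral lborel (f n) (q n)" for n
    unfolding f_eq[abs_def] q_eq
    by (intro has_bochner_integral_mult_right has_bochner_integral_diff has_bochner_integral_exp_atLeast p)
  have int_b: "has_bochner_integral lborel (b n) (B n)" for n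
    unfolding b_def[abs_def] B_def
    by (intro has_bochner_integral_mult_right has_bochner_integral_add has_bochner_integral_exp_atLeast p)
  have f_le: "\<bar>f n v\<bar> \<le> b n v" for n v
  proof (cases "v \<ge> 0")
    case True
    have E: "0 \<le> exp (- (c + m n) * v / 2)" by simp
    have "\<bar>(1 - a * m n) - m n * v\<bar> \<le> (1 + a * m n) + m n * v"
      using a m[of n] True by (intro abs_leI) (auto simp: algebra_simps add_increasing2)
    then have "g n / 2 * (\<bar>(1 - a * m n) - m n * v\<bar> * exp (- (c + m n) * v / 2))
       \<le> g n / 2 * (((1 + a * m n) + m n * v) * exp (- (c + m n) * v / 2))"
      using g0[of n] by (intro mult_left_mono mult_right_mono) auto
    moreover have "f n v = g n / 2 * (((1 - a * m n) - m n * v) * exp (- (c + m n) * v / 2))"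
      "b n v = g n / 2 * (((1 + a * m n) + m n * v) * exp (- (c + m n) * v / 2))"
      using True by (simp_all add: f_eq b_def algebra_simps)
    ultimately show ?thesis using g0[of n] by (simp only: abs_mult) simp
  qed (simp add: f_eq b_def)
  have gm: "summable (\<lambda>n. g n)" "summable (\<lambda>n. m n * g n)"
    unfolding g_def m_def by (rule summable_theta_tail[OF a])+
  have sB: "summable B"
  proof (rule summable_comparison_test')
    show "summable (\<lambda>n. g n + (a + 2) * (m n * g n))"
      by (intro summable_add summable_mult gm)
    fix n
    have 1: "2 / (c + m n) \<le> 2" "4 / (c + m n)\<^sup>2 \<le> 4"
      using c m[of n] power_mono[of 1 "c + m n" 2] p[of n] by (auto simp: divide_le_eq)
    have "B n \<le> g n / 2 * ((1 + a * m n) * 2 + m n * 4)"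
      unfolding B_def using g0[of n] a m[of n]
      by (intro mult_left_mono add_mono 1) auto
    moreover have "0 \<le> B n"
      unfolding B_def using g0[of n] a m[of n] p[of n]
      by (intro mult_nonneg_nonneg add_nonneg_nonneg) auto
    ultimately show "norm (B n) \<le> g n + (a + 2) * (m n * g n)"
      by (simp add: algebra_simps)
  qed
  have sb: "summable (\<lambda>n. b n v)" for v
  proof (cases "v \<ge> 0")
    case True
    show ?thesis
    proof (rule summable_comparison_test')
      show "summable (\<lambda>n. g n + (a + v) * (m n * g n))"
        by (intro summable_add summable_mult gm)
      fix n
      have "b n v = g n / 2 * (((1 + a * m n) + m n * v) * exp (- (c + m n) * v / 2))"
        using True by (simp add: b_def algebra_simps)
      moreover have "((1 + a * m n) + m n * v) * exp (- (c + m n) * v / 2) \<le> (1 + a * m n) + m n * v"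
        using True a m[of n] p[of n] mult_nonneg_nonneg[of "c + m n" v] by (intro mult_left_le) (auto simp: algebra_simps)
      ultimately have "b n v \<le> g n / 2 * ((1 + a * m n) + m n * v)"
        using g0[of n] by (auto intro!: mult_left_mono)
      also have "\<dots> \<le> g n * ((1 + a * m n) + m n * v)"
        using g0[of n] True a m[of n] by (intro mult_right_mono add_nonneg_nonneg) auto
      finally have "b n v \<le> g n + (a + v) * (m n * g n)" by (simp add: algebra_simps)
      moreover have "0 \<le> b n v" using f_le[of n v] by linarith
      ultimately show "norm (b n v) \<le> g n + (a + v) * (m n * g n)" by simp
    qed
  qed (simp add: b_def)
  have F: "(\<Sum>n. f n v) = indicator {0..} v * exp (- c * v / 2) / 2 * gauss_sum (a + v)" for v
  proof (cases "v \<ge> 0")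
    case True
    then have "a + v > 0" using a by simp
    from suminf_mult[OF summable_theta_tail(3)[OF this], of "indicator {0..} v * exp (- c * v / 2) / 2"]
    show ?thesis unfolding f_def m_def gauss_sum_def by simp
  qed (simp add: f_def)
  have "has_bochner_integral lborel (\<lambda>v. gauss_sum a / 2 * (indicator {0..} v * exp (- c * v / 2))) (gauss_sum a / 2 * (2 / c))"
    by (intro has_bochner_integral_mult_right has_bochner_integral_exp_atLeast c)
  moreover have "gauss_sum a / 2 * (indicator {0..} v * exp (- c * v / 2)) \<le> (\<Sum>n. f n v)" for v
  proof (cases "v \<ge> 0")
    case True
    then have "gauss_sum a \<le> gauss_sum (a + v)" using a by (intro gauss_sum_mono) auto
    then have "exp (- c * v / 2) / 2 * gauss_sum a \<le> exp (- c * v / 2) / 2 * gauss_sum (a + v)"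
      by (intro mult_left_mono) auto
    then show ?thesis unfolding F using True by (simp add: mult_ac)
  qed (simp add: F)
  moreover have "has_bochner_integral lborel (\<lambda>v::real. 0::real) 0" by (rule has_bochner_integral_zero)
  moreover have "(\<Sum>n. f n v) \<le> 0" for v
    unfolding F using a gauss_sum_nonpos[of "a + v"]
    by (cases "v \<ge> 0") (auto intro!: mult_nonneg_nonpos)
  ultimately have *: "gauss_sum a / 2 * (2 / c) \<le> suminf q" "suminf q \<le> 0"
    by (rule sums_integral_bounds(2)[OF int_f int_b f_le sB sb],
        rule sums_integral_bounds(3)[OF int_f int_b f_le sB sb])
  then show "gauss_sum a / c \<le> suminf q" "suminf q \<le> 0" by simp_all
qed

lemma has_bochner_integral_inverse_squares:
  assumes t: "t > (0::real)"
  shows "has_bochner_integral lborel (\<lambda>w. indicator {0..} w * (1 / (w\<^sup>2 + t\<^sup>2))) (pi / (2 * t))"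
    and "has_bochner_integral lborel (\<lambda>w. indicator {0..} w * (1 / (w\<^sup>2 + t\<^sup>2)\<^sup>2)) (pi / (4 * t ^ 3))"
proof -
  have pos: "w\<^sup>2 + t\<^sup>2 > 0" for w using t by (simp add: add_nonneg_pos)
  have eq: "1 + (w / t)\<^sup>2 = (w\<^sup>2 + t\<^sup>2) / t\<^sup>2" for w
    using t by (simp add: power_divide add_divide_distrib)
  have lim: "((\<lambda>w. arctan (w / t)) \<longlongrightarrow> pi / 2) at_top"
    using t by real_asymp
  have at: "((\<lambda>w. arctan (w / t)) has_real_derivative t / (w\<^sup>2 + t\<^sup>2)) (at w)" for w
  proof -
    have "((\<lambda>w. arctan (w / t)) has_real_derivative inverse (1 + (w / t)\<^sup>2) * (1 / t)) (at w)"
      using t by (auto intro!: derivative_eq_intros)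
    moreover have "inverse (1 + (w / t)\<^sup>2) * (1 / t) = t / (w\<^sup>2 + t\<^sup>2)"
    proof -
      have "t \<noteq> 0" using t by simp
      then show ?thesis unfolding eq by (simp add: power2_eq_square)
    qed
    ultimately show ?thesis by simp
  qed
  have "has_bochner_integral lborel (\<lambda>w. indicator {0..} w * (1 / (w\<^sup>2 + t\<^sup>2))) (pi / (2 * t) - arctan (0 / t) / t)"
  proof (rule has_bochner_integral_FTC_atLeast)
    show "((\<lambda>w. arctan (w / t) / t) has_real_derivative 1 / (w\<^sup>2 + t\<^sup>2)) (at w)" for w
      using DERIV_cdivide[OF at[of w], of t] t by simp
    show "((\<lambda>w. arctan (w / t) / t) \<longlongrightarrow> pi / (2 * t)) at_top"
      using tendsto_divide[OF lim tendsto_const[of t]] t by simp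
  qed (use pos in \<open>auto intro: less_imp_le\<close>)
  then show "has_bochner_integral lborel (\<lambda>w. indicator {0..} w * (1 / (w\<^sup>2 + t\<^sup>2))) (pi / (2 * t))"
    by simp
  have alg: "2 * t\<^sup>2 * (2 * t\<^sup>2 - s) / (2 * t\<^sup>2 * s)\<^sup>2 + t / s / (2 * t ^ 3) = 1 / s\<^sup>2" if "s > 0" for s
  proof -
    have "2 * t\<^sup>2 * (2 * t\<^sup>2 - s) / (2 * t\<^sup>2 * s)\<^sup>2 = (2 * t\<^sup>2 - s) / (2 * t\<^sup>2 * s\<^sup>2)"
    proof -
      have "X * Y / (X * s)\<^sup>2 = Y / (X * s\<^sup>2)" for X Y :: real
        by (simp add: power2_eq_square)
      then show ?thesis .
    qed
    also have "\<dots> = 1 / s\<^sup>2 - 1 / (2 * t\<^sup>2 * s)"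
      using that t by (simp add: diff_divide_distrib power2_eq_square)
    finally have "2 * t\<^sup>2 * (2 * t\<^sup>2 - s) / (2 * t\<^sup>2 * s)\<^sup>2 = 1 / s\<^sup>2 - 1 / (2 * t\<^sup>2 * s)" .
    moreover have "t / s / (2 * t ^ 3) = 1 / (2 * t\<^sup>2 * s)"
      using that t by (simp add: power2_eq_square power3_eq_cube)
    ultimately show ?thesis by simp
  qed
  let ?F = "\<lambda>w. w / (2 * t\<^sup>2 * (w\<^sup>2 + t\<^sup>2)) + arctan (w / t) / (2 * t ^ 3)"
  have "has_bochner_integral lborel (\<lambda>w. indicator {0..} w * (1 / (w\<^sup>2 + t\<^sup>2)\<^sup>2)) (pi / (4 * t ^ 3) - ?F 0)"
  proof (rule has_bochner_integral_FTC_atLeast)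
    show "(?F has_real_derivative 1 / (w\<^sup>2 + t\<^sup>2)\<^sup>2) (at w)" for w
    proof -
      have "((\<lambda>w. w / (2 * t\<^sup>2 * (w\<^sup>2 + t\<^sup>2))) has_real_derivative
          (1 * (2 * t\<^sup>2 * (w\<^sup>2 + t\<^sup>2)) - w * (2 * t\<^sup>2 * (2 * w))) / (2 * t\<^sup>2 * (w\<^sup>2 + t\<^sup>2))\<^sup>2) (at w)"
        using pos[of w] t by (auto intro!: derivative_eq_intros simp: power2_eq_square[of "2 * t\<^sup>2 * (w\<^sup>2 + t\<^sup>2)"])
      from DERIV_add[OF this DERIV_cdivide[OF at[of w], of "2 * t ^ 3"]]
      have "(?F has_real_derivative (1 * (2 * t\<^sup>2 * (w\<^sup>2 + t\<^sup>2)) - w * (2 * t\<^sup>2 * (2 * w))) / (2 * t\<^sup>2 * (w\<^sup>2 + t\<^sup>2))\<^sup>2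
          + t / (w\<^sup>2 + t\<^sup>2) / (2 * t ^ 3)) (at w)" .
      moreover have "(1 * (2 * t\<^sup>2 * s) - w * (2 * t\<^sup>2 * (2 * w))) / (2 * t\<^sup>2 * s)\<^sup>2 + t / s / (2 * t ^ 3) = 1 / s\<^sup>2"
        if "s = w\<^sup>2 + t\<^sup>2" for s
      proof -
        have w2: "w * w = s - t\<^sup>2" and s: "s > 0" using pos[of w] that by (simp_all add: power2_eq_square)
        have "(1 * (2 * t\<^sup>2 * s) - w * (2 * t\<^sup>2 * (2 * w))) = 2 * t\<^sup>2 * (s - 2 * (w * w))" by (simp add: algebra_simps)
        also have "\<dots> = 2 * t\<^sup>2 * (2 * t\<^sup>2 - s)" unfolding w2 by simp
        finally show ?thesis unfolding alg[OF s, symmetric] by (simp only:)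
      qed
      ultimately show ?thesis by simp
    qed
    have "((\<lambda>w. w / (2 * t\<^sup>2 * (w\<^sup>2 + t\<^sup>2))) \<longlongrightarrow> 0) at_top"
      using t by real_asymp
    from tendsto_add[OF this tendsto_divide[OF lim tendsto_const[of "2 * t ^ 3"]]]
    show "(?F \<longlongrightarrow> pi / (4 * t ^ 3)) at_top"
      using t by simp
  qed (use pos in \<open>auto intro: less_imp_le\<close>)
  then show "has_bochner_integral lborel (\<lambda>w. indicator {0..} w * (1 / (w\<^sup>2 + t\<^sup>2)\<^sup>2)) (pi / (4 * t ^ 3))"
    by simp
qed

text \<open>Expresses \<open>1 / (t + m)\<close> and \<open>1 / (t + m)^2\<close> by kernels that
  are rational in \<open>m^2\<close>. This reduces the left tail to the series of
  \<open>rational_gauss_sum_bounds\<close> with \<open>c = w^2\<close>. Partial fractions in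
  \<open>w^2\<close> divide by \<open>t^2 - m^2\<close>, whence \<open>m \<noteq> t\<close>.\<close>

lemma has_bochner_integral_stieltjes:
  assumes t: "t > (0::real)" and m: "m > 0" "m \<noteq> t"
  shows "has_bochner_integral lborel (\<lambda>w. indicator {0..} w * (w\<^sup>2 / ((w\<^sup>2 + t\<^sup>2) * (w\<^sup>2 + m\<^sup>2)))) (pi / (2 * (t + m)))"
    and "has_bochner_integral lborel (\<lambda>w. indicator {0..} w * (w\<^sup>2 / ((w\<^sup>2 + t\<^sup>2) * (w\<^sup>2 + m\<^sup>2)\<^sup>2))) (pi / (4 * m * (t + m)\<^sup>2))"
proof -
  have ne: "t\<^sup>2 - m\<^sup>2 \<noteq> 0" "t + m \<noteq> 0" "t - m \<noteq> 0"
    using m t by (auto simp: power2_eq_iff_nonneg)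
  have pos: "w\<^sup>2 + t\<^sup>2 > 0" "w\<^sup>2 + m\<^sup>2 > 0" for w using t m by (simp_all add: add_nonneg_pos)
  have fac: "t\<^sup>2 - m\<^sup>2 = (t - m) * (t + m)" by (simp add: algebra_simps power2_eq_square)
  \<comment> \<open>Here \<open>x\<close> stands for \<open>w^2\<close>; the second decomposition is
    the first one times \<open>1 / (x + M)\<close>, with the mixed product expanded once
    more.\<close>
  have pf: "x / ((x + T) * (x + M)) = (T * (1 / (x + T)) - M * (1 / (x + M))) / (T - M)"
    "x / ((x + T) * (x + M)\<^sup>2) = (T * ((1 / (x + M) - 1 / (x + T)) / (T - M)) - M * (1 / (x + M)\<^sup>2)) / (T - M)"
    if "x + T \<noteq> 0" "x + M \<noteq> 0" "T - M \<noteq> 0" for x T M :: real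
  proof -
    have "T / (x + T) - M / (x + M) = (T - M) * (x / ((x + T) * (x + M)))"
      using that by (simp add: field_simps)
    then show 1: "x / ((x + T) * (x + M)) = (T * (1 / (x + T)) - M * (1 / (x + M))) / (T - M)"
      using that by simp
    have "1 / (x + M) - 1 / (x + T) = (T - M) / ((x + T) * (x + M))"
      using that by (simp add: field_simps)
    then have "(1 / (x + M) - 1 / (x + T)) / (T - M) = 1 / ((x + T) * (x + M))"
      using that by simp
    moreover have "x / ((x + T) * (x + M)\<^sup>2) = (x / ((x + T) * (x + M))) * (1 / (x + M))"
      by (simp add: power2_eq_square)
    moreover have "\<dots> = (T * (1 / ((x + T) * (x + M))) - M * (1 / (x + M)\<^sup>2)) / (T - M)"
    proof -
      have "(T * p - M * r) / D * r = (T * (p * r) - M * r\<^sup>2) / D" for p r D :: real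
        by (simp add: algebra_simps power2_eq_square)
      from this[of "1 / (x + T)" "1 / (x + M)" "T - M"] show ?thesis
        unfolding 1 by (simp add: power_divide)
    qed
    ultimately show "x / ((x + T) * (x + M)\<^sup>2) = (T * ((1 / (x + M) - 1 / (x + T)) / (T - M)) - M * (1 / (x + M)\<^sup>2)) / (T - M)"
      by (simp only:)
  qed
  note ints = has_bochner_integral_inverse_squares[OF t] has_bochner_integral_inverse_squares[OF m(1)]
  have "has_bochner_integral lborel (\<lambda>w. (t\<^sup>2 * (indicator {0..} w * (1 / (w\<^sup>2 + t\<^sup>2))) - m\<^sup>2 * (indicator {0..} w * (1 / (w\<^sup>2 + m\<^sup>2)))) / (t\<^sup>2 - m\<^sup>2))
      ((t\<^sup>2 * (pi / (2 * t)) - m\<^sup>2 * (pi / (2 * m))) / (t\<^sup>2 - m\<^sup>2))"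
    by (intro has_bochner_integral_divide has_bochner_integral_diff has_bochner_integral_mult_right ints)
  moreover have "(t\<^sup>2 * (indicator {0..} w * (1 / (w\<^sup>2 + t\<^sup>2))) - m\<^sup>2 * (indicator {0..} w * (1 / (w\<^sup>2 + m\<^sup>2)))) / (t\<^sup>2 - m\<^sup>2)
      = indicator {0..} w * (w\<^sup>2 / ((w\<^sup>2 + t\<^sup>2) * (w\<^sup>2 + m\<^sup>2)))" for w
    by (subst pf(1)[OF pos(1)[of w, THEN less_imp_neq, symmetric] pos(2)[of w, THEN less_imp_neq, symmetric] ne(1)])
       (simp split: split_indicator)
  moreover have "(t\<^sup>2 * (pi / (2 * t)) - m\<^sup>2 * (pi / (2 * m))) / (t\<^sup>2 - m\<^sup>2) = pi / (2 * (t + m))"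
  proof -
    have "t\<^sup>2 * (pi / (2 * t)) - m\<^sup>2 * (pi / (2 * m)) = pi / 2 * (t - m)"
      using t m by (simp add: power2_eq_square right_diff_distrib mult.commute)
    from this[THEN arg_cong, of "\<lambda>u. u / (t\<^sup>2 - m\<^sup>2)"]
    have "(t\<^sup>2 * (pi / (2 * t)) - m\<^sup>2 * (pi / (2 * m))) / (t\<^sup>2 - m\<^sup>2) = pi / 2 * (t - m) / ((t - m) * (t + m))"
      by (simp only: fac)
    also have "\<dots> = pi / (2 * (t + m))" unfolding mult.commute[of "pi / 2"] using ne(3)
      by (subst nonzero_mult_divide_mult_cancel_left) simp_all
    finally show ?thesis .
  qed
  ultimately show "has_bochner_integral lborel (\<lambda>w. indicator {0..} w * (w\<^sup>2 / ((w\<^sup>2 + t\<^sup>2) * (w\<^sup>2 + m\<^sup>2)))) (pi / (2 * (t + m)))"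
    by (simp only:)
  have "has_bochner_integral lborel (\<lambda>w. (t\<^sup>2 * ((indicator {0..} w * (1 / (w\<^sup>2 + m\<^sup>2)) - indicator {0..} w * (1 / (w\<^sup>2 + t\<^sup>2))) / (t\<^sup>2 - m\<^sup>2))
        - m\<^sup>2 * (indicator {0..} w * (1 / (w\<^sup>2 + m\<^sup>2)\<^sup>2))) / (t\<^sup>2 - m\<^sup>2))
      ((t\<^sup>2 * ((pi / (2 * m) - pi / (2 * t)) / (t\<^sup>2 - m\<^sup>2)) - m\<^sup>2 * (pi / (4 * m ^ 3))) / (t\<^sup>2 - m\<^sup>2))"
    by (intro has_bochner_integral_divide has_bochner_integral_diff has_bochner_integral_mult_right ints)
  moreover have "(t\<^sup>2 * ((indicator {0..} w * (1 / (w\<^sup>2 + m\<^sup>2)) - indicator {0..} w * (1 / (w\<^sup>2 + t\<^sup>2))) / (t\<^sup>2 - m\<^sup>2))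
        - m\<^sup>2 * (indicator {0..} w * (1 / (w\<^sup>2 + m\<^sup>2)\<^sup>2))) / (t\<^sup>2 - m\<^sup>2)
      = indicator {0..} w * (w\<^sup>2 / ((w\<^sup>2 + t\<^sup>2) * (w\<^sup>2 + m\<^sup>2)\<^sup>2))" for w
    by (subst pf(2)[OF pos(1)[of w, THEN less_imp_neq, symmetric] pos(2)[of w, THEN less_imp_neq, symmetric] ne(1)])
       (simp split: split_indicator)
  moreover have "(t\<^sup>2 * ((pi / (2 * m) - pi / (2 * t)) / (t\<^sup>2 - m\<^sup>2)) - m\<^sup>2 * (pi / (4 * m ^ 3))) / (t\<^sup>2 - m\<^sup>2) = pi / (4 * m * (t + m)\<^sup>2)"
  proof -
    have "pi / (2 * m) - pi / (2 * t) = (t - m) * (pi / (2 * m * t))"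
      using t m by (simp add: field_simps)
    then have "(pi / (2 * m) - pi / (2 * t)) / (t\<^sup>2 - m\<^sup>2) = pi / (2 * m * t * (t + m))"
      unfolding fac by (simp only: nonzero_mult_divide_mult_cancel_left[OF ne(3)]) simp
    then have "t\<^sup>2 * ((pi / (2 * m) - pi / (2 * t)) / (t\<^sup>2 - m\<^sup>2)) - m\<^sup>2 * (pi / (4 * m ^ 3))
        = t * pi / (2 * m * (t + m)) - pi / (4 * m)"
      using t m ne by (simp add: power2_eq_square power3_eq_cube)
    also have "\<dots> = (t - m) * (pi / (4 * m * (t + m)))"
    proof -
      define K where "K = pi / (4 * m * (t + m))"
      have "t * pi / (2 * m * (t + m)) = 2 * t * K" "pi / (4 * m) = (t + m) * K"
      proof -
        have "t * pi / (2 * m * S) = 2 * t * (pi / (4 * m * S))" "pi / (4 * m) = S * (pi / (4 * m * S))"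
          if "S \<noteq> 0" for S :: real
          using m(1) that by (simp_all add: mult_ac)
        from this[OF ne(2)] show "t * pi / (2 * m * (t + m)) = 2 * t * K" "pi / (4 * m) = (t + m) * K"
          unfolding K_def .
      qed
      then show ?thesis unfolding K_def[symmetric] by (simp add: algebra_simps)
    qed
    finally have e: "t\<^sup>2 * ((pi / (2 * m) - pi / (2 * t)) / (t\<^sup>2 - m\<^sup>2)) - m\<^sup>2 * (pi / (4 * m ^ 3)) = (t - m) * (pi / (4 * m * (t + m)))" .
    show ?thesis
      unfolding e unfolding fac nonzero_mult_divide_mult_cancel_left[OF ne(3)]
      by (simp add: power2_eq_square mult_ac)
  qed
  ultimately show "has_bochner_integral lborel (\<lambda>w. indicator {0..} w * (w\<^sup>2 / ((w\<^sup>2 + t\<^sup>2) * (w\<^sup>2 + m\<^sup>2)\<^sup>2))) (pi / (4 * m * (t + m)\<^sup>2))"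
    by (simp only:)
qed

text \<open>By \<open>t / (t + n)^2 = 1 / (t + n) - n / (t + n)^2\<close> and the Stieltjes
  integrals, the series is the integral over \<open>w > 0\<close> of
  \<open>2 / pi * w^2 / (w^2 + t^2)\<close> times the series of
  \<open>rational_gauss_sum_bounds\<close> at \<open>c = w^2\<close>. The lower bound
  \<open>gauss_sum a / w^2\<close> of the latter cancels \<open>w^2\<close>, and
  \<open>2 / pi / (w^2 + t^2)\<close> has integral \<open>1 / t\<close>. Divided by
  \<open>t\<close>, this is the series in \<open>L_plus\<close> at the point
  \<open>- t\<close>.\<close>

lemma left_tail_bounds:
  fixes a t :: real
  assumes a: "a > 0" and t: "t > 0" "t \<notin> \<int>"
  defines "v \<equiv> \<lambda>n. exp (- a * (real (Suc n))\<^sup>2 / 2) * (t / (t + real (Suc n))\<^sup>2 - a * (real (Suc n))\<^sup>2 / (t + real (Suc n)))"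
  shows "summable v" "gauss_sum a / t \<le> suminf v" "suminf v \<le> 0"
proof -
  define m where "m n = real (Suc n)" for n
  define g where "g n = exp (- a * (m n)\<^sup>2 / 2)" for n
  define J where "J n w = indicator {0..} w * (w\<^sup>2 / ((w\<^sup>2 + t\<^sup>2) * (w\<^sup>2 + (m n)\<^sup>2)))" for n w
  define J2 where "J2 n w = indicator {0..} w * (w\<^sup>2 / ((w\<^sup>2 + t\<^sup>2) * (w\<^sup>2 + (m n)\<^sup>2)\<^sup>2))" for n w
  define f where "f n w = 2 / pi * (g n * ((1 - a * (m n)\<^sup>2) * J n w - 2 * (m n)\<^sup>2 * J2 n w))" for n w
  define b where "b n w = 2 / pi * (g n * (3 + a * (m n)\<^sup>2) * J n w)" for n w
  define B where "B n = 2 / pi * (g n * (3 + a * (m n)\<^sup>2) * (pi / (2 * (t + m n))))" for n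
  have m: "m n \<ge> 1" for n by (simp add: m_def)
  have mt: "m n \<noteq> t" for n
    using t(2) Ints_of_nat[of "Suc n"] by (auto simp: m_def simp del: of_nat_Suc)
  have g0: "0 \<le> g n" for n by (simp add: g_def)
  have m0: "m n > 0" for n using m[of n] by linarith
  note ints = has_bochner_integral_stieltjes[OF t(1) m0 mt, folded J_def J2_def]
  have v_eq: "v n = 2 / pi * (g n * ((1 - a * (m n)\<^sup>2) * (pi / (2 * (t + m n))) - 2 * (m n)\<^sup>2 * (pi / (4 * m n * (t + m n)\<^sup>2))))" for n
  proof -
    have s: "t + m n \<noteq> 0" "m n \<noteq> 0" using m[of n] t by auto
    have "t / (t + m n)\<^sup>2 = 1 / (t + m n) - m n / (t + m n)\<^sup>2"
    proof -
      have "1 / (t + m n) = (t + m n) / (t + m n)\<^sup>2" using s(1) by (simp add: power2_eq_square)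
      then show ?thesis by (simp add: add_divide_distrib)
    qed
    moreover have "2 / pi * (g n * ((1 - a * (m n)\<^sup>2) * (pi / (2 * (t + m n))) - 2 * (m n)\<^sup>2 * (pi / (4 * m n * (t + m n)\<^sup>2))))
      = g n * ((1 - a * (m n)\<^sup>2) / (t + m n) - m n / (t + m n)\<^sup>2)"
    proof -
      have "2 / pi * (A * (X * (pi / (2 * S)) - 2 * M\<^sup>2 * (pi / (4 * M * T)))) = A * (X / S - M / T)" if "M \<noteq> 0"
        for A X S M T :: real
        using that by (simp add: power2_eq_square right_diff_distrib)
      then show ?thesis using s(2) .
    qed
    moreover have "v n = g n * (t / (t + m n)\<^sup>2 - a * (m n)\<^sup>2 / (t + m n))"
      by (simp only: v_def g_def m_def)
    ultimately show ?thesis by (simp add: diff_divide_distrib left_diff_distrib right_diff_distrib)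
  qed
  have int_f: "has_bochner_integral lborel (f n) (v n)" for n
    unfolding f_def[abs_def] v_eq
    by (intro has_bochner_integral_mult_right has_bochner_integral_diff ints[unfolded J_def[symmetric] J2_def[symmetric]])
  have int_b: "has_bochner_integral lborel (b n) (B n)" for n
    unfolding b_def[abs_def] B_def
    by (intro has_bochner_integral_mult_right ints)
  have pos: "w\<^sup>2 + t\<^sup>2 > 0" "w\<^sup>2 + (m n)\<^sup>2 > 0" for w n
    using t m[of n] by (simp_all add: add_nonneg_pos)
  have J0: "0 \<le> J n w" for n w
    using pos(1)[of w] pos(2)[of w n] by (auto simp: J_def intro!: mult_nonneg_nonneg divide_nonneg_pos mult_pos_pos)
  have J2_eq: "J2 n w = J n w * (1 / (w\<^sup>2 + (m n)\<^sup>2))" for n w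
    by (simp add: J_def J2_def power2_eq_square)
  have f_le: "\<bar>f n w\<bar> \<le> b n w" for n w
  proof -
    have e: "f n w = 2 / pi * (g n * ((1 - a * (m n)\<^sup>2 - 2 * ((m n)\<^sup>2 / (w\<^sup>2 + (m n)\<^sup>2))) * J n w))"
      unfolding f_def J2_eq by (simp add: algebra_simps)
    have r: "0 \<le> (m n)\<^sup>2 / (w\<^sup>2 + (m n)\<^sup>2)" "(m n)\<^sup>2 / (w\<^sup>2 + (m n)\<^sup>2) \<le> 1"
      using pos(2)[of w n] by (auto simp: divide_le_eq)
    have am: "0 \<le> a * (m n)\<^sup>2" using a by simp
    have "\<bar>1 - a * (m n)\<^sup>2 - 2 * ((m n)\<^sup>2 / (w\<^sup>2 + (m n)\<^sup>2))\<bar> \<le> 3 + a * (m n)\<^sup>2"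
      using r am by (intro abs_leI) linarith+
    then have "2 / pi * (g n * (\<bar>1 - a * (m n)\<^sup>2 - 2 * ((m n)\<^sup>2 / (w\<^sup>2 + (m n)\<^sup>2))\<bar> * J n w))
        \<le> 2 / pi * (g n * ((3 + a * (m n)\<^sup>2) * J n w))"
      using g0[of n] J0[of n w] by (intro mult_left_mono mult_right_mono) auto
    moreover have "\<bar>f n w\<bar> = 2 / pi * (g n * (\<bar>1 - a * (m n)\<^sup>2 - 2 * ((m n)\<^sup>2 / (w\<^sup>2 + (m n)\<^sup>2))\<bar> * J n w))"
      unfolding e using g0[of n] J0[of n w] by (simp only: abs_mult) simp
    ultimately show ?thesis unfolding b_def by (simp only: mult.assoc)
  qed
  have gm: "summable (\<lambda>n. g n)" "summable (\<lambda>n. (m n)\<^sup>2 * g n)"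
    unfolding g_def m_def by (rule summable_theta_tail[OF a])+
  have sg: "summable (\<lambda>n. 3 * g n + a * ((m n)\<^sup>2 * g n))"
    by (intro summable_add summable_mult gm)
  have geq: "g n * (3 + a * (m n)\<^sup>2) = 3 * g n + a * ((m n)\<^sup>2 * g n)" for n
    by (simp add: algebra_simps)
  have gge: "0 \<le> 3 * g n + a * ((m n)\<^sup>2 * g n)" for n using g0[of n] a by auto
  have sB: "summable B"
  proof (rule summable_comparison_test'[OF sg])
    fix n
    have "B n = (3 * g n + a * ((m n)\<^sup>2 * g n)) * (1 / (t + m n))"
    proof -
      have "2 / pi * (X * (pi / (2 * S))) = X * (1 / S)" for X S :: real by simp
      then show ?thesis unfolding B_def geq .
    qed
    moreover have "1 / (t + m n) \<le> 1" "0 \<le> 1 / (t + m n)" using t m[of n] by (auto simp: divide_le_eq)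
    ultimately show "norm (B n) \<le> 3 * g n + a * ((m n)\<^sup>2 * g n)"
      using gge[of n] mult_left_le[of "1 / (t + m n)" "3 * g n + a * ((m n)\<^sup>2 * g n)"]
        mult_nonneg_nonneg[of "3 * g n + a * ((m n)\<^sup>2 * g n)" "1 / (t + m n)"]
      by (simp only: real_norm_def abs_of_nonneg)
  qed
  have sb: "summable (\<lambda>n. b n w)" for w
  proof (rule summable_comparison_test'[OF sg])
    fix n
    have "1 \<le> w\<^sup>2 + (m n)\<^sup>2" using m[of n] power_mono[of 1 "m n" 2] by (intro add_increasing) auto
    then have i: "1 / (w\<^sup>2 + (m n)\<^sup>2) \<le> 1" "0 \<le> 1 / (w\<^sup>2 + (m n)\<^sup>2)" by (auto simp: divide_le_eq)
    have ii: "w\<^sup>2 / (w\<^sup>2 + t\<^sup>2) \<le> 1" "0 \<le> w\<^sup>2 / (w\<^sup>2 + t\<^sup>2)" using pos(1)[of w] by (auto simp: divide_le_eq)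
    have "J n w = indicator {0..} w * ((w\<^sup>2 / (w\<^sup>2 + t\<^sup>2)) * (1 / (w\<^sup>2 + (m n)\<^sup>2)))"
      by (simp add: J_def)
    also have "\<dots> \<le> 1" using i ii by (intro mult_le_one mult_nonneg_nonneg) (auto simp: indicator_def)
    finally have J1: "J n w \<le> 1" .
    have "2 / pi * J n w \<le> 1" using J1 J0[of n w] pi_ge_two by (simp add: divide_le_eq)
    then have "(3 * g n + a * ((m n)\<^sup>2 * g n)) * (2 / pi * J n w) \<le> 3 * g n + a * ((m n)\<^sup>2 * g n)"
      using gge[of n] by (intro mult_left_le)
    moreover have "b n w = (3 * g n + a * ((m n)\<^sup>2 * g n)) * (2 / pi * J n w)"
      unfolding b_def geq by (simp only: mult_ac)
    ultimately show "norm (b n w) \<le> 3 * g n + a * ((m n)\<^sup>2 * g n)"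
      using f_le[of n w] by simp
  qed
  define q where "q c n = g n * ((1 - a * (m n)\<^sup>2) / (c + (m n)\<^sup>2) - 2 * (m n)\<^sup>2 / (c + (m n)\<^sup>2)\<^sup>2)" for c n
  have qb: "gauss_sum a / c \<le> suminf (q c)" "suminf (q c) \<le> 0" if "c > 0" for c
    using rational_gauss_sum_bounds[OF a that] unfolding q_def g_def m_def by simp_all
  have fq: "f n w = 2 / pi * (w\<^sup>2 / (w\<^sup>2 + t\<^sup>2)) * q (w\<^sup>2) n" if "w > 0" for n w
  proof -
    have "2 / pi * (G * (X * (1 * (W / (A * B))) - Y * (1 * (W / (A * B\<^sup>2))))) = 2 / pi * (W / A) * (G * (X / B - Y / B\<^sup>2))"
      for A B G W X Y :: real
      by (simp add: right_diff_distrib mult_ac)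
    moreover have "indicator {0..} w = (1::real)" using that by simp
    ultimately show ?thesis unfolding f_def J_def J2_def q_def by (simp only: add.commute)
  qed
  have F: "(\<Sum>n. f n w) = 2 / pi * (w\<^sup>2 / (w\<^sup>2 + t\<^sup>2)) * suminf (q (w\<^sup>2))" if "w > 0" for w
  proof -
    have "summable (\<lambda>n. f n w)"
      using f_le by (intro summable_comparison_test'[OF sb]) auto
    then have "summable (\<lambda>n. 2 / pi * (w\<^sup>2 / (w\<^sup>2 + t\<^sup>2)) * q (w\<^sup>2) n)" unfolding fq[OF that] .
    then have "summable (q (w\<^sup>2))"
      using that pos(1)[of w] by (subst (asm) summable_cmult_iff) auto
    then show ?thesis unfolding fq[OF that] by (rule suminf_mult)
  qed
  \<comment> \<open>At \<open>w = 0\<close> the parameter \<open>c\<close> would not be positive,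
    but the factor \<open>w^2\<close> makes the integrand vanish there.\<close>
  have F0: "(\<Sum>n. f n w) = 0" if "\<not> w > 0" for w
    using that by (cases "w = 0") (auto simp: f_def J_def J2_def)
  have gs: "gauss_sum a \<le> 0" by (rule gauss_sum_nonpos[OF a])
  have "has_bochner_integral lborel (\<lambda>w. 2 / pi * gauss_sum a * (indicator {0..} w * (1 / (w\<^sup>2 + t\<^sup>2)))) (2 / pi * gauss_sum a * (pi / (2 * t)))"
    by (intro has_bochner_integral_mult_right has_bochner_integral_inverse_squares t)
  moreover have "2 / pi * gauss_sum a * (indicator {0..} w * (1 / (w\<^sup>2 + t\<^sup>2))) \<le> (\<Sum>n. f n w)" for w
  proof (cases "w > 0")
    case True
    have "2 / pi * (w\<^sup>2 / (w\<^sup>2 + t\<^sup>2)) * (gauss_sum a / w\<^sup>2) \<le> 2 / pi * (w\<^sup>2 / (w\<^sup>2 + t\<^sup>2)) * suminf (q (w\<^sup>2))"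
      using pos(1)[of w] True by (intro mult_left_mono qb) auto
    then show ?thesis unfolding F[OF True] using True by (simp add: mult_ac)
  next
    case False
    have "2 / pi * gauss_sum a \<le> 0" using gs by (intro mult_nonneg_nonpos) auto
    then have "2 / pi * gauss_sum a * (indicator {0..} w * (1 / (w\<^sup>2 + t\<^sup>2))) \<le> 0"
      by (rule mult_nonpos_nonneg) auto
    then show ?thesis unfolding F0[OF False] .
  qed
  moreover have "has_bochner_integral lborel (\<lambda>w::real. 0::real) 0" by (rule has_bochner_integral_zero)
  moreover have "(\<Sum>n. f n w) \<le> 0" for w
  proof (cases "w > 0")
    case True
    then show ?thesis unfolding F[OF True] using pos(1)[of w] qb(2)[of "w\<^sup>2"]
      by (intro mult_nonneg_nonpos) auto
  qed (simp add: F0)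
  ultimately have *: "summable v" "2 / pi * gauss_sum a * (pi / (2 * t)) \<le> suminf v" "suminf v \<le> 0"
    by (rule sums_integral_bounds[OF int_f int_b f_le sB sb])+
  then show "summable v" "gauss_sum a / t \<le> suminf v" "suminf v \<le> 0" by simp_all
qed

text \<open>The number \<open>- I n\<close> is the integral over \<open>0 < v < a\<close> of
  \<open>exp (- (a - v) * x^2 / 2)\<close> times term \<open>n\<close> of
  \<open>gauss_sum v\<close>. So \<open>- suminf I\<close> integrates \<open>gauss_sum v\<close>
  against a positive kernel of mass \<open>2 * (1 - exp (- a * x^2 / 2)) / x^2\<close>, and the
  bounds come from \<open>- 1 / 2 \<le> gauss_sum v \<le> gauss_sum a\<close>.\<close>

lemma tilted_gauss_sum_bounds:
  fixes a x :: real
  assumes a: "a > 0" and x: "x > 0" "x \<notin> \<int>"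
  defines "I \<equiv> \<lambda>n. exp (- a * x\<^sup>2 / 2) * (1 / (x - real (Suc n))\<^sup>2 + 1 / (x + real (Suc n))\<^sup>2)
     - exp (- a * (real (Suc n))\<^sup>2 / 2) * (1 / (x - real (Suc n))\<^sup>2 + 1 / (x + real (Suc n))\<^sup>2
         - 2 * a * (real (Suc n))\<^sup>2 / (x\<^sup>2 - (real (Suc n))\<^sup>2))"
  shows "summable I" "suminf I \<le> (1 - exp (- a * x\<^sup>2 / 2)) / x\<^sup>2"
    and "- suminf I \<le> 2 * gauss_sum a * (1 - exp (- a * x\<^sup>2 / 2)) / x\<^sup>2"
proof -
  define m where "m n = real (Suc n)" for n
  define Ex where "Ex = exp (- a * x\<^sup>2 / 2)"
  define f where "f n v = indicator {0<..<a} v * exp (- (a - v) * x\<^sup>2 / 2) * ((1 - v * (m n)\<^sup>2) * exp (- v * (m n)\<^sup>2 / 2))" for n v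
  \<comment> \<open>The interval is open at 0, since the terms at \<open>v = 0\<close> would all be
    1 and not summable. On the whole half-line the integral of \<open>b n\<close> is
    \<open>6 / (m n)^2\<close>, which is summable.\<close>
  define b where "b n v = indicator {0<..} v * ((1 + v * (m n)\<^sup>2) * exp (- v * (m n)\<^sup>2 / 2))" for n and v :: real
  have m: "m n \<ge> 1" for n by (simp add: m_def)
  have mx: "m n \<noteq> x" for n
    using x(2) Ints_of_nat[of "Suc n"] by (auto simp: m_def simp del: of_nat_Suc)
  have m2: "(m n)\<^sup>2 \<ge> 1" for n using m[of n] power_mono[of 1 "m n" 2] by simp
  have Ico: "has_bochner_integral lborel (\<lambda>v. indicator {0<..} v * h v) c"
    if "has_bochner_integral lborel (\<lambda>v. indicator {0..} v * h v) c" "h \<in> borel_measurable borel" for h :: "real \<Rightarrow> real" and c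
  proof -
    have "AE v in lborel. v \<noteq> (0::real)" by (rule AE_lborel_singleton)
    then have "AE v in lborel. indicator {0<..} v * h v = indicator {0..} v * h v"
      by eventually_elim (auto simp: indicator_def)
    then show ?thesis
      using that by (subst has_bochner_integral_cong_AE[where g = "\<lambda>v. indicator {0..} v * h v"]) auto
  qed
  have Icc: "has_bochner_integral lborel (\<lambda>v. indicator {0<..<a} v * h v) (H a - H 0)"
    if "\<And>v. (H has_real_derivative h v) (at v)" "\<And>v. isCont h v" for h H :: "real \<Rightarrow> real"
  proof -
    have hm[measurable]: "h \<in> borel_measurable borel"
      using that(2) by (intro borel_measurable_continuous_onI) (simp add: continuous_on_eq_continuous_at)
    have "has_bochner_integral lborel (\<lambda>v. h v * indicator {0..a} v) (H a - H 0)"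
      using a by (intro has_bochner_integral_FTC_Icc_real that) auto
    moreover have "AE v in lborel. v \<noteq> (0::real)" "AE v in lborel. v \<noteq> a" by (rule AE_lborel_singleton)+
    then have "AE v in lborel. indicator {0<..<a} v * h v = h v * indicator {0..a} v"
      by eventually_elim (auto simp: indicator_def)
    ultimately show ?thesis
      by (subst has_bochner_integral_cong_AE[where g = "\<lambda>v. h v * indicator {0..a} v"]) auto
  qed
  have int_b: "has_bochner_integral lborel (b n) (2 / (m n)\<^sup>2 + (m n)\<^sup>2 * (4 / ((m n)\<^sup>2)\<^sup>2))" for n
  proof -
    have p: "(m n)\<^sup>2 > 0" using m2[of n] by linarith
    have "has_bochner_integral lborel (\<lambda>v. indicator {0<..} v * exp (- (m n)\<^sup>2 * v / 2) + (m n)\<^sup>2 * (indicator {0<..} v * (v * exp (- (m n)\<^sup>2 * v / 2))))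
       (2 / (m n)\<^sup>2 + (m n)\<^sup>2 * (4 / ((m n)\<^sup>2)\<^sup>2))"
      by (intro has_bochner_integral_add has_bochner_integral_mult_right Ico has_bochner_integral_exp_atLeast p) auto
    moreover have "b n v = indicator {0<..} v * exp (- (m n)\<^sup>2 * v / 2) + (m n)\<^sup>2 * (indicator {0<..} v * (v * exp (- (m n)\<^sup>2 * v / 2)))" for v
    proof -
      have "exp (- v * (m n)\<^sup>2 / 2) = exp (- (m n)\<^sup>2 * v / 2)" by (simp add: mult.commute)
      then show ?thesis unfolding b_def by (simp only:) (simp add: algebra_simps)
    qed
    ultimately show ?thesis by (simp only: b_def[abs_def])
  qed
  have f_le: "\<bar>f n v\<bar> \<le> b n v" for n v
  proof (cases "v \<in> {0<..<a}")
    case True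
    then have v: "0 < v" "v < a" by auto
    have "\<bar>1 - v * (m n)\<^sup>2\<bar> \<le> 1 + v * (m n)\<^sup>2" using v by (intro abs_leI) auto
    moreover have "exp (- (a - v) * x\<^sup>2 / 2) \<le> 1" using v by (auto intro!: mult_nonpos_nonneg)
    ultimately have "exp (- (a - v) * x\<^sup>2 / 2) * (\<bar>1 - v * (m n)\<^sup>2\<bar> * exp (- v * (m n)\<^sup>2 / 2))
        \<le> 1 * ((1 + v * (m n)\<^sup>2) * exp (- v * (m n)\<^sup>2 / 2))"
      by (intro mult_mono mult_right_mono) auto
    then show ?thesis using v by (simp add: f_def b_def abs_mult)
  next
    case False
    have "0 \<le> b n v" by (auto simp: b_def indicator_def intro!: mult_nonneg_nonneg add_nonneg_nonneg)
    then show ?thesis using False by (simp add: f_def)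
  qed
  have I_eq: "- I n = exp (- a * (m n)\<^sup>2 / 2) * ((1 - a * (m n)\<^sup>2) / k + (m n)\<^sup>2 / k\<^sup>2) - Ex * (1 / k + (m n)\<^sup>2 / k\<^sup>2)"
    if k: "k = (x\<^sup>2 - (m n)\<^sup>2) / 2" for n k
  proof -
    define y where "y = m n"
    have s: "x - y \<noteq> 0" "x + y \<noteq> 0" using mx[of n] m[of n] x by (auto simp: y_def)
    have k2: "k = (x - y) * (x + y) / 2" by (simp add: k y_def power2_eq_square algebra_simps)
    have kne: "k \<noteq> 0" using s by (simp add: k2)
    have 1: "1 / k + y\<^sup>2 / k\<^sup>2 = (k + y\<^sup>2) / k\<^sup>2" using kne by (simp add: power2_eq_square field_simps)
    have 2: "k + y\<^sup>2 = ((x + y)\<^sup>2 + (x - y)\<^sup>2) / 4"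
      by (simp add: k y_def power2_eq_square algebra_simps diff_divide_distrib)
    have 3: "k\<^sup>2 = (x - y)\<^sup>2 * (x + y)\<^sup>2 / 4" by (simp add: k2 power_divide power_mult_distrib)
    have e: "1 / k + y\<^sup>2 / k\<^sup>2 = 1 / (x - y)\<^sup>2 + 1 / (x + y)\<^sup>2"
      unfolding 1 unfolding 2 3 using s by (simp add: add_divide_distrib)
    have e2: "(1 - a * y\<^sup>2) / k + y\<^sup>2 / k\<^sup>2 = (1 / (x - y)\<^sup>2 + 1 / (x + y)\<^sup>2) - 2 * a * y\<^sup>2 / (x\<^sup>2 - y\<^sup>2)"
    proof -
      have "a * Y / (D / 2) = 2 * a * Y / D" for Y D :: real by simp
      then have "a * y\<^sup>2 / k = 2 * a * y\<^sup>2 / (x\<^sup>2 - y\<^sup>2)" unfolding k y_def .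
      then show ?thesis unfolding e[symmetric] by (simp add: diff_divide_distrib)
    qed
    show ?thesis unfolding I_def m_def[symmetric] y_def[symmetric] e e2 Ex_def by simp
  qed
  have int_f: "has_bochner_integral lborel (f n) (- I n)" for n
  proof -
    define k where "k = (x\<^sup>2 - (m n)\<^sup>2) / 2"
    define y where "y = (m n)\<^sup>2"
    have kne: "k \<noteq> 0" using mx[of n] m[of n] x by (auto simp: k_def power2_eq_iff_nonneg)
    \<comment> \<open>The two exponentials in \<open>f n v\<close> multiply to
      \<open>Ex * exp (k * v)\<close>, and \<open>H\<close> is an antiderivative. Division by
      \<open>k\<close> is possible because \<open>x\<close> is positive and not an integer.\<close>
    define H where "H v = Ex * (exp (k * v) * ((1 - v * y) / k + y / k\<^sup>2))" for v
    have "(H has_real_derivative (Ex * ((1 - v * y) * exp (k * v)))) (at v)" for v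
    proof -
      have "(H has_real_derivative Ex * (exp (k * v) * k * ((1 - v * y) / k + y / k\<^sup>2) + exp (k * v) * (- y / k))) (at v)"
        unfolding H_def using kne by (auto intro!: derivative_eq_intros)
      moreover have "Ex * (exp (k * v) * k * ((1 - v * y) / k + y / k\<^sup>2) + exp (k * v) * (- y / k)) = Ex * ((1 - v * y) * exp (k * v))"
        using kne by (simp add: distrib_left power2_eq_square)
      ultimately show ?thesis by (simp only:)
    qed
    then have "has_bochner_integral lborel (\<lambda>v. indicator {0<..<a} v * (Ex * ((1 - v * y) * exp (k * v)))) (H a - H 0)"
      by (intro Icc) (auto intro!: continuous_intros)
    moreover have "indicator {0<..<a} v * (Ex * ((1 - v * y) * exp (k * v))) = f n v" for v
    proof -
      have "Ex * exp (k * v) = exp (- (a - v) * x\<^sup>2 / 2) * exp (- v * y / 2)"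
        unfolding Ex_def exp_add[symmetric] by (simp add: k_def y_def field_simps)
      then show ?thesis unfolding f_def y_def[symmetric] by (simp add: mult_ac)
    qed
    moreover have "H a - H 0 = - I n"
    proof -
      have "Ex * exp (k * a) = exp (- a * y / 2)"
        unfolding Ex_def exp_add[symmetric] by (simp add: k_def y_def field_simps)
      then show ?thesis unfolding I_eq[OF k_def] y_def[symmetric] H_def by (simp add: mult.assoc[symmetric])
    qed
    ultimately show ?thesis by simp
  qed
  have sB: "summable (\<lambda>n. 2 / (m n)\<^sup>2 + (m n)\<^sup>2 * (4 / ((m n)\<^sup>2)\<^sup>2))"
  proof -
    have "summable (\<lambda>n. 1 / (m n)\<^sup>2)"
      using inverse_squares_sums by (simp add: m_def sums_iff add.commute)
    then have "summable (\<lambda>n. 6 * (1 / (m n)\<^sup>2))" by (rule summable_mult)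
    moreover have "6 * (1 / (m n)\<^sup>2) = 2 / (m n)\<^sup>2 + (m n)\<^sup>2 * (4 / ((m n)\<^sup>2)\<^sup>2)" for n
    proof -
      have "6 * (1 / M) = 2 / M + M * (4 / M\<^sup>2)" if "M \<noteq> 0" for M :: real
        using that by (simp add: power2_eq_square)
      moreover have "(m n)\<^sup>2 \<noteq> 0" using m2[of n] by auto
      ultimately show ?thesis .
    qed
    ultimately show ?thesis by simp
  qed
  have sb: "summable (\<lambda>n. b n v)" for v
  proof (cases "v > 0")
    case True
    have "summable (\<lambda>n. exp (- v * (m n)\<^sup>2 / 2) + v * ((m n)\<^sup>2 * exp (- v * (m n)\<^sup>2 / 2)))"
      unfolding m_def by (intro summable_add summable_mult summable_theta_tail True)
    moreover have "b n v = exp (- v * (m n)\<^sup>2 / 2) + v * ((m n)\<^sup>2 * exp (- v * (m n)\<^sup>2 / 2))" for n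
      using True by (simp add: b_def algebra_simps)
    ultimately show ?thesis by simp
  qed (simp add: b_def)
  have F: "(\<Sum>n. f n v) = indicator {0<..<a} v * exp (- (a - v) * x\<^sup>2 / 2) * gauss_sum v" for v
  proof (cases "v \<in> {0<..<a}")
    case True
    then have "v > 0" by simp
    from suminf_mult[OF summable_theta_tail(3)[OF this], of "indicator {0<..<a} v * exp (- (a - v) * x\<^sup>2 / 2)"]
    show ?thesis unfolding f_def m_def gauss_sum_def .
  qed (simp add: f_def)
  define W where "W = 2 * (1 - Ex) / x\<^sup>2"
  have int_W: "has_bochner_integral lborel (\<lambda>v. indicator {0<..<a} v * exp (- (a - v) * x\<^sup>2 / 2)) W"
  proof -
    have x2: "x\<^sup>2 \<noteq> 0" using x by simp
    let ?H = "\<lambda>v. 2 / x\<^sup>2 * exp (- (a - v) * x\<^sup>2 / 2)"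
    have "(?H has_real_derivative exp (- (a - v) * x\<^sup>2 / 2)) (at v)" for v
    proof -
      have "((\<lambda>v. 2 / X * exp (- (a - v) * X / 2)) has_real_derivative exp (- (a - v) * X / 2)) (at v)" if "X \<noteq> 0" for X :: real
        using that by (auto intro!: derivative_eq_intros)
      from this[OF x2] show ?thesis .
    qed
    then have "has_bochner_integral lborel (\<lambda>v. indicator {0<..<a} v * exp (- (a - v) * x\<^sup>2 / 2)) (?H a - ?H 0)"
      by (intro Icc) (auto intro!: continuous_intros)
    moreover have "?H a - ?H 0 = W" by (simp add: W_def Ex_def diff_divide_distrib)
    ultimately show ?thesis by simp
  qed
  have bi: "has_bochner_integral lborel (\<lambda>v. (- 1 / 2) * (indicator {0<..<a} v * exp (- (a - v) * x\<^sup>2 / 2))) ((- 1 / 2) * W)"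
    "has_bochner_integral lborel (\<lambda>v. gauss_sum a * (indicator {0<..<a} v * exp (- (a - v) * x\<^sup>2 / 2))) (gauss_sum a * W)"
    by (intro has_bochner_integral_mult_right int_W)+
  have lo: "(- 1 / 2) * (indicator {0<..<a} v * exp (- (a - v) * x\<^sup>2 / 2)) \<le> (\<Sum>n. f n v)" for v
  proof (cases "v \<in> {0<..<a}")
    case True
    then have "- 1 / 2 \<le> gauss_sum v" by (intro gauss_sum_ge) auto
    from mult_left_mono[OF this, of "exp (- (a - v) * x\<^sup>2 / 2)"] True
    show ?thesis unfolding F by (simp add: mult.commute)
  qed (simp add: F)
  have up: "(\<Sum>n. f n v) \<le> gauss_sum a * (indicator {0<..<a} v * exp (- (a - v) * x\<^sup>2 / 2))" for v
  proof (cases "v \<in> {0<..<a}")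
    case True
    then have "gauss_sum v \<le> gauss_sum a" by (intro gauss_sum_mono) auto
    from mult_left_mono[OF this, of "exp (- (a - v) * x\<^sup>2 / 2)"] True
    show ?thesis unfolding F by (simp add: mult.commute)
  qed (simp add: F)
  note * = sums_integral_bounds[OF int_f int_b f_le sB sb bi(1) lo bi(2) up]
  from *(1) show sI: "summable I" by (simp add: summable_minus_iff)
  show "suminf I \<le> (1 - exp (- a * x\<^sup>2 / 2)) / x\<^sup>2" "- suminf I \<le> 2 * gauss_sum a * (1 - exp (- a * x\<^sup>2 / 2)) / x\<^sup>2"
  proof -
    have "W / 2 = (1 - Ex) / x\<^sup>2" "gauss_sum a * W = 2 * gauss_sum a * (1 - Ex) / x\<^sup>2"
    proof -
      have "2 * A / X / 2 = A / X" "g * (2 * A / X) = 2 * g * A / X" for A X g :: real by simp_all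
      then show "W / 2 = (1 - Ex) / x\<^sup>2" "gauss_sum a * W = 2 * gauss_sum a * (1 - Ex) / x\<^sup>2"
        unfolding W_def by blast+
    qed
    moreover have "suminf I \<le> W / 2" "- suminf I \<le> gauss_sum a * W"
      using *(2,3) unfolding suminf_minus[OF sI] by simp_all
    ultimately show "suminf I \<le> (1 - exp (- a * x\<^sup>2 / 2)) / x\<^sup>2" "- suminf I \<le> 2 * gauss_sum a * (1 - exp (- a * x\<^sup>2 / 2)) / x\<^sup>2"
      unfolding Ex_def by (simp_all only:)
  qed
qed

text \<open>Partial fractions give \<open>R n = Ex * z n - I n - v n / x\<close>, so the gap
  \<open>Ex * Z - suminf R\<close> equals \<open>Ex / x^2 + suminf I + suminf v / x\<close>. The
  upper bound adds \<open>suminf I \<le> (1 - Ex) / x^2\<close> and \<open>suminf v \<le> 0\<close>.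
  In the lower bound the numerator over \<open>x^2\<close> is \<open>Ex * (1 + 2 * H) - H\<close>
  with \<open>H = gauss_sum a\<close> in \<open>[- 1 / 2, 0]\<close>. Later \<open>Z\<close> is
  \<open>pi^2 / (sin (pi * x))^2\<close>.\<close>

lemma right_tail_bounds:
  fixes a x :: real
  assumes a: "a > 0" and x: "x > 0" "x \<notin> \<int>"
    and Z: "(\<lambda>n. 1 / (x - real (Suc n))\<^sup>2 + 1 / (x + real (Suc n))\<^sup>2) sums (Z - 1 / x\<^sup>2)"
  defines "R \<equiv> \<lambda>n. exp (- a * (real (Suc n))\<^sup>2 / 2) * (1 / (x - real (Suc n))\<^sup>2 - a * (real (Suc n))\<^sup>2 / (x * (x - real (Suc n))))"
  shows "summable R" "0 \<le> exp (- a * x\<^sup>2 / 2) * Z - suminf R" "exp (- a * x\<^sup>2 / 2) * Z - suminf R \<le> 1 / x\<^sup>2"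
proof -
  define Ex where "Ex = exp (- a * x\<^sup>2 / 2)"
  define g where "g n = exp (- a * (real (Suc n))\<^sup>2 / 2)" for n
  define z where "z n = 1 / (x - real (Suc n))\<^sup>2 + 1 / (x + real (Suc n))\<^sup>2" for n
  define I where "I n = Ex * z n - g n * (z n - 2 * a * (real (Suc n))\<^sup>2 / (x\<^sup>2 - (real (Suc n))\<^sup>2))" for n
  define v where "v n = g n * (x / (x + real (Suc n))\<^sup>2 - a * (real (Suc n))\<^sup>2 / (x + real (Suc n)))" for n
  have R_eq: "R n = Ex * z n - I n - v n / x" for n
  proof -
    define y where "y = real (Suc n)"
    have "y \<noteq> x" using x(2) Ints_of_nat[of "Suc n"] by (auto simp: y_def simp del: of_nat_Suc)
    then have s: "x - y \<noteq> 0" "x + y \<noteq> 0" "x \<noteq> 0" using x by (auto simp: y_def)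
    have fac: "x\<^sup>2 - y\<^sup>2 = (x - y) * (x + y)" by (simp add: power2_eq_square algebra_simps)
    have "a * y\<^sup>2 / (x * (x - y)) = 2 * a * y\<^sup>2 / (x\<^sup>2 - y\<^sup>2) - a * y\<^sup>2 / (x + y) / x"
    proof -
      \<comment> \<open>The pole at \<open>y\<close> is split into a part even in \<open>y\<close>,
        which belongs to \<open>I\<close>, and a part with its pole at \<open>- y\<close>, which
        belongs to \<open>v\<close>.\<close>
      have "1 / (x * (x - y)) = 2 / (x\<^sup>2 - y\<^sup>2) - 1 / (x + y) / x"
      proof -
        define p q where "p = x - y" and "q = x + y"
        have pq: "p \<noteq> 0" "q \<noteq> 0" using s by (auto simp: p_def q_def)
        have "2 / (p * q) - 1 / q / x = (2 * x - p) / (p * q * x)"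
          using pq s(3) by (simp add: field_simps)
        also have "2 * x - p = q" by (simp add: p_def q_def)
        also have "q / (p * q * x) = 1 / (x * p)" using pq by simp
        finally show ?thesis unfolding fac by (simp add: p_def q_def)
      qed
      from arg_cong[OF this, of "\<lambda>u. a * y\<^sup>2 * u"] show ?thesis by (simp add: right_diff_distrib mult_ac)
    qed
    then show ?thesis
      unfolding R_def I_def v_def z_def g_def[symmetric] y_def[symmetric] using s
      by (simp add: right_diff_distrib distrib_left diff_divide_distrib)
  qed
  note I = tilted_gauss_sum_bounds[OF a x, folded g_def Ex_def, folded z_def, folded I_def]
  note v = left_tail_bounds[OF a x, folded g_def, folded v_def]
  have z: "z sums (Z - 1 / x\<^sup>2)" using Z by (simp add: z_def[abs_def])
  have s: "R sums (Ex * (Z - 1 / x\<^sup>2) - suminf I - suminf v / x)"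
    unfolding R_eq[abs_def] using I(1) v(1)
    by (intro sums_diff sums_mult sums_divide z summable_sums)
  then show "summable R" by (simp add: sums_iff)
  have x0: "x \<noteq> 0" using x by simp
  have eq: "Ex * Z - suminf R = Ex / x\<^sup>2 + suminf I + suminf v / x"
    using s by (simp add: sums_iff algebra_simps)
  have Ex: "0 < Ex" "Ex \<le> 1" using a by (auto simp: Ex_def)
  have gs: "gauss_sum a \<le> 0" "- 1 / 2 \<le> gauss_sum a" using gauss_sum_nonpos gauss_sum_ge a by auto
  have "suminf v / x \<le> 0" using v(3) x by (simp add: divide_nonpos_pos)
  then show "exp (- a * x\<^sup>2 / 2) * Z - suminf R \<le> 1 / x\<^sup>2"
    unfolding Ex_def[symmetric] eq using I(2) by (simp add: diff_divide_distrib)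
  have "gauss_sum a / x / x \<le> suminf v / x" using v(2) x by (intro divide_right_mono) auto
  moreover have "0 \<le> Ex / x\<^sup>2 - 2 * gauss_sum a * (1 - Ex) / x\<^sup>2 + gauss_sum a / x / x"
  proof -
    have "Ex / x\<^sup>2 - 2 * gauss_sum a * (1 - Ex) / x\<^sup>2 + gauss_sum a / x / x
      = (Ex * (1 + 2 * gauss_sum a) - gauss_sum a) / x\<^sup>2"
      by (simp add: power2_eq_square field_simps x0)
    moreover have "0 \<le> Ex * (1 + 2 * gauss_sum a)" using Ex gs by (intro mult_nonneg_nonneg) auto
    ultimately show ?thesis using gs by (simp add: divide_nonneg_nonneg)
  qed
  ultimately show "0 \<le> exp (- a * x\<^sup>2 / 2) * Z - suminf R"
    unfolding Ex_def[symmetric] eq using I(3) by linarith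
qed

section \<open>Phragmen-Lindelof bounds\<close>

text \<open>The maximum principle on an unbounded closed set: cut it by a disc of radius
  \<open>R\<close>, whose circle already lies in the region where the bound is assumed.\<close>

lemma norm_le_if_le_frontier:
  assumes S: "closed S" and hol: "f holomorphic_on interior S" and cont: "continuous_on S f"
    and frontier: "\<And>z. z \<in> frontier S \<Longrightarrow> cmod (f z) \<le> M"
    and infinity: "\<And>z. z \<in> S \<Longrightarrow> cmod z \<ge> R \<Longrightarrow> cmod (f z) \<le> M"
    and z: "z \<in> S"
  shows "cmod (f z) \<le> M"
proof (cases "cmod z \<ge> R")
  case True
  then show ?thesis using infinity z by blast
next
  case False
  let ?T = "S \<inter> cball 0 R"
  show ?thesis
  proof (rule maximum_modulus_frontier[where S = ?T and f = f and \<xi> = z])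
    show "f holomorphic_on interior ?T"
      by (rule holomorphic_on_subset[OF hol]) (auto intro: interior_mono[THEN subsetD])
    show "continuous_on (closure ?T) f"
      using S by (intro continuous_on_subset[OF cont]) (simp add: closed_Int)
    show "bounded ?T" by (rule bounded_subset[OF bounded_cball]) auto
    show "z \<in> ?T" using z False by simp
    fix w assume "w \<in> frontier ?T"
    then have "w \<in> frontier S \<or> w \<in> S \<and> cmod w = R"
      using frontier_Int_closed[OF S closed_cball] by (auto simp: frontier_cball)
    then show "cmod (f w) \<le> M" using frontier infinity by auto
  qed
qed

text \<open>On the closed first quadrant the real part of \<open>(1 - 2 * \<i>) * (csqrt (z + 1)) ^ 3\<close> is at least a
  multiple of \<open>cmod z powr (3 / 2)\<close>, which beats exponential growth; the shift by 1 avoids the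
  branch point.\<close>

lemma Phragmen_Lindelof_quadrant:
  fixes g :: "complex \<Rightarrow> complex"
  defines "S \<equiv> {z. Re z \<ge> 0} \<inter> {z. Im z \<ge> 0}"
  assumes hol: "g holomorphic_on UNIV"
    and growth: "\<And>z. z \<in> S \<Longrightarrow> cmod (g z) \<le> A * exp (B * cmod z)"
    and real: "\<And>x::real. x \<ge> 0 \<Longrightarrow> cmod (g (of_real x)) \<le> M"
    and imag: "\<And>y::real. y \<ge> 0 \<Longrightarrow> cmod (g (\<i> * of_real y)) \<le> M"
    and M: "M > 0" and z: "z \<in> S"
  shows "cmod (g z) \<le> M"
proof -
  \<comment> \<open>On the quadrant the argument of \<open>csqrt (z + 1) ^ 3\<close> lies in
    \<open>[0, 3 * pi / 4)\<close>, which reaches beyond the right half-plane; the factor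
    \<open>1 - 2 * \<i>\<close> turns this sector by \<open>- arctan 2\<close> into it.\<close>
  define c where "c z = (1 - 2 * \<i>) * csqrt (z + 1) ^ 3" for z
  have A: "A \<ge> 0" using growth[of 0] norm_ge_zero[of "g 0"] by (simp add: S_def del: norm_ge_zero)
  have S_closed: "closed S"
    unfolding S_def by (intro closed_Int closed_halfspace_Re_ge closed_halfspace_Im_ge)
  have S_nonneg: "z + 1 \<notin> \<real>\<^sub>\<le>\<^sub>0" if "z \<in> S" for z
    using that by (auto simp: S_def complex_nonpos_Reals_iff)
  have c_hol: "c holomorphic_on S"
    unfolding c_def using S_nonneg by (intro holomorphic_intros) auto
  have c_ge: "Re (c z) \<ge> (cmod z / 2) powr (3 / 2)" "Re (c z) \<ge> 0" if "z \<in> S" for z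
  proof -
    define w where "w = csqrt (z + 1)"
    define a b where "a = Re w" and "b = Im w"
    have w2: "w ^ 2 = z + 1" by (simp add: w_def)
    have ab: "a\<^sup>2 - b\<^sup>2 = Re z + 1" "2 * a * b = Im z"
      using arg_cong[OF w2, of Re] arg_cong[OF w2, of Im] by (simp_all add: a_def b_def power2_eq_square algebra_simps)
    have a0: "a \<ge> 0" using csqrt_principal[of "z + 1"] by (auto simp: a_def w_def)
    have "Re z \<ge> 0" using that by (simp add: S_def)
    then have "a\<^sup>2 \<ge> 1" using ab(1) zero_le_power2[of b] by linarith
    then have apos: "a > 0" using a0 by (cases "a = 0") auto
    have b0: "b \<ge> 0"
    proof (rule ccontr)
      assume "\<not> b \<ge> 0"
      then have "2 * a * b < 0" using apos by (simp add: mult_pos_neg)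
      then show False using ab(2) that by (simp add: S_def)
    qed
    have ba: "b \<le> a"
      using ab(1) that by (intro power2_le_imp_le[OF _ a0]) (simp add: S_def)
    have "b\<^sup>2 \<le> a * b" "a * b \<le> a\<^sup>2"
      using ba a0 b0 by (auto simp: power2_eq_square intro: mult_right_mono mult_left_mono)
    then have "0 \<le> b * (6 * a\<^sup>2 - 3 * (a * b) - 2 * b\<^sup>2)"
      using b0 \<open>a\<^sup>2 \<ge> 1\<close> by (intro mult_nonneg_nonneg) linarith+
    moreover have "Re (c z) = a ^ 3 + b * (6 * a\<^sup>2 - 3 * (a * b) - 2 * b\<^sup>2)"
      unfolding c_def w_def[symmetric] by (simp add: a_def b_def power3_eq_cube power2_eq_square algebra_simps)
    ultimately have ge: "Re (c z) \<ge> a ^ 3" by linarith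
    then show "Re (c z) \<ge> 0" using a0 by (meson order_trans zero_le_power)
    have "cmod (z + 1) = a\<^sup>2 + b\<^sup>2"
      unfolding w2[symmetric] norm_power by (simp add: cmod_power2 a_def b_def)
    then have "2 * a\<^sup>2 = cmod (z + 1) + Re z + 1" using ab(1) by simp
    moreover have "cmod z \<le> cmod (z + 1)"
      using that unfolding cmod_def by (intro real_sqrt_le_mono add_right_mono power_mono) (auto simp: S_def)
    ultimately have "cmod z / 2 \<le> a\<^sup>2" using that by (simp add: S_def)
    then have "(cmod z / 2) powr (3 / 2) \<le> (a\<^sup>2) powr (3 / 2)" by (intro powr_mono2) auto
    also have "(a\<^sup>2) powr (3 / 2) = a ^ 3"
    proof -
      have "(a\<^sup>2) powr (3 / 2) = (a powr 2) powr (3 / 2)" using apos by simp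
      also have "\<dots> = a powr 3" by (simp add: powr_powr)
      also have "\<dots> = a ^ 3" using apos by simp
      finally show ?thesis .
    qed
    finally show "Re (c z) \<ge> (cmod z / 2) powr (3 / 2)" using ge by linarith
  qed
  have bound: "cmod (g z * exp (- of_real d * c z)) \<le> M" if d: "d > 0" for d :: real
  proof -
    have "filterlim (\<lambda>r. B * r - d * (r / 2) powr (3 / 2)) at_bot at_top"
      using d by real_asymp
    then have "((\<lambda>r. A * exp (B * r - d * (r / 2) powr (3 / 2))) \<longlongrightarrow> A * 0) at_top"
      by (intro tendsto_mult tendsto_const filterlim_compose[OF exp_at_bot])
    moreover have "A * exp (B * r - d * p) = A * exp (B * r) * exp (- d * p)" for r p
      by (simp add: mult.assoc flip: exp_add)
    ultimately have "((\<lambda>r. A * exp (B * r) * exp (- d * (r / 2) powr (3 / 2))) \<longlongrightarrow> 0) at_top"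
      by (simp only: mult_zero_right)
    then have "eventually (\<lambda>r. A * exp (B * r) * exp (- d * (r / 2) powr (3 / 2)) < M) at_top"
      using M by (rule order_tendstoD)
    then obtain R where R: "\<And>r. r \<ge> R \<Longrightarrow> A * exp (B * r) * exp (- d * (r / 2) powr (3 / 2)) < M"
      unfolding eventually_at_top_linorder by blast
    have nexp: "cmod (exp (- of_real d * c z)) = exp (- d * Re (c z))" for z
      by (simp add: norm_exp_eq_Re)
    have le1: "cmod (exp (- of_real d * c z)) \<le> 1" if "z \<in> S" for z
      unfolding nexp using c_ge(2)[OF that] d by simp
    show ?thesis
    proof (rule norm_le_if_le_frontier[OF S_closed, where f = "\<lambda>z. g z * exp (- of_real d * c z)" and z = z and R = R])
      show "(\<lambda>z. g z * exp (- of_real d * c z)) holomorphic_on interior S"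
        by (intro holomorphic_intros holomorphic_on_subset[OF hol] holomorphic_on_subset[OF c_hol] interior_subset) auto
      show "continuous_on S (\<lambda>z. g z * exp (- of_real d * c z))"
        by (intro holomorphic_on_imp_continuous_on holomorphic_intros holomorphic_on_subset[OF hol] c_hol) auto
      show "z \<in> S" by (rule z)
      fix z assume "z \<in> frontier S"
      then have "z \<in> S" "z \<notin> interior S" using S_closed by (auto simp: frontier_def)
      moreover have "{z. Re z > 0} \<inter> {z. Im z > 0} \<subseteq> interior S"
        by (rule interior_maximal) (auto simp: S_def intro!: open_Int open_halfspace_Re_gt open_halfspace_Im_gt)
      ultimately have "z \<in> S" "z \<notin> {z. Re z > 0} \<inter> {z. Im z > 0}" by blast+
      then have "z \<in> S" "Re z = 0 \<or> Im z = 0" by (auto simp: S_def)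
      then have "z = \<i> * of_real (Im z) \<and> Im z \<ge> 0 \<or> z = of_real (Re z) \<and> Re z \<ge> 0"
        by (auto simp: S_def complex_eq_iff)
      then have "cmod (g z) \<le> M" using real[of "Re z"] imag[of "Im z"] by metis
      then have "cmod (g z) * cmod (exp (- of_real d * c z)) \<le> M * 1"
        using le1[OF \<open>z \<in> S\<close>] M by (intro mult_mono) auto
      then show "cmod (g z * exp (- of_real d * c z)) \<le> M" by (simp only: norm_mult mult_1_right)
    next
      fix z assume z: "z \<in> S" "R \<le> cmod z"
      have "cmod (g z) * exp (- d * Re (c z)) \<le> A * exp (B * cmod z) * exp (- d * (cmod z / 2) powr (3 / 2))"
        using growth[OF z(1)] c_ge(1)[OF z(1)] d A by (intro mult_mono) auto
      also have "\<dots> < M" by (rule R[OF z(2)])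
      finally show "cmod (g z * exp (- of_real d * c z)) \<le> M" by (simp only: norm_mult nexp)
    qed
  qed
  \<comment> \<open>The bound is independent of the strength \<open>d\<close> of the damping factor,
    so \<open>d\<close> may tend to 0.\<close>
  have lim: "((\<lambda>d. cmod (g z * exp (- of_real d * c z))) \<longlongrightarrow> cmod (g z * exp (- of_real 0 * c z))) (at_right 0)"
    by (intro tendsto_intros)
  have "eventually (\<lambda>d. cmod (g z * exp (- of_real d * c z)) \<le> M) (at_right 0)"
    using eventually_at_right_less[of "0::real"] by eventually_elim (rule bound)
  from tendsto_upperbound[OF lim this] show ?thesis by simp
qed

text \<open>The factor \<open>exp (\<i> * B * z)\<close> removes the growth on the imaginary axis:
  \<open>g\<close> is bounded by \<open>M\<close> on the real line and by \<open>A\<close> on the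
  upper imaginary axis, hence by the larger of the two on both upper quadrants. A second application
  of the maximum principle, with a factor that vanishes at infinity, improves the constant to
  \<open>M\<close>.\<close>

lemma Phragmen_Lindelof_upper:
  fixes f :: "complex \<Rightarrow> complex"
  assumes hol: "f holomorphic_on UNIV"
    and growth: "\<And>z. cmod (f z) \<le> A * exp (B * cmod z)"
    and real: "\<And>x::real. cmod (f (of_real x)) \<le> M"
    and M: "M > 0" and B: "B \<ge> 0" and z: "Im z \<ge> 0"
  shows "cmod (f z) \<le> M * exp (B * Im z)"
proof -
  define g where "g z = f z * exp (\<i> * of_real B * z)" for z
  define C where "C = max A M"
  have C: "C > 0" "A \<le> C" "M \<le> C" using M by (auto simp: C_def)
  have A: "A \<ge> 0" using growth[of 0] norm_ge_zero[of "f 0"] by (simp del: norm_ge_zero)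
  have ng: "cmod (g z) = cmod (f z) * exp (- (B * Im z))" for z
    by (simp add: g_def norm_mult norm_exp_eq_Re)
  have g_hol: "g holomorphic_on UNIV"
    unfolding g_def by (intro holomorphic_intros hol)
  have g_growth: "cmod (g z) \<le> A * exp (B * cmod z)" if "Im z \<ge> 0" for z
  proof -
    have "cmod (f z) * exp (- (B * Im z)) \<le> (A * exp (B * cmod z)) * 1"
      using growth[of z] that B A by (intro mult_mono) auto
    then show ?thesis by (simp add: ng)
  qed
  have g_real: "cmod (g (of_real x)) \<le> M" for x
    unfolding ng using real[of x] by simp
  have g_imag: "cmod (g (\<i> * of_real y)) \<le> C" if "y \<ge> 0" for y
  proof -
    have "cmod (f (\<i> * of_real y)) * exp (- (B * y)) \<le> A * exp (B * y) * exp (- (B * y))"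
      using growth[of "\<i> * of_real y"] that by (intro mult_right_mono) (auto simp: norm_mult)
    then show ?thesis unfolding ng using C(2) by (simp add: mult.assoc flip: exp_add)
  qed
  have g_C: "cmod (g z) \<le> C" if "Im z \<ge> 0" for z
  proof (cases "Re z \<ge> 0")
    case True
    show ?thesis
      by (rule Phragmen_Lindelof_quadrant[OF g_hol, of A B C])
         (use True that g_growth order_trans[OF g_real C(3)] g_imag C(1) in \<open>auto\<close>)
  next
    case False
    \<comment> \<open>Multiplication by \<open>\<i>\<close> maps the first quadrant onto the
      second.\<close>
    have "cmod (g (\<i> * (- \<i> * z))) \<le> C"
    proof (rule Phragmen_Lindelof_quadrant[of "\<lambda>z. g (\<i> * z)" A B C])
      show "(\<lambda>z. g (\<i> * z)) holomorphic_on UNIV"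
        by (rule holomorphic_on_compose_gen[OF _ g_hol, unfolded o_def]) (auto intro!: holomorphic_intros)
      show "cmod (g (\<i> * w)) \<le> A * exp (B * cmod w)" if "w \<in> {z. Re z \<ge> 0} \<inter> {z. Im z \<ge> 0}" for w
        using g_growth[of "\<i> * w"] that by (simp add: norm_mult)
      show "cmod (g (\<i> * of_real x)) \<le> C" if "x \<ge> 0" for x using g_imag[OF that] .
      show "cmod (g (\<i> * (\<i> * of_real y))) \<le> C" if "y \<ge> 0" for y
        using g_real[of "- y"] C(3) by (simp add: mult.assoc[symmetric])
    qed (use that False C in auto)
    then show ?thesis by (simp add: mult.assoc[symmetric])
  qed
  define S where "S = {z. Im z \<ge> 0}"
  \<comment> \<open>On the closed upper half-plane the factor has modulus at most 1, and at most
    \<open>M / C\<close> once \<open>cmod z \<ge> (C / M + 1) / e\<close>; there the crude bound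
    \<open>C\<close> already gives \<open>M\<close>. Afterwards \<open>e\<close> tends to 0.\<close>
  have bound: "cmod (g z * (\<i> / (\<i> + of_real e * z))) \<le> M" if e: "e > 0" for e :: real
  proof -
    have ge1: "cmod (\<i> + of_real e * z) \<ge> 1" if "z \<in> S" for z
    proof -
      have "0 \<le> e * Im z" using that e by (simp add: S_def)
      then show ?thesis using abs_Im_le_cmod[of "\<i> + of_real e * z"] by simp
    qed
    then have ne: "\<i> + of_real e * z \<noteq> 0" if "z \<in> S" for z
      using that by force
    show ?thesis
    proof (rule norm_le_if_le_frontier[where f = "\<lambda>z. g z * (\<i> / (\<i> + of_real e * z))" and z = z and S = S and R = "(C / M + 1) / e"])
      show "closed S" by (simp add: S_def closed_halfspace_Im_ge)
      have "(\<lambda>z. g z * (\<i> / (\<i> + of_real e * z))) holomorphic_on S"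
        by (intro holomorphic_intros holomorphic_on_subset[OF g_hol] ne) auto
      then show "(\<lambda>z. g z * (\<i> / (\<i> + of_real e * z))) holomorphic_on interior S"
        "continuous_on S (\<lambda>z. g z * (\<i> / (\<i> + of_real e * z)))"
        using interior_subset holomorphic_on_subset holomorphic_on_imp_continuous_on by blast+
      show "z \<in> S" using z by (simp add: S_def)
      fix z assume "z \<in> frontier S"
      then have "z \<in> S" "z \<notin> interior S" by (auto simp: S_def frontier_def closure_closed closed_halfspace_Im_ge)
      moreover have "{z. Im z > 0} \<subseteq> interior S"
        by (rule interior_maximal) (auto simp: S_def intro!: open_halfspace_Im_gt)
      ultimately have "z \<notin> {z. Im z > 0}" "z \<in> S" by blast+
      then have z: "Im z = 0" by (simp add: S_def)
      then have "cmod (g z) \<le> M" using g_real[of "Re z"] by (simp add: complex_eq_iff[of z] complex_is_Real_iff)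
      then have "cmod (g z) / cmod (\<i> + of_real e * z) \<le> M / 1"
        using ge1[of z] z M by (intro frac_le) (auto simp: S_def)
      then show "cmod (g z * (\<i> / (\<i> + of_real e * z))) \<le> M" by (simp add: norm_mult norm_divide)
    next
      fix z assume z: "z \<in> S" "(C / M + 1) / e \<le> cmod z"
      have "C / M + 1 \<le> cmod (of_real e * z)"
        using z(2) e by (simp add: norm_mult divide_le_eq mult.commute)
      moreover have "cmod (of_real e * z) \<le> cmod (\<i> + of_real e * z) + 1"
        using norm_triangle_ineq4[of "\<i> + of_real e * z" \<i>] by simp
      ultimately have "C / M \<le> cmod (\<i> + of_real e * z)" by simp
      then have "C \<le> M * cmod (\<i> + of_real e * z)" using M by (simp add: divide_le_eq mult.commute)
      then have "cmod (g z) \<le> M * cmod (\<i> + of_real e * z)" using g_C[of z] z(1) by (simp add: S_def)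
      then show "cmod (g z * (\<i> / (\<i> + of_real e * z))) \<le> M"
        using ne[OF z(1)] by (simp add: norm_mult norm_divide divide_le_eq)
    qed
  qed
  have lim: "((\<lambda>e. cmod (g z * (\<i> / (\<i> + of_real e * z)))) \<longlongrightarrow> cmod (g z * (\<i> / (\<i> + of_real 0 * z)))) (at_right 0)"
    by (intro tendsto_intros) auto
  have "eventually (\<lambda>e. cmod (g z * (\<i> / (\<i> + of_real e * z))) \<le> M) (at_right 0)"
    using eventually_at_right_less[of "0::real"] by eventually_elim (rule bound)
  from tendsto_upperbound[OF lim this] have "cmod (g z) \<le> M" by simp
  then show ?thesis unfolding ng by (simp add: exp_minus divide_inverse[symmetric] divide_le_eq)
qed

text \<open>The half-plane bound applies with every exponent \<open>2 * pi + e\<close>, always with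
  the same constant \<open>M\<close>, so the limit \<open>e \<rightarrow> 0\<close> reaches
  \<open>2 * pi\<close>. The lower half-plane is treated through
  \<open>z \<mapsto> - z\<close>.\<close>

lemma exp_type_le_bounded_real:
  fixes f :: "complex \<Rightarrow> complex"
  assumes hol: "f holomorphic_on UNIV" and type: "exp_type_le f 1"
    and real: "\<And>x::real. cmod (f (of_real x)) \<le> M" and M: "M > 0"
  shows "cmod (f z) \<le> M * exp (2 * pi * \<bar>Im z\<bar>)"
proof -
  have bound: "cmod (f z) \<le> M * exp ((2 * pi + e) * \<bar>Im z\<bar>)" if e: "e > 0" for e
  proof -
    obtain C where C: "\<And>z. cmod (f z) \<le> C * exp ((2 * pi + e) * cmod z)"
      using type e unfolding exp_type_le_def by force
    have B: "2 * pi + e \<ge> 0" using e by (simp add: add_nonneg_nonneg)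
    show ?thesis
    proof (cases "Im z \<ge> 0")
      case True
      then show ?thesis using Phragmen_Lindelof_upper[OF hol C real M B] by simp
    next
      case False
      have "cmod (f (- (- z))) \<le> M * exp ((2 * pi + e) * Im (- z))"
      proof (rule Phragmen_Lindelof_upper[of "\<lambda>z. f (- z)"])
        show "(\<lambda>z. f (- z)) holomorphic_on UNIV"
          by (rule holomorphic_on_compose_gen[OF _ hol, unfolded o_def]) (auto intro!: holomorphic_intros)
        show "cmod (f (- z)) \<le> C * exp ((2 * pi + e) * cmod z)" for z using C[of "- z"] by simp
        show "cmod (f (- of_real x)) \<le> M" for x using real[of "- x"] by simp
      qed (use M B False in auto)
      then show ?thesis using False by simp
    qed
  qed
  have lim: "((\<lambda>e. M * exp ((2 * pi + e) * \<bar>Im z\<bar>)) \<longlongrightarrow> M * exp ((2 * pi + 0) * \<bar>Im z\<bar>)) (at_right 0)"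
    by (intro tendsto_intros)
  have "eventually (\<lambda>e. cmod (f z) \<le> M * exp ((2 * pi + e) * \<bar>Im z\<bar>)) (at_right 0)"
    using eventually_at_right_less[of "0::real"] by eventually_elim (rule bound)
  from tendsto_lowerbound[OF lim this] show ?thesis by simp
qed

section \<open>Entire functions with double zeros at the integers\<close>

lemma Ints_norm_less_one:
  assumes "z \<in> \<int>" "cmod z < 1"
  shows "z = 0"
proof -
  obtain k where k: "z = of_int k" using assms(1) by (auto elim: Ints_cases)
  then have "real_of_int \<bar>k\<bar> < real_of_int 1" using assms(2) by simp
  then have "\<bar>k\<bar> < 1" by (simp only: of_int_less_iff)
  then show ?thesis by (simp add: k)
qed

lemma sin_pi_eq_0_iff: "sin (of_real pi * z) = 0 \<longleftrightarrow> z \<in> \<int>" for z :: complex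
proof
  assume "sin (of_real pi * z) = 0"
  then obtain n :: int where "of_real pi * z = of_real (of_int n * pi)"
    by (auto simp: sin_eq_0)
  then have "z = of_int n" by simp
  then show "z \<in> \<int>" by simp
next
  assume "z \<in> \<int>"
  then show "sin (of_real pi * z) = 0"
    by (auto elim!: Ints_cases simp: sin_eq_0)
qed

lemma sin_pi_squared_shift:
  assumes "m \<in> \<int>"
  shows "(sin (of_real pi * (z - m)))\<^sup>2 = (sin (of_real pi * z :: complex))\<^sup>2"
proof -
  have s: "sin (of_real pi * m) = 0" using assms by (simp add: sin_pi_eq_0_iff)
  then have "(cos (of_real pi * m))\<^sup>2 = 1"
    using sin_cos_squared_add[of "of_real pi * m"] by simp
  with s show ?thesis by (simp add: right_diff_distrib sin_diff power_mult_distrib)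
qed

text \<open>Near an integer \<open>n\<close> both functions are \<open>(z - n)^2\<close> times a
  holomorphic factor: the iterated difference quotient \<open>E2 n\<close> for \<open>E\<close>, and
  \<open>(s (z - n))^2\<close>, free of zeros in the unit disc around \<open>n\<close>, for the
  squared sine.\<close>

lemma double_zeros_quotient:
  fixes E :: "complex \<Rightarrow> complex"
  assumes hol: "E holomorphic_on UNIV"
    and zero: "\<And>n. n \<in> \<int> \<Longrightarrow> E n = 0" "\<And>n. n \<in> \<int> \<Longrightarrow> deriv E n = 0"
  obtains Q where "Q holomorphic_on UNIV" "\<And>z. E z = Q z * (sin (of_real pi * z))\<^sup>2"
proof -
  define D where "D a f = (\<lambda>z. if z = a then deriv f a else (f z - f a) / (z - a))" for a :: complex and f :: "complex \<Rightarrow> complex"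
  have D_hol: "D a f holomorphic_on UNIV" if "f holomorphic_on UNIV" for a f
    unfolding D_def using that by (rule pole_lemma) simp
  define E2 where "E2 n = D n (D n E)" for n
  have E2_hol: "E2 n holomorphic_on UNIV" for n
    unfolding E2_def by (intro D_hol hol)
  have E2: "E z = (z - n)\<^sup>2 * E2 n z" if "n \<in> \<int>" for n z
    using zero[OF that] by (cases "z = n") (auto simp: E2_def D_def power2_eq_square)
  define ss where "ss z = (sin (of_real pi * z))\<^sup>2" for z :: complex
  define s where "s = D 0 (\<lambda>z. sin (of_real pi * z))"
  have s_hol: "s holomorphic_on UNIV"
    unfolding s_def by (intro D_hol holomorphic_intros)
  have "((\<lambda>z. sin (of_real pi * z)) has_field_derivative of_real pi) (at (0::complex))"
    by (auto intro!: derivative_eq_intros)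
  then have s0: "s 0 = of_real pi" by (simp add: s_def D_def DERIV_imp_deriv)
  have s: "z * s z = sin (of_real pi * z)" for z by (simp add: s_def D_def)
  have s_ne: "s z \<noteq> 0" if "cmod z < 1" for z
  proof
    assume "s z = 0"
    then have "z \<in> \<int>" using s[of z] by (simp add: sin_pi_eq_0_iff[symmetric])
    then have "z = 0" using that by (rule Ints_norm_less_one)
    then show False using \<open>s z = 0\<close> s0 by simp
  qed
  \<comment> \<open>The value at an integer is the limit of the quotient, as
    \<open>s 0 = pi\<close>.\<close>
  define Q where "Q z = (if z \<in> \<int> then E2 z z / (of_real pi)\<^sup>2 else E z / ss z)" for z
  have loc: "Q z = E2 n z / (s (z - n))\<^sup>2" if n: "n \<in> \<int>" and z: "cmod (z - n) < 1" for n z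
  proof (cases "z = n")
    case True
    then show ?thesis using n by (simp add: Q_def s0)
  next
    case False
    have "z \<notin> \<int>"
    proof
      assume "z \<in> \<int>"
      then have "z - n \<in> \<int>" using n by simp
      with z have "z - n = 0" by (rule Ints_norm_less_one[rotated])
      with False show False by simp
    qed
    moreover have "ss z = (z - n)\<^sup>2 * (s (z - n))\<^sup>2"
      unfolding ss_def sin_pi_squared_shift[OF n, of z, symmetric] s[of "z - n", symmetric]
      by (simp only: power_mult_distrib)
    ultimately show ?thesis using False E2[OF n, of z] by (simp add: Q_def)
  qed
  have Q_hol: "Q holomorphic_on UNIV"
  proof (rule holomorphic_onI)
    fix z0 :: complex
    have "Q field_differentiable at z0"
    proof (cases "z0 \<in> \<int>")
      case True
      have "(\<lambda>z. E2 z0 z / (s (z - z0))\<^sup>2) holomorphic_on ball z0 1"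
      proof (intro holomorphic_intros)
        show "E2 z0 holomorphic_on ball z0 1" by (rule holomorphic_on_subset[OF E2_hol]) simp
        show "(\<lambda>z. s (z - z0)) holomorphic_on ball z0 1"
          by (rule holomorphic_on_compose_gen[OF _ s_hol, unfolded o_def]) (auto intro!: holomorphic_intros)
        show "(s (z - z0))\<^sup>2 \<noteq> 0" if "z \<in> ball z0 1" for z
          using s_ne[of "z - z0"] that by (simp add: dist_norm norm_minus_commute)
      qed
      then have "Q holomorphic_on ball z0 1"
        by (rule holomorphic_transform) (use loc[OF True] in \<open>auto simp: dist_norm norm_minus_commute\<close>)
      then show ?thesis by (rule holomorphic_on_imp_differentiable_at) auto
    next
      case False
      have "open (- (\<int> :: complex set))" by (simp add: open_Compl closed_Ints)
      moreover have "(\<lambda>z. E z / ss z) holomorphic_on - \<int>"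
        unfolding ss_def by (intro holomorphic_intros holomorphic_on_subset[OF hol]) (auto simp: sin_pi_eq_0_iff)
      then have "Q holomorphic_on - \<int>"
        by (rule holomorphic_transform) (auto simp: Q_def)
      ultimately show ?thesis using False holomorphic_on_imp_differentiable_at by blast
    qed
    then show "Q field_differentiable at z0 within UNIV" .
  qed
  moreover have "E z = Q z * (sin (of_real pi * z))\<^sup>2" for z
  proof (cases "z \<in> \<int>")
    case True
    then show ?thesis using zero(1) sin_pi_eq_0_iff[of z] by simp
  next
    case False
    then have "ss z \<noteq> 0" using sin_pi_eq_0_iff[of z] by (simp add: ss_def)
    then show ?thesis using False by (simp add: Q_def ss_def)
  qed
  ultimately show ?thesis using that by blast
qed

text \<open>The quotient \<open>Q\<close> by the squared sine grows at most linearly: away from the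
  real line the sine compensates the exponential, and near it the maximum principle applies to boxes
  with vertical sides at half-integers, where the sine has modulus at least 1. Liouville's theorem
  then makes \<open>Q\<close> linear. The growth hypothesis has a linear factor so that functions
  \<open>z * E z\<close> are covered.\<close>

lemma double_zeros_linear_factor:
  fixes E :: "complex \<Rightarrow> complex"
  assumes hol: "E holomorphic_on UNIV"
    and zero: "\<And>n. n \<in> \<int> \<Longrightarrow> E n = 0" "\<And>n. n \<in> \<int> \<Longrightarrow> deriv E n = 0"
    and bound: "\<And>z. cmod (E z) \<le> (A + B * cmod z) * exp (2 * pi * \<bar>Im z\<bar>)"
    and AB: "A \<ge> 0" "B \<ge> 0"
  obtains al be where "\<And>z. E z = (al + be * z) * (sin (of_real pi * z))\<^sup>2"
proof -
  obtain Q where Q_hol: "Q holomorphic_on UNIV" and Q: "\<And>z. E z = Q z * (sin (of_real pi * z))\<^sup>2"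
    using double_zeros_quotient[OF hol zero] by metis
  have nsin: "(cmod (sin (of_real pi * z)))\<^sup>2 = (exp (2 * (pi * Im z)) + inverse (exp (2 * (pi * Im z))) - 2 * cos (2 * (pi * Re z))) / 4" for z
    using norm_sin_squared[of "of_real pi * z"] by simp
  have pi2: "exp (2 * pi) \<ge> 16"
  proof -
    have "(16::real) \<le> exp 1 ^ 4" using exp_ge_add_one_self[of 1] power_mono[of 2 "exp 1 :: real" 4] by simp
    moreover have "exp 1 ^ 4 = exp (4::real)" by (simp flip: exp_of_nat_mult)
    moreover have "exp (4::real) \<le> exp (2 * pi)" using pi_gt3 by simp
    ultimately show ?thesis by linarith
  qed
  \<comment> \<open>With \<open>t\<close> below, \<open>4 * (cmod (sin (pi * z)))^2\<close> is at
    least \<open>t - 2\<close>, and four times this exceeds \<open>t\<close> because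
    \<open>t \<ge> 16\<close>.\<close>
  have far: "16 * (cmod (sin (of_real pi * z)))\<^sup>2 \<ge> exp (2 * pi * \<bar>Im z\<bar>)" if "\<bar>Im z\<bar> \<ge> 1" for z
  proof -
    define t where "t = exp (2 * pi * \<bar>Im z\<bar>)"
    have "exp (2 * pi * 1) \<le> t" unfolding t_def using that by simp
    then have t: "t \<ge> 16" using pi2 by simp
    have "exp (2 * (pi * Im z)) + inverse (exp (2 * (pi * Im z))) = t + inverse t"
      by (cases "Im z \<ge> 0") (auto simp: t_def exp_minus mult.assoc)
    moreover have "inverse t \<ge> 0" using t by simp
    moreover have "cos (2 * (pi * Re z)) \<le> 1" by simp
    moreover have "4 * (cmod (sin (of_real pi * z)))\<^sup>2 = exp (2 * (pi * Im z)) + inverse (exp (2 * (pi * Im z))) - 2 * cos (2 * (pi * Re z))"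
      unfolding nsin by simp
    ultimately have "4 * (cmod (sin (of_real pi * z)))\<^sup>2 \<ge> t - 2"
      by linarith
    then show ?thesis unfolding t_def[symmetric] using t by simp
  qed
  have Qn: "cmod (Q z) * (cmod (sin (of_real pi * z)))\<^sup>2 = cmod (E z)" for z
    by (simp add: Q norm_mult norm_power)
  have Q_far: "cmod (Q z) \<le> exp (2 * pi) * (A + B * cmod z)" if "\<bar>Im z\<bar> \<ge> 1" for z
  proof -
    have "cmod (Q z) * exp (2 * pi * \<bar>Im z\<bar>) \<le> cmod (Q z) * (16 * (cmod (sin (of_real pi * z)))\<^sup>2)"
      by (intro mult_left_mono far that) auto
    also have "\<dots> = 16 * cmod (E z)" by (simp add: Qn[symmetric])
    also have "\<dots> \<le> 16 * ((A + B * cmod z) * exp (2 * pi * \<bar>Im z\<bar>))" by (intro mult_left_mono bound) auto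
    finally have "cmod (Q z) \<le> 16 * (A + B * cmod z)" by simp
    also have "\<dots> \<le> exp (2 * pi) * (A + B * cmod z)" using pi2 AB by (intro mult_right_mono) auto
    finally show ?thesis .
  qed
  \<comment> \<open>The shift by 4 pays for moving from \<open>z\<close> to the frontier of its box,
    which has width 1 and height 2.\<close>
  have Q_bound: "cmod (Q z) \<le> exp (2 * pi) * (A + B * (cmod z + 4))" for z
  proof (cases "\<bar>Im z\<bar> \<ge> 1")
    case True
    have "exp (2 * pi) * (A + B * cmod z) \<le> exp (2 * pi) * (A + B * (cmod z + 4))"
      using AB by (intro mult_left_mono add_left_mono) auto
    then show ?thesis using Q_far[OF True] by linarith
  next
    case False
    define m where "m = \<lfloor>Re z + 1 / 2\<rfloor>"
    define p q where "p = Complex (m - 1 / 2) (- 1)" and "q = Complex (m + 1 / 2) 1"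
    have m: "m - 1 / 2 \<le> Re z" "Re z \<le> m + 1 / 2"
      unfolding m_def by linarith+
    show ?thesis
    proof (rule maximum_modulus_frontier[where S = "cbox p q" and f = Q and \<xi> = z])
      show "Q holomorphic_on interior (cbox p q)" by (rule holomorphic_on_subset[OF Q_hol]) simp
      show "continuous_on (closure (cbox p q)) Q"
        by (rule holomorphic_on_imp_continuous_on[OF holomorphic_on_subset[OF Q_hol]]) simp
      show "bounded (cbox p q)" by (rule bounded_cbox)
      show "z \<in> cbox p q" using m False by (auto simp: p_def q_def in_cbox_complex_iff)
      fix w assume "w \<in> frontier (cbox p q)"
      then have w: "w \<in> cbox p q" "w \<notin> box p q" by (auto simp: frontier_cbox)
      have Re: "m - 1 / 2 \<le> Re w" "Re w \<le> m + 1 / 2" and Im: "\<bar>Im w\<bar> \<le> 1"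
        using w(1) by (auto simp: p_def q_def in_cbox_complex_iff)
      have "cmod (w - z) \<le> \<bar>Re (w - z)\<bar> + \<bar>Im (w - z)\<bar>" by (rule cmod_le)
      also have "\<dots> \<le> 4" using Re Im m False by simp
      finally have wz: "cmod w \<le> cmod z + 4" using norm_triangle_ineq2[of w z] by linarith
      have "cmod (Q w) \<le> exp (2 * pi) * (A + B * cmod w)"
      proof (cases "\<bar>Im w\<bar> \<ge> 1")
        case True
        then show ?thesis by (rule Q_far)
      next
        case False
        then have "Re w = m - 1 / 2 \<or> Re w = m + 1 / 2"
          using w Re by (auto simp: p_def q_def in_box_complex_iff)
        then have "cos (2 * (pi * Re w)) = - 1"
        proof
          assume "Re w = m - 1 / 2"
          then have e: "2 * (pi * Re w) = of_int m * (2 * pi) - pi" by (simp only:) (simp add: algebra_simps)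
          show ?thesis unfolding e cos_diff using sin_int_2pin[of m] cos_int_2pin[of m] by (simp add: mult.commute mult.left_commute)
        next
          assume "Re w = m + 1 / 2"
          then have e: "2 * (pi * Re w) = of_int m * (2 * pi) + pi" by (simp only:) (simp add: algebra_simps)
          show ?thesis unfolding e cos_add using sin_int_2pin[of m] cos_int_2pin[of m] by (simp add: mult.commute mult.left_commute)
        qed
        moreover have "t + inverse t \<ge> 2" if "t > 0" for t :: real
        proof -
          have "t + inverse t - 2 = (t - 1)\<^sup>2 / t" using that by (simp add: field_simps power2_eq_square)
          also have "\<dots> \<ge> 0" using that by simp
          finally show ?thesis by simp
        qed
        from this[of "exp (2 * (pi * Im w))"] have "exp (2 * (pi * Im w)) + inverse (exp (2 * (pi * Im w))) \<ge> 2" by simp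
        ultimately have "(cmod (sin (of_real pi * w)))\<^sup>2 \<ge> 1" unfolding nsin by simp
        then have "cmod (Q w) \<le> cmod (Q w) * (cmod (sin (of_real pi * w)))\<^sup>2"
          using mult_left_mono[of 1 _ "cmod (Q w)"] by simp
        also have "\<dots> = cmod (E w)" by (rule Qn)
        also have "\<dots> \<le> (A + B * cmod w) * exp (2 * pi * \<bar>Im w\<bar>)" by (rule bound)
        also have "\<dots> \<le> (A + B * cmod w) * exp (2 * pi)"
          using Im AB by (intro mult_left_mono) auto
        finally show ?thesis by (simp add: mult.commute)
      qed
      also have "\<dots> \<le> exp (2 * pi) * (A + B * (cmod z + 4))"
        using wz AB by (intro mult_left_mono add_left_mono) auto
      finally show "cmod (Q w) \<le> exp (2 * pi) * (A + B * (cmod z + 4))" .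
    qed
  qed
  have "cmod (Q z) \<le> exp (2 * pi) * (A + 5 * B) * cmod z ^ 1" if "1 \<le> cmod z" for z
  proof -
    have "A \<le> A * cmod z" "B * 4 \<le> B * 4 * cmod z"
      using that AB mult_left_mono[of 1 "cmod z" A] mult_left_mono[of 1 "cmod z" "B * 4"] by auto
    then have "A + B * (cmod z + 4) \<le> (A + 5 * B) * cmod z" by (simp add: algebra_simps)
    then have "exp (2 * pi) * (A + B * (cmod z + 4)) \<le> exp (2 * pi) * ((A + 5 * B) * cmod z)"
      by (intro mult_left_mono) auto
    then show ?thesis using Q_bound[of z] by (simp only: mult.assoc power_one_right)
  qed
  note L = Liouville_polynomial[OF Q_hol this]
  define c0 c1 where "c0 = (deriv ^^ 0) Q 0" and "c1 = (deriv ^^ 1) Q 0"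
  have lin: "Q z = c0 + c1 * z" for z
  proof -
    have "Q z = (\<Sum>k\<le>1. (deriv ^^ k) Q 0 / fact k * z ^ k)" by (rule L)
    also have "\<dots> = c0 + c1 * z" by (simp add: c0_def c1_def)
    finally show ?thesis .
  qed
  have "E z = (c0 + c1 * z) * (sin (of_real pi * z))\<^sup>2" for z
    by (rule trans[OF Q]) (simp only: lin)
  then show ?thesis by (rule that)
qed

section \<open>Poisson summation below the critical type\<close>

lemma tendsto_suminf_dominated:
  fixes a :: "nat \<Rightarrow> nat \<Rightarrow> 'a :: {real_normed_algebra, banach}"
  assumes "\<And>k. (\<lambda>n. a k n) \<longlonglongrightarrow> b k" "\<And>k n. norm (a k n) \<le> M k" "summable M"
  shows "(\<lambda>n. \<Sum>k. a k n) \<longlonglongrightarrow> suminf b"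
  using tannerys_theorem[of a b sequentially M] assms by (auto intro!: always_eventually)

text \<open>An explicit form of the function whose existence \<open>sinc_extension\<close> asserts,
  so that its values at integers can be computed.\<close>

definition csinc :: "complex \<Rightarrow> complex" where
  "csinc z = (if z = 0 then 1 else sin (of_real pi * z) / (of_real pi * z))"

lemma csinc_0 [simp]: "csinc 0 = 1"
  by (simp add: csinc_def)

text \<open>Comparing derivatives at 0 in \<open>pi * w * s w = sin (pi * w)\<close> gives
  \<open>s 0 = 1\<close>, which identifies \<open>csinc\<close> with the function of
  \<open>sinc_extension\<close>.\<close>

lemma csinc_holomorphic: "csinc holomorphic_on UNIV"
  and csinc_norm_le: "cmod (csinc z) \<le> exp (pi * \<bar>Im z\<bar>)"
proof -
  obtain s :: "complex \<Rightarrow> complex" where hol: "s holomorphic_on UNIV"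
    and eq: "\<And>w. of_real pi * w * s w = sin (of_real pi * w)"
    and bd: "\<And>w. cmod (s w) \<le> exp (pi * \<bar>Im w\<bar>)"
    using sinc_extension by metis
  obtain s' where s': "(s has_field_derivative s') (at 0)"
    using hol by (meson UNIV_I field_differentiable_def holomorphic_on_imp_differentiable_at open_UNIV)
  have "((\<lambda>w. of_real pi * w * s w) has_field_derivative of_real pi * s 0) (at 0)"
    by (rule derivative_eq_intros s' refl)+ simp
  moreover have "((\<lambda>w. of_real pi * w * s w) has_field_derivative of_real pi) (at 0)"
    unfolding eq by (auto intro!: derivative_eq_intros)
  ultimately have "of_real pi * s 0 = of_real pi" by (rule DERIV_unique)
  then have "s 0 = 1" by simp
  then have "csinc w = s w" for w
    using eq[of w] by (auto simp: csinc_def field_simps)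
  then have "csinc = s" by auto
  then show "csinc holomorphic_on UNIV" "cmod (csinc z) \<le> exp (pi * \<bar>Im z\<bar>)"
    using hol bd by simp_all
qed

lemma norm_sin_le: "cmod (sin w) \<le> exp \<bar>Im w\<bar>"
proof -
  have "cmod (sin w) = cmod (exp (\<i> * w) - exp (- (\<i> * w))) / 2"
    by (simp add: sin_exp_eq norm_divide norm_mult)
  also have "\<dots> \<le> (cmod (exp (\<i> * w)) + cmod (exp (- (\<i> * w)))) / 2"
    by (intro divide_right_mono norm_triangle_ineq4) simp
  also have "\<dots> \<le> (exp \<bar>Im w\<bar> + exp \<bar>Im w\<bar>) / 2"
    by (intro divide_right_mono add_mono) (auto simp: norm_exp_eq_Re)
  finally show ?thesis by simp
qed

lemma csinc_squared_decay: "(1 + (cmod w)\<^sup>2) * (cmod (csinc w))\<^sup>2 \<le> 2 * exp (2 * pi * \<bar>Im w\<bar>)"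
proof -
  have e: "(exp (pi * \<bar>Im w\<bar>))\<^sup>2 = exp (2 * pi * \<bar>Im w\<bar>)" by (simp flip: exp_double)
  have sq: "(cmod (csinc w))\<^sup>2 \<le> exp (2 * pi * \<bar>Im w\<bar>)"
    unfolding e[symmetric] by (intro power_mono csinc_norm_le) auto
  have "cmod (sin (of_real pi * w)) \<le> exp (pi * \<bar>Im w\<bar>)"
    using norm_sin_le[of "of_real pi * w"] by (simp add: abs_mult)
  then have "cmod (of_real pi * w * csinc w) \<le> exp (pi * \<bar>Im w\<bar>)"
    by (cases "w = 0") (auto simp: csinc_def)
  then have "(cmod (of_real pi * w * csinc w))\<^sup>2 \<le> exp (2 * pi * \<bar>Im w\<bar>)"
    unfolding e[symmetric] by (intro power_mono) auto
  then have "pi\<^sup>2 * ((cmod w)\<^sup>2 * (cmod (csinc w))\<^sup>2) \<le> exp (2 * pi * \<bar>Im w\<bar>)"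
    by (simp add: norm_mult power_mult_distrib mult.assoc)
  moreover have "1 * ((cmod w)\<^sup>2 * (cmod (csinc w))\<^sup>2) \<le> pi\<^sup>2 * ((cmod w)\<^sup>2 * (cmod (csinc w))\<^sup>2)"
    using pi_gt3 power_mono[of 1 pi 2] by (intro mult_right_mono) auto
  ultimately show ?thesis using sq by (simp add: distrib_right)
qed

lemma csinc_of_real: "csinc (of_real x) = of_real (Re (csinc (of_real x)))"
proof -
  have "csinc (of_real x) \<in> \<real>"
    by (auto simp: csinc_def simp flip: of_real_mult intro!: Reals_divide sin_in_Reals)
  then show ?thesis by (simp add: of_real_Re)
qed

lemma csinc_Ints: "m \<in> \<int> \<Longrightarrow> csinc m = (if m = 0 then 1 else 0)"
  by (simp add: csinc_def sin_pi_eq_0_iff)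

lemma csinc_squared_eq: "z \<noteq> 0 \<Longrightarrow> (csinc z)\<^sup>2 = (sin (of_real pi * z))\<^sup>2 / ((of_real pi)\<^sup>2 * z\<^sup>2)"
  by (simp add: csinc_def power_divide power_mult_distrib)

text \<open>A Peetre-type inequality: it trades quadratic decay around one centre for decay around
  another, at the cost of a factor that depends only on the shift \<open>x\<close>.\<close>

lemma shifted_square_le: "1 + n\<^sup>2 \<le> 2 * (1 + x\<^sup>2) * (1 + (x + n)\<^sup>2)" for n x :: real
proof -
  have "0 \<le> (n + 2 * x)\<^sup>2" "0 \<le> x\<^sup>2 * (x + n)\<^sup>2" by simp_all
  moreover have "2 * (1 + x\<^sup>2) * (1 + (x + n)\<^sup>2) = 2 + 2 * x\<^sup>2 + 2 * (x + n)\<^sup>2 + 2 * (x\<^sup>2 * (x + n)\<^sup>2)"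
    by (simp add: algebra_simps)
  moreover have "2 * x\<^sup>2 + 2 * (x + n)\<^sup>2 = n\<^sup>2 + (n + 2 * x)\<^sup>2"
    by (simp add: power2_eq_square algebra_simps)
  ultimately show ?thesis by linarith
qed

lemma integrable_if_quadratic_decay:
  fixes f :: "real \<Rightarrow> 'a :: {banach, second_countable_topology}"
  assumes "f \<in> borel_measurable borel" "\<And>x. (1 + x\<^sup>2) * norm (f x) \<le> C"
  shows "integrable lborel f"
proof (rule Bochner_Integration.integrable_bound)
  have half: "integrable lborel (\<lambda>w. indicator {0..} w * (1 / (w\<^sup>2 + 1\<^sup>2)) :: real)"
    using has_bochner_integral_inverse_squares(1)[of 1] by (auto simp: has_bochner_integral_iff)
  have half': "integrable lborel (\<lambda>w. indicator {0..} (0 + (- 1) * w) * (1 / ((0 + (- 1) * w)\<^sup>2 + 1\<^sup>2)) :: real)"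
    by (rule lborel_integrable_real_affine[OF half]) simp
  show "integrable lborel (\<lambda>w::real. \<bar>C\<bar> * (indicator {0..} w * (1 / (w\<^sup>2 + 1\<^sup>2)) + indicator {0..} (0 + (- 1) * w) * (1 / ((0 + (- 1) * w)\<^sup>2 + 1\<^sup>2))))"
    by (intro integrable_mult_right Bochner_Integration.integrable_add half half')
  show "AE x in lborel. norm (f x) \<le> norm (\<bar>C\<bar> * (indicator {0..} x * (1 / (x\<^sup>2 + 1\<^sup>2)) + indicator {0..} (0 + (- 1) * x) * (1 / ((0 + (- 1) * x)\<^sup>2 + 1\<^sup>2))))"
  proof (intro AE_I2)
    fix x :: real
    have p: "0 < x\<^sup>2 + 1" by (simp add: add_nonneg_pos)
    have "norm (f x) \<le> C / (x\<^sup>2 + 1)"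
      using assms(2)[of x] p by (simp add: pos_le_divide_eq mult.commute add.commute)
    also have "\<dots> \<le> \<bar>C\<bar> * (1 / (x\<^sup>2 + 1))" using p by (simp add: divide_right_mono)
    also have "\<dots> \<le> \<bar>C\<bar> * (indicator {0..} x * (1 / (x\<^sup>2 + 1\<^sup>2)) + indicator {0..} (0 + (- 1) * x) * (1 / ((0 + (- 1) * x)\<^sup>2 + 1\<^sup>2)))"
      using p by (intro mult_left_mono) (auto simp: indicator_def)
    also have "\<dots> \<le> norm (\<bar>C\<bar> * (indicator {0..} x * (1 / (x\<^sup>2 + 1\<^sup>2)) + indicator {0..} (0 + (- 1) * x) * (1 / ((0 + (- 1) * x)\<^sup>2 + 1\<^sup>2))))"
      by simp
    finally show "norm (f x) \<le> norm (\<bar>C\<bar> * (indicator {0..} x * (1 / (x\<^sup>2 + 1\<^sup>2)) + indicator {0..} (0 + (- 1) * x) * (1 / ((0 + (- 1) * x)\<^sup>2 + 1\<^sup>2))))" .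
  qed
qed (use assms(1) in simp)

text \<open>Removing \<open>P 0\<close> and a multiple of \<open>sin (2 * pi * z)\<close> leaves
  double zeros at all integers, hence a linear factor times the squared sine. Periodicity makes that
  factor constant, and what remains grows like \<open>exp (2 * pi * \<bar>y\<bar>)\<close> along the
  imaginary axis unless both coefficients vanish.\<close>

lemma periodic_type_less_constant:
  fixes P :: "complex \<Rightarrow> complex"
  assumes hol: "P holomorphic_on UNIV" and per: "\<And>z. P (z + 1) = P z"
    and bound: "\<And>z. cmod (P z) \<le> C * exp (2 * pi * rho * \<bar>Im z\<bar>)" and rho: "rho < 1"
  shows "P z = P 0"
proof -
  have C: "C \<ge> 0" using order_trans[OF norm_ge_zero bound[of 0]] by simp
  have per_int: "P (z + of_int k) = P z" for z k
  proof (induction k rule: int_induct[of _ 0])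
    case (step1 i)
    then show ?case using per[of "z + of_int i"] by (simp add: add.assoc)
  next
    case (step2 i)
    then show ?case using per[of "z + of_int (i - 1)"] by (simp add: add.assoc)
  qed simp
  have diff: "P field_differentiable (at z)" for z
    using holomorphic_on_imp_differentiable_at[OF hol] by simp
  have deriv_int: "deriv P n = deriv P 0" if "n \<in> \<int>" for n
  proof -
    obtain k where k: "n = of_int k" using \<open>n \<in> \<int>\<close> by (auto elim: Ints_cases)
    have "(P has_field_derivative deriv P n) (at (0 + n))"
      using diff[of n] by (simp add: DERIV_deriv_iff_field_differentiable)
    then have "((\<lambda>z. P (z + n)) has_field_derivative deriv P n) (at 0)"
      by (simp only: DERIV_shift)
    then have "(P has_field_derivative deriv P n) (at 0)"
      unfolding k per_int .
    then show ?thesis by (rule DERIV_imp_deriv[symmetric])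
  qed
  \<comment> \<open>The derivative of \<open>P\<close> is the same at all integers, and
    \<open>p * sin (2 * pi * z)\<close> has exactly this derivative there.\<close>
  define p where "p = deriv P 0 / (2 * of_real pi)"
  define E where "E z = P z - P 0 - p * sin (2 * of_real pi * z)" for z
  have E_hol: "E holomorphic_on UNIV" unfolding E_def by (intro holomorphic_intros hol)
  have sin_int: "sin (2 * of_real pi * n) = 0" "cos (2 * of_real pi * n) = 1" if "n \<in> \<int>" for n :: complex
  proof -
    have "sin (of_real pi * n) = 0" using that by (simp add: sin_pi_eq_0_iff)
    then show "sin (2 * of_real pi * n) = 0" "cos (2 * of_real pi * n) = 1"
      using sin_double[of "of_real pi * n"] cos_double_sin[of "of_real pi * n"] by (simp_all add: mult.assoc)
  qed
  have E0: "E n = 0" if "n \<in> \<int>" for n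
  proof -
    obtain k where "n = of_int k" using \<open>n \<in> \<int>\<close> by (auto elim: Ints_cases)
    then have "P n = P 0" using per_int[of 0 k] by simp
    then show ?thesis using sin_int[OF that] by (simp add: E_def)
  qed
  have E1: "deriv E n = 0" if "n \<in> \<int>" for n
  proof (rule DERIV_imp_deriv)
    have "(P has_field_derivative deriv P 0) (at n)"
      using diff[of n] deriv_int[OF that] by (simp add: DERIV_deriv_iff_field_differentiable[symmetric])
    then have "(E has_field_derivative deriv P 0 - p * (cos (2 * of_real pi * n) * (2 * of_real pi))) (at n)"
      unfolding E_def by (auto intro!: derivative_eq_intros)
    then show "(E has_field_derivative 0) (at n)"
      using sin_int[OF that] by (simp add: p_def)
  qed
  have E_bound: "cmod (E z) \<le> ((C + cmod (P 0) + cmod p) + 0 * cmod z) * exp (2 * pi * \<bar>Im z\<bar>)" for z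
  proof -
    let ?e = "exp (2 * pi * \<bar>Im z\<bar>)"
    have e1: "1 \<le> ?e" by simp
    have "rho * \<bar>Im z\<bar> \<le> 1 * \<bar>Im z\<bar>" using rho by (intro mult_right_mono) auto
    then have "C * exp (2 * pi * rho * \<bar>Im z\<bar>) \<le> C * ?e"
      using C by (intro mult_left_mono) (auto simp: mult.assoc)
    then have 1: "cmod (P z) \<le> C * ?e" using bound[of z] by linarith
    have 2: "cmod (P 0) \<le> cmod (P 0) * ?e" using e1 mult_left_mono[of 1 ?e "cmod (P 0)"] by simp
    have "cmod (sin (2 * of_real pi * z)) \<le> ?e"
      using norm_sin_le[of "2 * of_real pi * z"] by (simp add: abs_mult)
    then have 3: "cmod (p * sin (2 * of_real pi * z)) \<le> cmod p * ?e"
      unfolding norm_mult by (intro mult_left_mono) auto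
    have "cmod (E z) \<le> cmod (P z) + cmod (P 0) + cmod (p * sin (2 * of_real pi * z))"
      unfolding E_def using norm_triangle_ineq4[of "P z - P 0" "p * sin (2 * of_real pi * z)"] norm_triangle_ineq4[of "P z" "P 0"]
      by linarith
    also have "\<dots> \<le> C * ?e + cmod (P 0) * ?e + cmod p * ?e" using 1 2 3 by linarith
    finally show ?thesis by (simp add: algebra_simps)
  qed
  obtain al be where E: "\<And>z. E z = (al + be * z) * (sin (of_real pi * z))\<^sup>2"
    using double_zeros_linear_factor[OF E_hol E0 E1 E_bound] C by (metis add_nonneg_nonneg norm_ge_zero order_refl)
  have "be = 0"
  proof -
    have "sin (2 * of_real pi * (1 / 2 + 1) :: complex) = sin (2 * of_real pi * (1 / 2))"
      using sin_int[of 1] unfolding distrib_left[of "2 * of_real pi"] sin_add by simp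
    then have "E (1 / 2 + 1) = E (1 / 2)"
      unfolding E_def using per[of "1 / 2"] by (simp only:)
    moreover have "(sin (of_real pi * (1 / 2 + 1) :: complex))\<^sup>2 = (sin (of_real pi * (1 / 2)))\<^sup>2"
      using sin_pi_squared_shift[of 1 "1 / 2 + 1"] by simp
    moreover have "sin (of_real pi * (1 / 2) :: complex) \<noteq> 0"
    proof -
      have "sin (of_real pi * (1 / 2) :: complex) = of_real (sin (pi / 2))"
        by (simp only: sin_of_real[symmetric]) simp
      then show ?thesis by simp
    qed
    ultimately have "al + be * (1 / 2 + 1) = al + be * (1 / 2)" unfolding E by simp
    then show ?thesis by (simp add: algebra_simps)
  qed
  then have P_eq: "P z = P 0 + p * sin (2 * of_real pi * z) + al * (sin (of_real pi * z))\<^sup>2" for z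
    using E[of z] by (simp add: E_def algebra_simps)
  have iy: "sin (2 * of_real pi * (\<i> * of_real y)) = \<i> * of_real (sinh (2 * pi * y))"
    "(sin (of_real pi * (\<i> * of_real y)))\<^sup>2 = - of_real ((cosh (2 * pi * y) - 1) / 2)" for y :: real
  proof -
    have s: "sin (\<i> * of_real t) = \<i> * of_real (sinh t)" for t
      by (simp add: sin_exp_eq sinh_field_def exp_of_real[symmetric] mult.assoc[symmetric] field_simps)
    have "2 * of_real pi * (\<i> * of_real y) = \<i> * of_real (2 * pi * y)" "of_real pi * (\<i> * of_real y) = \<i> * of_real (pi * y)"
      by simp_all
    note e = this
    show "sin (2 * of_real pi * (\<i> * of_real y)) = \<i> * of_real (sinh (2 * pi * y))"
      unfolding e by (rule s)
    have "cosh (2 * (pi * y)) = 1 + 2 * (sinh (pi * y))\<^sup>2"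
      using cosh_double[of "pi * y"] cosh_square_eq[of "pi * y"] by simp
    then have "(cosh (2 * pi * y) - 1) / 2 = (sinh (pi * y))\<^sup>2" by (simp add: mult.assoc)
    then show "(sin (of_real pi * (\<i> * of_real y)))\<^sup>2 = - of_real ((cosh (2 * pi * y) - 1) / 2)"
      unfolding e s by (simp only: power_mult_distrib power2_i of_real_power mult_minus_left mult_1_left)
  qed
  define K where "K = C + cmod (P 0)"
  have small: "cmod (p * (\<i> * of_real (sinh (2 * pi * y))) - al * of_real ((cosh (2 * pi * y) - 1) / 2)) \<le> K + C * exp (2 * pi * rho * \<bar>y\<bar>)" for y
  proof -
    have "cmod (P (\<i> * of_real y) - P 0) \<le> C * exp (2 * pi * rho * \<bar>y\<bar>) + cmod (P 0)"
      using norm_triangle_ineq4[of "P (\<i> * of_real y)" "P 0"] bound[of "\<i> * of_real y"] by simp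
    moreover have "P (\<i> * of_real y) - P 0 = p * (\<i> * of_real (sinh (2 * pi * y))) - al * of_real ((cosh (2 * pi * y) - 1) / 2)"
      unfolding P_eq[of "\<i> * of_real y"] iy by simp
    ultimately show ?thesis using C by (simp add: K_def)
  qed
  have lim: "((\<lambda>y. 2 * (K + C * exp (2 * pi * rho * y)) * exp (- 2 * pi * y)) \<longlongrightarrow> 0) at_top"
  proof -
    have "((\<lambda>y. 2 * K * exp (- 2 * pi * y)) \<longlongrightarrow> 0) at_top" by real_asymp
    moreover have "((\<lambda>y. 2 * C * exp (- 2 * pi * (1 - rho) * y)) \<longlongrightarrow> 0) at_top"
      using rho by real_asymp
    ultimately have "((\<lambda>y. 2 * K * exp (- 2 * pi * y) + 2 * C * exp (- 2 * pi * (1 - rho) * y)) \<longlongrightarrow> 0 + 0) at_top"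
      by (rule tendsto_add)
    moreover have "2 * K * exp (- 2 * pi * y) + 2 * C * exp (- 2 * pi * (1 - rho) * y) = 2 * (K + C * exp (2 * pi * rho * y)) * exp (- 2 * pi * y)" for y
    proof -
      have "exp (- 2 * pi * (1 - rho) * y) = exp (2 * pi * rho * y) * exp (- 2 * pi * y)"
        unfolding exp_add[symmetric] by (simp add: algebra_simps)
      then show ?thesis by (simp add: algebra_simps)
    qed
    ultimately show ?thesis by simp
  qed
  \<comment> \<open>At \<open>\<i> * y\<close> the sine is odd in \<open>y\<close> and the squared
    sine is even; combining the bounds at \<open>y\<close> and \<open>- y\<close> separates the two
    coefficients.\<close>
  have pair: "cmod al * (cosh (2 * pi * y) - 1) \<le> 2 * (K + C * exp (2 * pi * rho * y))"
    "cmod p * (2 * \<bar>sinh (2 * pi * y)\<bar>) \<le> 2 * (K + C * exp (2 * pi * rho * y))" if "y \<ge> 0" for y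
  proof -
    define u v where "u = p * (\<i> * of_real (sinh (2 * pi * y)))" and "v = al * of_real ((cosh (2 * pi * y) - 1) / 2)"
    have 1: "cmod (u - v) \<le> K + C * exp (2 * pi * rho * y)" "cmod (- u - v) \<le> K + C * exp (2 * pi * rho * y)"
      using small[of y] small[of "- y"] that by (simp_all add: u_def v_def)
    have "cmod (2 * v) \<le> 2 * (K + C * exp (2 * pi * rho * y))"
      using norm_triangle_ineq[of "u - v" "- u - v"] 1 norm_minus_cancel[of "2 * v"] by (simp add: algebra_simps)
    moreover have "cmod (2 * v) = cmod al * (cosh (2 * pi * y) - 1)"
    proof -
      have "cmod (2 * v) = 2 * (cmod al * \<bar>(cosh (2 * pi * y) - 1) / 2\<bar>)"
        by (simp only: v_def norm_mult norm_of_real norm_numeral)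
      then show ?thesis using cosh_real_ge_1[of "2 * pi * y"] by simp
    qed
    ultimately show "cmod al * (cosh (2 * pi * y) - 1) \<le> 2 * (K + C * exp (2 * pi * rho * y))" by simp
    have "cmod (2 * u) \<le> 2 * (K + C * exp (2 * pi * rho * y))"
      using norm_triangle_ineq4[of "u - v" "- u - v"] 1 by simp
    moreover have "cmod (2 * u) = cmod p * (2 * \<bar>sinh (2 * pi * y)\<bar>)"
      by (simp add: u_def norm_mult)
    ultimately show "cmod p * (2 * \<bar>sinh (2 * pi * y)\<bar>) \<le> 2 * (K + C * exp (2 * pi * rho * y))" by simp
  qed
  have "cmod al * (1 / 2) \<le> 0"
  proof (rule tendsto_le[OF _ lim])
    show "((\<lambda>y. cmod al * ((cosh (2 * pi * y) - 1) * exp (- 2 * pi * y))) \<longlongrightarrow> cmod al * (1 / 2)) at_top"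
    proof (intro tendsto_mult tendsto_const)
      show "((\<lambda>y. (cosh (2 * pi * y) - 1) * exp (- 2 * pi * y)) \<longlongrightarrow> 1 / 2) at_top"
        unfolding cosh_field_def by real_asymp
    qed
    show "eventually (\<lambda>y. cmod al * ((cosh (2 * pi * y) - 1) * exp (- 2 * pi * y)) \<le> 2 * (K + C * exp (2 * pi * rho * y)) * exp (- 2 * pi * y)) at_top"
      using eventually_ge_at_top[of 0]
    proof eventually_elim
      case (elim y)
      show ?case using mult_right_mono[OF pair(1)[OF elim] exp_ge_zero[of "- 2 * pi * y"]] by (simp only: mult.assoc)
    qed
  qed simp
  then have al: "al = 0" by simp
  have "cmod p * (2 * (1 / 2)) \<le> 0"
  proof (rule tendsto_le[OF _ lim])
    have "((\<lambda>y. 2 * (sinh (2 * pi * y) * exp (- 2 * pi * y))) \<longlongrightarrow> 2 * (1 / 2)) at_top"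
      unfolding sinh_field_def by real_asymp
    then show "((\<lambda>y. cmod p * (2 * (sinh (2 * pi * y) * exp (- 2 * pi * y)))) \<longlongrightarrow> cmod p * (2 * (1 / 2))) at_top"
      by (rule tendsto_mult[OF tendsto_const])
    show "eventually (\<lambda>y. cmod p * (2 * (sinh (2 * pi * y) * exp (- 2 * pi * y))) \<le> 2 * (K + C * exp (2 * pi * rho * y)) * exp (- 2 * pi * y)) at_top"
      using eventually_ge_at_top[of 0]
    proof eventually_elim
      case (elim y)
      have "cmod p * (2 * sinh (2 * pi * y)) \<le> cmod p * (2 * \<bar>sinh (2 * pi * y)\<bar>)"
        by (intro mult_left_mono) auto
      then have "cmod p * (2 * sinh (2 * pi * y)) \<le> 2 * (K + C * exp (2 * pi * rho * y))"
        using pair(2)[OF elim] by linarith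
      from mult_right_mono[OF this exp_ge_zero[of "- 2 * pi * y"]] show ?case by (simp only: mult.assoc)
    qed
  qed simp
  then have "p = 0" by simp
  with al show ?thesis using P_eq[of z] by simp
qed

text \<open>The periodization \<open>P\<close> is constant by the preceding lemma. Its value at 0 is
  the sum over the integers and its mean over \<open>[0, 1]\<close> is the integral. Pairing
  \<open>n\<close> with \<open>- (n + 1)\<close> runs through every integer once.\<close>

lemma poisson_strict_type:
  fixes F :: "complex \<Rightarrow> complex"
  assumes hol: "F holomorphic_on UNIV"
    and bound: "\<And>z. (1 + (Re z)\<^sup>2) * cmod (F z) \<le> C * exp (2 * pi * rho * \<bar>Im z\<bar>)" and rho: "rho < 1"
  shows "(\<lambda>n. F (of_nat n) + F (- of_nat (Suc n))) sums (\<integral>x. F (of_real x) \<partial>lborel)"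
    and "integrable lborel (\<lambda>x. F (of_real x))"
proof -
  have C: "C \<ge> 0"
    using order_trans[OF mult_nonneg_nonneg bound[of 0]] by simp
  define S where "S n z = F (z + of_nat n) + F (z - of_nat (Suc n))" for n z
  define M where "M n = 1 / (1 + (real n)\<^sup>2)" for n
  have M_sum: "summable M"
  proof (rule summable_comparison_test_bigo)
    show "summable (\<lambda>n. norm (1 / (real n)\<^sup>2))"
      using inverse_power_summable[of 2] by (simp add: field_simps)
    show "M \<in> O(\<lambda>n. 1 / (real n)\<^sup>2)" unfolding M_def by real_asymp
  qed
  have M0: "0 \<le> M n" for n by (simp add: M_def)
  have F_bound: "cmod (F (z + of_real m)) \<le> 2 * (1 + (Re z)\<^sup>2) * (C * exp (2 * pi * rho * \<bar>Im z\<bar>)) * (1 / (1 + m\<^sup>2))" for z m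
  proof -
    define X where "X = C * exp (2 * pi * rho * \<bar>Im z\<bar>)"
    have X: "(1 + (Re z + m)\<^sup>2) * cmod (F (z + of_real m)) \<le> X"
      using bound[of "z + of_real m"] by (simp add: X_def)
    have "(1 + m\<^sup>2) * cmod (F (z + of_real m)) \<le> 2 * (1 + (Re z)\<^sup>2) * (1 + (Re z + m)\<^sup>2) * cmod (F (z + of_real m))"
      by (intro mult_right_mono shifted_square_le) auto
    also have "\<dots> \<le> 2 * (1 + (Re z)\<^sup>2) * X"
      unfolding mult.assoc[of _ _ "cmod (F (z + of_real m))"] by (intro mult_left_mono X) auto
    finally have "cmod (F (z + of_real m)) \<le> 2 * (1 + (Re z)\<^sup>2) * X / (1 + m\<^sup>2)"
      by (simp add: pos_le_divide_eq add_pos_nonneg mult.commute)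
    then show ?thesis by (simp add: X_def)
  qed
  have S_bound: "cmod (S n z) \<le> 4 * (1 + (Re z)\<^sup>2) * (C * exp (2 * pi * rho * \<bar>Im z\<bar>)) * M n" for n z
  proof -
    define Y where "Y = 2 * (1 + (Re z)\<^sup>2) * (C * exp (2 * pi * rho * \<bar>Im z\<bar>))"
    have Y: "Y \<ge> 0" using C by (simp add: Y_def)
    have "cmod (F (z + of_nat n)) \<le> Y * M n"
      using F_bound[of z "real n"] by (simp add: Y_def M_def)
    moreover have "cmod (F (z - of_nat (Suc n))) \<le> Y * M n"
    proof -
      have "cmod (F (z - of_nat (Suc n))) \<le> Y * (1 / (1 + (- real (Suc n))\<^sup>2))"
        using F_bound[of z "- real (Suc n)"] by (simp add: Y_def del: of_nat_Suc)
      also have "\<dots> \<le> Y * M n"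
        unfolding M_def power2_minus using Y
        by (intro mult_left_mono divide_left_mono add_left_mono power_mono)
           (auto intro!: mult_pos_pos add_pos_nonneg)
      finally show ?thesis .
    qed
    ultimately have "cmod (S n z) \<le> 2 * (Y * M n)"
      unfolding S_def using norm_triangle_ineq[of "F (z + of_nat n)" "F (z - of_nat (Suc n))"] by linarith
    then show ?thesis by (simp add: Y_def algebra_simps)
  qed
  define P where "P z = (\<Sum>n. S n z)" for z
  have S_sum: "summable (\<lambda>n. S n z)" for z
    by (rule summable_comparison_test'[OF summable_mult[OF M_sum] S_bound])
  have S_hol: "(\<lambda>z. S n z) holomorphic_on UNIV" for n
  proof -
    have "(\<lambda>z. F (z + c)) holomorphic_on UNIV" for c
      by (rule holomorphic_on_compose_gen[OF _ hol, unfolded o_def]) (auto intro!: holomorphic_intros)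
    from holomorphic_on_add[OF this[of "of_nat n"] this[of "- of_nat (Suc n)"]] show ?thesis
      by (simp add: S_def del: of_nat_Suc)
  qed
  have P_hol: "P holomorphic_on UNIV"
  proof (rule holomorphic_uniform_sequence[OF open_UNIV])
    show "(\<lambda>z. \<Sum>i<n. S i z) holomorphic_on UNIV" for n
      by (intro holomorphic_intros S_hol)
    fix z :: complex
    define R where "R = cmod z + 1"
    define B where "B = 4 * (1 + R\<^sup>2) * (C * exp (2 * pi * \<bar>rho\<bar> * R))"
    have "cmod (S n w) \<le> B * M n" if "w \<in> cball z 1" for n w
    proof -
      have w: "cmod w \<le> R"
        using that norm_triangle_sub[of w z] by (auto simp: R_def dist_norm norm_minus_commute)
      then have "\<bar>Re w\<bar> \<le> R" "\<bar>Im w\<bar> \<le> R" using abs_Re_le_cmod[of w] abs_Im_le_cmod[of w] by linarith+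
      then have r: "(Re w)\<^sup>2 \<le> R\<^sup>2" "rho * \<bar>Im w\<bar> \<le> \<bar>rho\<bar> * R"
        using power_mono[of "\<bar>Re w\<bar>" R 2] by (auto intro!: mult_mono)
      have "4 * (1 + (Re w)\<^sup>2) * (C * exp (2 * pi * rho * \<bar>Im w\<bar>)) * M n \<le> B * M n"
        unfolding B_def using r C M0[of n]
        by (intro mult_right_mono mult_mono add_left_mono) (auto simp: mult.assoc)
      then show ?thesis using S_bound[of n w] by linarith
    qed
    then have "uniform_limit (cball z 1) (\<lambda>n w. \<Sum>i<n. S i w) P sequentially"
      unfolding P_def by (rule Weierstrass_m_test) (assumption | rule summable_mult[OF M_sum])+
    then show "\<exists>d>0. cball z d \<subseteq> UNIV \<and> uniform_limit (cball z d) (\<lambda>n w. \<Sum>i<n. S i w) P sequentially"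
      by (intro exI[of _ 1]) auto
  qed
  have F_lim: "(\<lambda>n. F (z + of_real (c * real n))) \<longlonglongrightarrow> 0" if "c = 1 \<or> c = - 1" for z c
  proof (rule Lim_null_comparison)
    define Y where "Y = 2 * (1 + (Re z)\<^sup>2) * (C * exp (2 * pi * rho * \<bar>Im z\<bar>))"
    show "(\<lambda>n. Y * (1 / (1 + (c * real n)\<^sup>2))) \<longlonglongrightarrow> 0"
      using that by (elim disjE; simp; real_asymp)
    show "eventually (\<lambda>n. norm (F (z + of_real (c * real n))) \<le> Y * (1 / (1 + (c * real n)\<^sup>2))) sequentially"
      unfolding Y_def by (intro always_eventually allI F_bound)
  qed
  have per: "P (z + 1) = P z" for z
  proof -
    \<comment> \<open>The partial sum covers the shifts from \<open>- N\<close> to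
      \<open>N - 1\<close>; translation by 1 exchanges the shift \<open>- N\<close> for
      \<open>N\<close>, and both boundary terms tend to 0.\<close>
    have tel: "(\<Sum>n<N. S n (z + 1)) = (\<Sum>n<N. S n z) + F (z + of_nat N) - F (z - of_nat N)" for N
    proof (induction N)
      case (Suc N)
      have "z + 1 + of_nat N = z + of_nat (Suc N)" "z + 1 - of_nat (Suc N) = z - of_nat N" by simp_all
      then have "S N (z + 1) = F (z + of_nat (Suc N)) + F (z - of_nat N)"
        "S N z = F (z + of_nat N) + F (z - of_nat (Suc N))"
        unfolding S_def by (simp_all only:)
      then show ?case using Suc.IH by (simp del: of_nat_Suc)
    qed simp
    have "(\<lambda>N. (\<Sum>n<N. S n z) + F (z + of_nat N) - F (z - of_nat N)) \<longlonglongrightarrow> P z + 0 - 0"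
      using F_lim[of 1 z] F_lim[of "- 1" z] summable_LIMSEQ[OF S_sum[of z]]
      by (intro tendsto_intros) (simp_all add: P_def)
    moreover have "(\<lambda>N. \<Sum>n<N. S n (z + 1)) \<longlonglongrightarrow> P (z + 1)"
      using summable_LIMSEQ[OF S_sum[of "z + 1"]] by (simp add: P_def)
    ultimately show ?thesis unfolding tel using LIMSEQ_unique by fastforce
  qed
  have P_bound0: "cmod (P z) \<le> 4 * (1 + (Re z)\<^sup>2) * (C * exp (2 * pi * rho * \<bar>Im z\<bar>)) * suminf M" for z
    unfolding P_def suminf_mult[OF M_sum, symmetric]
    by (rule norm_suminf_le[OF S_bound summable_mult[OF M_sum]])
  \<comment> \<open>The termwise bound still grows with \<open>Re z\<close>; periodicity moves the
    point into the strip over \<open>[0, 1]\<close>.\<close>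
  have P_bound: "cmod (P z) \<le> (8 * C * suminf M) * exp (2 * pi * rho * \<bar>Im z\<bar>)" for z
  proof -
    have per_int: "P (w + of_int k) = P w" for w k
    proof (induction k rule: int_induct[of _ 0])
      case (step1 i)
      then show ?case using per[of "w + of_int i"] by (simp add: add.assoc)
    next
      case (step2 i)
      then show ?case using per[of "w + of_int (i - 1)"] by (simp add: add.assoc)
    qed simp
    define w where "w = z - of_int \<lfloor>Re z\<rfloor>"
    have w: "0 \<le> Re w" "Re w \<le> 1" "Im w = Im z" by (auto simp: w_def) linarith
    have "P z = P w" using per_int[of w "\<lfloor>Re z\<rfloor>"] by (simp add: w_def)
    moreover have "(Re w)\<^sup>2 \<le> 1" using w power_mono[of "Re w" 1 2] by simp
    then have "4 * (1 + (Re w)\<^sup>2) * (C * exp (2 * pi * rho * \<bar>Im w\<bar>)) * suminf M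
      \<le> 4 * 2 * (C * exp (2 * pi * rho * \<bar>Im w\<bar>)) * suminf M"
      using C suminf_nonneg[OF M_sum M0] by (intro mult_right_mono mult_left_mono) auto
    ultimately show ?thesis using P_bound0[of w] w(3) by (simp add: mult_ac)
  qed
  have const: "P z = P 0" for z
    by (rule periodic_type_less_constant[OF P_hol per P_bound rho])
  have F_cont: "continuous_on X (\<lambda>x. F (of_real x + c))" for X :: "real set" and c
    using holomorphic_on_imp_continuous_on[OF hol]
    by (rule continuous_on_compose2) (auto intro!: continuous_intros)
  show F_int: "integrable lborel (\<lambda>x. F (of_real x))"
  proof (rule integrable_if_quadratic_decay[where C = C])
    show "(\<lambda>x. F (of_real x)) \<in> borel_measurable borel"
      using F_cont[of UNIV 0] by (intro borel_measurable_continuous_onI) simp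
    show "(1 + x\<^sup>2) * norm (F (of_real x)) \<le> C" for x using bound[of "of_real x"] by simp
  qed
  let ?f = "\<lambda>x::real. F (of_real x)"
  have f: "?f integrable_on {p..q}" for p q
    using F_cont[of _ 0] by (intro integrable_continuous_interval) simp
  have shift: "integral {0..1} (\<lambda>x. F (of_real x + of_real c)) = integral {c..c + 1} ?f" for c
  proof -
    have "(?f has_integral integral {c..c + 1} ?f) (cbox c (c + 1))"
      using integrable_integral[OF f] by simp
    from has_integral_affinity[OF this, of 1 c]
    show ?thesis by (auto dest!: integral_unique simp: algebra_simps)
  qed
  have int_S: "integral {0..1} (\<lambda>x. S n (of_real x)) = integral {real n..real (Suc n)} ?f + integral {- real (Suc n)..- real n} ?f" for n
  proof -
    have "integral {0..1} (\<lambda>x. S n (of_real x)) = integral {0..1} (\<lambda>x. F (of_real x + of_real (real n)) + F (of_real x + of_real (- real (Suc n))))"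
      by (simp add: S_def del: of_nat_Suc)
    also have "\<dots> = integral {0..1} (\<lambda>x. F (of_real x + of_real (real n))) + integral {0..1} (\<lambda>x. F (of_real x + of_real (- real (Suc n))))"
      by (intro Henstock_Kurzweil_Integration.integral_add integrable_continuous_interval F_cont)
    finally show ?thesis unfolding shift by (simp add: add.commute)
  qed
  have "(\<lambda>n. integral {0..1} (\<lambda>x. S n (of_real x))) sums integral {0..1} (\<lambda>x. \<Sum>n. S n (of_real x))"
  proof (rule integral_sums_Weierstrass(1))
    show "continuous_on {0..1} (\<lambda>x. S n (of_real x))" for n
      using continuous_on_add[OF F_cont[of "{0..1}" "of_nat n"] F_cont[of "{0..1}" "- of_nat (Suc n)"]]
      by (simp add: S_def del: of_nat_Suc)
    show "norm (S n (of_real y)) \<le> 4 * 2 * C * M n" if "y \<in> {0..1}" for n y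
    proof -
      have "y\<^sup>2 \<le> 1" using that power_mono[of y 1 2] by simp
      then have "4 * (1 + y\<^sup>2) * C * M n \<le> 4 * 2 * C * M n"
        using C M0[of n] by (intro mult_right_mono mult_left_mono) auto
      then show ?thesis using S_bound[of n "of_real y"] by simp
    qed
    show "summable (\<lambda>n. 4 * 2 * C * M n)" by (intro summable_mult M_sum)
  qed
  also have "integral {0..1} (\<lambda>x. \<Sum>n. S n (of_real x)) = P 0"
  proof -
    have "(\<lambda>x::real. \<Sum>n. S n (of_real x)) = (\<lambda>_. P 0)"
      by (rule ext) (rule trans[OF P_def[symmetric] const])
    then show ?thesis by simp
  qed
  finally have s1: "(\<lambda>n. integral {0..1} (\<lambda>x. S n (of_real x))) sums P 0" .
  have partial: "(\<Sum>n<N. integral {0..1} (\<lambda>x. S n (of_real x))) = integral {- real N..real N} ?f" for N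
  proof (induction N)
    case (Suc N)
    have "integral {- real (Suc N)..real (Suc N)} ?f = integral {- real (Suc N)..real N} ?f + integral {real N..real (Suc N)} ?f"
      by (intro Henstock_Kurzweil_Integration.integral_combine[symmetric] f) auto
    moreover have "integral {- real (Suc N)..real N} ?f = integral {- real (Suc N)..- real N} ?f + integral {- real N..real N} ?f"
      by (intro Henstock_Kurzweil_Integration.integral_combine[symmetric] f) auto
    ultimately show ?case using Suc.IH int_S[of N] by (simp del: of_nat_Suc)
  qed simp
  have "(\<lambda>N. \<integral>x. indicator {- real N..real N} x *\<^sub>R ?f x \<partial>lborel) \<longlonglongrightarrow> (\<integral>x. ?f x \<partial>lborel)"
  proof (rule integral_dominated_convergence[where w = "\<lambda>x. norm (?f x)"])
    show "AE x in lborel. (\<lambda>N. indicator {- real N..real N} x *\<^sub>R ?f x) \<longlonglongrightarrow> ?f x"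
    proof (intro AE_I2 tendsto_eventually)
      fix x :: real
      obtain N0 where N0: "\<bar>x\<bar> \<le> real N0" using real_arch_simple by blast
      show "eventually (\<lambda>N. indicator {- real N..real N} x *\<^sub>R ?f x = ?f x) sequentially"
      proof (rule eventually_sequentiallyI[of N0])
        fix N assume "N0 \<le> N"
        then have "real N0 \<le> real N" by simp
        then have "x \<in> {- real N..real N}" using N0 by auto
        then show "indicator {- real N..real N} x *\<^sub>R ?f x = ?f x" by simp
      qed
    qed
  qed (use F_int in \<open>auto simp: indicator_def\<close>)
  moreover have "(\<integral>x. indicator {- real N..real N} x *\<^sub>R ?f x \<partial>lborel) = integral {- real N..real N} ?f" for N
    using set_borel_integral_eq_integral(2)[of "{- real N..real N}" ?f] integrable_mult_indicator[of "{- real N..real N}", OF _ F_int]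
    by (simp add: set_integrable_def set_lebesgue_integral_def)
  ultimately have "(\<lambda>n. integral {0..1} (\<lambda>x. S n (of_real x))) sums (\<integral>x. ?f x \<partial>lborel)"
    by (simp add: sums_def partial)
  then have "P 0 = (\<integral>x. ?f x \<partial>lborel)" using s1 sums_unique2 by blast
  moreover have "(\<lambda>n. S n 0) sums P 0" unfolding P_def by (rule summable_sums[OF S_sum])
  ultimately show "(\<lambda>n. F (of_nat n) + F (- of_nat (Suc n))) sums (\<integral>x. F (of_real x) \<partial>lborel)"
    by (simp add: S_def)
qed

section \<open>The Fejer kernel and limits of dilations\<close>

text \<open>The Fejer kernel \<open>(sin (pi * x) / (pi * x))^2\<close>, with the value 1 at
  0.\<close>

definition sinc_sq :: "real \<Rightarrow> real" where
  "sinc_sq x = (Re (csinc (of_real x)))\<^sup>2"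

lemma sinc_sq_of_real: "(csinc (of_real x))\<^sup>2 = of_real (sinc_sq x)"
  by (subst csinc_of_real) (simp add: sinc_sq_def)

lemma sinc_sq_props:
  shows "0 \<le> sinc_sq x" "sinc_sq x \<le> 1" "(1 + x\<^sup>2) * sinc_sq x \<le> 2"
    and "isCont sinc_sq x" "sinc_sq 0 = 1" "sinc_sq (- x) = sinc_sq x"
    and "x \<in> \<int> \<Longrightarrow> x \<noteq> 0 \<Longrightarrow> sinc_sq x = 0"
    and "x \<noteq> 0 \<Longrightarrow> sinc_sq x = (sin (pi * x))\<^sup>2 / (pi\<^sup>2 * x\<^sup>2)"
proof -
  have n: "sinc_sq x = (cmod (csinc (of_real x)))\<^sup>2"
  proof -
    have "cmod ((csinc (of_real x))\<^sup>2) = \<bar>sinc_sq x\<bar>"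
      by (simp only: sinc_sq_of_real norm_of_real)
    also have "\<dots> = sinc_sq x" by (simp add: sinc_sq_def)
    finally show ?thesis by (simp add: norm_power)
  qed
  show "0 \<le> sinc_sq x" by (simp add: sinc_sq_def)
  show "sinc_sq x \<le> 1"
    using power_mono[OF csinc_norm_le[of "of_real x"], of 2] by (simp add: n)
  show "(1 + x\<^sup>2) * sinc_sq x \<le> 2"
    using csinc_squared_decay[of "of_real x"] by (simp add: n)
  have c: "isCont complex_of_real x" by (intro continuous_intros)
  have "isCont csinc (of_real x)"
    using holomorphic_on_imp_continuous_on[OF csinc_holomorphic]
    by (simp add: continuous_on_eq_continuous_at)
  with c have "isCont (\<lambda>x. csinc (of_real x)) x" by (rule isCont_o2)
  then show "isCont sinc_sq x"
    unfolding sinc_sq_def[abs_def] isCont_def by (intro tendsto_power tendsto_Re)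
  show "sinc_sq 0 = 1" by (simp add: sinc_sq_def)
  show "sinc_sq (- x) = sinc_sq x" by (simp add: sinc_sq_def csinc_def)
  show "x \<in> \<int> \<Longrightarrow> x \<noteq> 0 \<Longrightarrow> sinc_sq x = 0"
    using csinc_Ints[of "of_real x"] by (auto simp: sinc_sq_def elim!: Ints_cases)
  show "sinc_sq x = (sin (pi * x))\<^sup>2 / (pi\<^sup>2 * x\<^sup>2)" if "x \<noteq> 0"
  proof -
    have "complex_of_real (sinc_sq x) = of_real ((sin (pi * x))\<^sup>2 / (pi\<^sup>2 * x\<^sup>2))"
      using that csinc_squared_eq[of "of_real x"]
      by (simp add: sinc_sq_of_real[symmetric] sin_of_real[symmetric])
    then show ?thesis by (simp only: of_real_eq_iff)
  qed
qed

text \<open>Dilation by \<open>r j < 1\<close> makes a type \<open>2 * pi\<close> strictly smaller.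
  The lower bound \<open>1 / 2\<close> keeps decay estimates uniform in \<open>j\<close>.\<close>

lemma dilation_sequence:
  defines "r \<equiv> \<lambda>j::nat. real (Suc j) / real (Suc (Suc j))"
  shows "1 / 2 \<le> r j" "r j < 1" "r \<longlonglongrightarrow> 1"
proof -
  show "1 / 2 \<le> r j" "r j < 1" by (simp_all add: r_def field_simps)
  show "r \<longlonglongrightarrow> 1" unfolding r_def by real_asymp
qed

lemma quadratic_decay_scaled:
  fixes y r C v :: real
  assumes "1 / 2 \<le> r" "0 \<le> v" "(1 + (r * y)\<^sup>2) * v \<le> C"
  shows "(1 + y\<^sup>2) * v \<le> 4 * C"
proof -
  have "(1 / 2)\<^sup>2 \<le> r\<^sup>2" using assms(1) by (intro power_mono) auto
  then have "1 * y\<^sup>2 \<le> (4 * r\<^sup>2) * y\<^sup>2" by (intro mult_right_mono) (auto simp: power2_eq_square)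
  then have "1 + y\<^sup>2 \<le> 4 * (1 + (r * y)\<^sup>2)" by (simp add: power_mult_distrib)
  then have "(1 + y\<^sup>2) * v \<le> 4 * (1 + (r * y)\<^sup>2) * v" using assms(2) by (rule mult_right_mono)
  moreover have "4 * ((1 + (r * y)\<^sup>2) * v) \<le> 4 * C" using assms(3) by simp
  ultimately show ?thesis by (simp only: mult.assoc)
qed

lemma le_inverse_square_if_decay:
  fixes n C v :: real
  assumes "(1 + n\<^sup>2) * v \<le> C"
  shows "v \<le> C * (1 / (1 + n\<^sup>2))"
  using assms by (simp add: pos_le_divide_eq add_pos_nonneg mult.commute)

lemma summable_inverse_square_plus: "summable (\<lambda>n. 1 / (1 + (real n)\<^sup>2))"
proof (rule summable_comparison_test_bigo)
  show "summable (\<lambda>n. norm (1 / (real n)\<^sup>2))"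
    using inverse_power_summable[of 2] by (simp add: field_simps)
  show "(\<lambda>n. 1 / (1 + (real n)\<^sup>2)) \<in> O(\<lambda>n. 1 / (real n)\<^sup>2)" by real_asymp
qed

lemma inverse_square_Suc_le: "1 / (1 + (real (Suc n))\<^sup>2) \<le> 1 / (1 + (real n)\<^sup>2)"
  by (intro divide_left_mono add_left_mono power_mono) (auto intro!: mult_pos_pos add_pos_nonneg)

text \<open>The kernel has type \<open>2 * pi\<close> itself, so Poisson summation is applied to its
  dilates and gives \<open>I / r j\<close> for every translation \<open>y\<close>. In the limit the
  lattice sum is \<open>I\<close> for every \<open>y\<close>; at \<open>y = 0\<close> only the value
  1 at the origin survives, so \<open>I = 1\<close>.\<close>

lemma
  shows sinc_sq_sums: "(\<lambda>n. sinc_sq (x - real n) + sinc_sq (x + real (Suc n))) sums 1"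
    and sinc_sq_integral: "has_bochner_integral lborel sinc_sq 1"
proof -
  define r where "r j = real (Suc j) / real (Suc (Suc j))" for j
  note r = dilation_sequence[folded r_def]
  have meas[measurable]: "sinc_sq \<in> borel_measurable borel"
    by (intro borel_measurable_continuous_onI continuous_at_imp_continuous_on ballI sinc_sq_props)
  have int: "integrable lborel sinc_sq"
    by (rule integrable_if_quadratic_decay[where C = 2]) (use sinc_sq_props in auto)
  define I where "I = integral\<^sup>L lborel sinc_sq"
  have decay: "(1 + n\<^sup>2) * sinc_sq (r j * (y - n)) \<le> 16 * (1 + y\<^sup>2)" for y n j
  proof -
    have "(1 + (y - n)\<^sup>2) * sinc_sq (r j * (y - n)) \<le> 4 * 2"
      by (rule quadratic_decay_scaled[OF r(1)]) (use sinc_sq_props in auto)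
    moreover have "(1 + n\<^sup>2) * sinc_sq (r j * (y - n)) \<le> 2 * (1 + y\<^sup>2) * (1 + (y - n)\<^sup>2) * sinc_sq (r j * (y - n))"
      using shifted_square_le[of "- n" y] sinc_sq_props(1) by (intro mult_right_mono) auto
    moreover have "2 * (1 + y\<^sup>2) * ((1 + (y - n)\<^sup>2) * sinc_sq (r j * (y - n))) \<le> 2 * (1 + y\<^sup>2) * (4 * 2)"
      by (intro mult_left_mono calculation(1)) auto
    ultimately show ?thesis by (simp add: mult.assoc)
  qed
  have dil: "(\<lambda>n. sinc_sq (r j * (y - real n)) + sinc_sq (r j * (y + real (Suc n)))) sums (I / r j)" for j y
  proof -
    define F where "F z = (csinc (of_real (r j) * (of_real y - z)))\<^sup>2" for z
    have rj: "r j > 0" using r(1)[of j] by linarith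
    have F_hol: "F holomorphic_on UNIV"
      unfolding F_def
      by (intro holomorphic_intros holomorphic_on_compose_gen[OF _ csinc_holomorphic, unfolded o_def]) auto
    have bound: "(1 + (Re z)\<^sup>2) * cmod (F z) \<le> (16 * (1 + y\<^sup>2)) * exp (2 * pi * r j * \<bar>Im z\<bar>)" for z
    proof -
      define e where "e = exp (2 * pi * r j * \<bar>Im z\<bar>)"
      define w where "w = of_real (r j) * (of_real y - z)"
      have Re: "(r j * (y - Re z))\<^sup>2 \<le> (cmod w)\<^sup>2"
        unfolding cmod_power2 by (simp add: w_def)
      have Im: "\<bar>Im w\<bar> = r j * \<bar>Im z\<bar>" using rj by (simp add: w_def abs_mult)
      have F: "cmod (F z) = (cmod (csinc w))\<^sup>2" by (simp add: F_def w_def norm_power)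
      have "(1 + (r j * (y - Re z))\<^sup>2) * cmod (F z) \<le> (1 + (cmod w)\<^sup>2) * (cmod (csinc w))\<^sup>2"
        unfolding F using Re by (intro mult_right_mono) auto
      also have "\<dots> \<le> 2 * e" using csinc_squared_decay[of w] unfolding Im e_def by (simp add: mult.assoc)
      finally have "(1 + (y - Re z)\<^sup>2) * cmod (F z) \<le> 4 * (2 * e)"
        by (intro quadratic_decay_scaled[OF r(1)]) auto
      then have "2 * (1 + y\<^sup>2) * ((1 + (y - Re z)\<^sup>2) * cmod (F z)) \<le> 2 * (1 + y\<^sup>2) * (4 * (2 * e))"
        by (intro mult_left_mono) auto
      moreover have "(1 + (Re z)\<^sup>2) * cmod (F z) \<le> 2 * (1 + y\<^sup>2) * (1 + (y - Re z)\<^sup>2) * cmod (F z)"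
        using shifted_square_le[of "- Re z" y] by (intro mult_right_mono) auto
      moreover have "2 * (1 + y\<^sup>2) * (4 * (2 * e)) = (16 * (1 + y\<^sup>2)) * e" by (simp add: algebra_simps)
      ultimately have "(1 + (Re z)\<^sup>2) * cmod (F z) \<le> (16 * (1 + y\<^sup>2)) * e"
        unfolding mult.assoc[of "2 * (1 + y\<^sup>2)" "1 + (y - Re z)\<^sup>2"] by linarith
      then show ?thesis unfolding e_def .
    qed
    have Fr: "F (of_real u) = of_real (sinc_sq (r j * (y - u)))" for u
      unfolding F_def by (simp add: sinc_sq_of_real[symmetric])
    have "(\<integral>u. F (of_real u) \<partial>lborel) = of_real (\<integral>u. sinc_sq (r j * (y - u)) \<partial>lborel)"
      unfolding Fr by (rule integral_complex_of_real)
    also have "(\<integral>u. sinc_sq (r j * (y - u)) \<partial>lborel) = I / r j"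
    proof -
      have "I = \<bar>- r j\<bar> *\<^sub>R (\<integral>u. sinc_sq (r j * y + (- r j) * u) \<partial>lborel)"
        unfolding I_def using rj by (intro lborel_integral_real_affine) simp
      then show ?thesis using rj by (simp add: field_simps)
    qed
    finally have "(\<lambda>n. F (of_real (real n)) + F (of_real (- real (Suc n)))) sums of_real (I / r j)"
      using poisson_strict_type(1)[OF F_hol bound r(2)] by simp
    then have "(\<lambda>n. complex_of_real (sinc_sq (r j * (y - real n)) + sinc_sq (r j * (y + real (Suc n))))) sums of_real (I / r j)"
      unfolding Fr by (simp del: of_nat_Suc)
    then show ?thesis by (simp only: sums_of_real_iff)
  qed
  have sum: "(\<lambda>n. sinc_sq (y - real n) + sinc_sq (y + real (Suc n))) sums I" for y
  proof -
    let ?a = "\<lambda>n j. sinc_sq (r j * (y - real n)) + sinc_sq (r j * (y + real (Suc n)))"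
    let ?M = "\<lambda>n. 32 * (1 + y\<^sup>2) * (1 / (1 + (real n)\<^sup>2))"
    have a_le: "norm (?a n j) \<le> ?M n" for n j
    proof -
      have 1: "sinc_sq (r j * (y - real n)) \<le> 16 * (1 + y\<^sup>2) * (1 / (1 + (real n)\<^sup>2))"
        using decay by (rule le_inverse_square_if_decay)
      have "sinc_sq (r j * (y - (- real (Suc n)))) \<le> 16 * (1 + y\<^sup>2) * (1 / (1 + (- real (Suc n))\<^sup>2))"
        using decay by (rule le_inverse_square_if_decay)
      also have "\<dots> \<le> 16 * (1 + y\<^sup>2) * (1 / (1 + (real n)\<^sup>2))"
        unfolding power2_minus by (intro mult_left_mono inverse_square_Suc_le) auto
      finally have 2: "sinc_sq (r j * (y + real (Suc n))) \<le> 16 * (1 + y\<^sup>2) * (1 / (1 + (real n)\<^sup>2))"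
        by (simp only: diff_minus_eq_add)
      have "norm (?a n j) = ?a n j" using sinc_sq_props(1) by (simp add: add_nonneg_nonneg)
      then show ?thesis using 1 2 by linarith
    qed
    have lim: "(\<lambda>j. ?a n j) \<longlonglongrightarrow> sinc_sq (1 * (y - real n)) + sinc_sq (1 * (y + real (Suc n)))" for n
      by (intro tendsto_add isCont_tendsto_compose[OF sinc_sq_props(4)] tendsto_mult r tendsto_const)
    have sM: "summable ?M" by (intro summable_mult summable_inverse_square_plus)
    have "(\<lambda>j. \<Sum>n. ?a n j) \<longlonglongrightarrow> (\<Sum>n. sinc_sq (1 * (y - real n)) + sinc_sq (1 * (y + real (Suc n))))"
      by (rule tendsto_suminf_dominated[OF lim a_le sM])
    moreover have "(\<Sum>n. ?a n j) = I / r j" for j using dil by (simp add: sums_iff)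
    moreover have "(\<lambda>j. I / r j) \<longlonglongrightarrow> I / 1" by (intro tendsto_divide tendsto_const r) simp
    ultimately have s: "(\<Sum>n. sinc_sq (1 * (y - real n)) + sinc_sq (1 * (y + real (Suc n)))) = I"
      using LIMSEQ_unique by fastforce
    have "summable (\<lambda>n. sinc_sq (1 * (y - real n)) + sinc_sq (1 * (y + real (Suc n))))"
    proof (rule summable_comparison_test'[OF sM])
      show "norm (sinc_sq (1 * (y - real n)) + sinc_sq (1 * (y + real (Suc n)))) \<le> ?M n" for n
        using a_le by (intro LIMSEQ_le_const2[OF tendsto_norm[OF lim]]) auto
    qed
    with s show ?thesis by (simp add: sums_iff)
  qed
  have "(\<lambda>n. if n = 0 then 1 else 0::real) sums 1" using sums_single[of 0 "\<lambda>_. 1::real"] by simp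
  moreover have "(if n = 0 then 1 else 0) = sinc_sq (0 - real n) + sinc_sq (0 + real (Suc n))" for n
    using sinc_sq_props(7)[of "0 - real n"] sinc_sq_props(7)[of "0 + real (Suc n)"] sinc_sq_props(5)
    by (auto simp del: of_nat_Suc)
  ultimately have "(\<lambda>n. sinc_sq (0 - real n) + sinc_sq (0 + real (Suc n))) sums 1" by (simp only:)
  with sum[of 0] have "I = 1" by (rule sums_unique2)
  then show "(\<lambda>n. sinc_sq (x - real n) + sinc_sq (x + real (Suc n))) sums 1" "has_bochner_integral lborel sinc_sq 1"
    using sum[of x] int by (simp_all add: has_bochner_integral_iff I_def)
qed

section \<open>One-sided quadrature at the integers\<close>

text \<open>Integrability does not directly bound \<open>F\<close> pointwise, but it bounds the
  primitive \<open>G\<close> on the real line, and \<open>G\<close> has the same type.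
  Phragmen-Lindelof applies to \<open>G\<close>, and Cauchy's estimate on unit circles returns to
  \<open>F\<close>.\<close>

lemma exp_type_le_integrable_real:
  fixes F :: "complex \<Rightarrow> complex"
  assumes hol: "F holomorphic_on UNIV" and type: "exp_type_le F 1"
    and int: "integrable lborel (\<lambda>x. F (of_real x))"
  obtains M where "M > 0" "\<And>z. cmod (F z) \<le> M * exp (2 * pi * \<bar>Im z\<bar>)"
proof -
  obtain g where g: "\<And>z. (g has_field_derivative F z) (at z)"
    using holomorphic_convex_primitive'[OF convex_UNIV open_UNIV hol] by auto
  define G where "G z = g z - g 0" for z
  have G: "(G has_field_derivative F z) (at z within X)" for z X
    unfolding G_def using DERIV_subset[OF g[of z], of X] by (auto intro!: derivative_eq_intros)
  have G_hol: "G holomorphic_on UNIV"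
    unfolding holomorphic_on_def field_differentiable_def using G by blast
  \<comment> \<open>The summand 1 secures the strict positivity that the Phragmen-Lindelof bound
    asks for.\<close>
  define N where "N = (\<integral>x. cmod (F (of_real x)) \<partial>lborel) + 1"
  have "0 \<le> (\<integral>x. cmod (F (of_real x)) \<partial>lborel)" by (rule integral_nonneg_AE) simp
  then have N: "N > 0" unfolding N_def by linarith
  have cont: "continuous_on X (\<lambda>x::real. F (of_real x))" for X
    using holomorphic_on_imp_continuous_on[OF hol]
    by (rule continuous_on_compose2) (auto intro!: continuous_intros)
  have part: "cmod (integral {p..q} (\<lambda>x. F (of_real x))) \<le> N" for p q
  proof -
    let ?h = "\<lambda>x. indicator {p..q} x *\<^sub>R F (of_real x)"
    have i: "integrable lborel ?h" by (rule integrable_mult_indicator[OF _ int]) simp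
    have "integral {p..q} (\<lambda>x. F (of_real x)) = integral\<^sup>L lborel ?h"
      using set_borel_integral_eq_integral(2)[of "{p..q}" "\<lambda>x. F (of_real x)"] i
      by (simp add: set_integrable_def set_lebesgue_integral_def)
    also have "cmod \<dots> \<le> (\<integral>x. cmod (?h x) \<partial>lborel)" by (rule integral_norm_bound)
    also have "\<dots> \<le> (\<integral>x. cmod (F (of_real x)) \<partial>lborel)"
      by (intro integral_mono integrable_norm i int) (simp split: split_indicator)
    finally show ?thesis by (simp add: N_def)
  qed
  have ftc: "((\<lambda>x. F (of_real x)) has_integral (G (of_real q) - G (of_real p))) {p..q}" if "p \<le> q" for p q
  proof (rule fundamental_theorem_of_calculus[OF that])
    fix x :: real
    have "((\<lambda>x. G (of_real x)) has_vector_derivative (1 * F (of_real x))) (at x within {p..q})"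
      by (rule field_vector_diff_chain_within[of of_real, unfolded o_def])
         (auto intro!: derivative_eq_intros G)
    then show "((\<lambda>x. G (of_real x)) has_vector_derivative F (of_real x)) (at x within {p..q})" by simp
  qed
  have G_real: "cmod (G (of_real x)) \<le> N" for x
  proof (cases "0 \<le> x")
    case True
    then show ?thesis using integral_unique[OF ftc[of 0 x]] part[of 0 x] by (simp add: G_def)
  next
    case False
    then have "integral {x..0} (\<lambda>x. F (of_real x)) = - G (of_real x)"
      using integral_unique[OF ftc[of x 0]] by (simp add: G_def)
    then show ?thesis using part[of x 0] by simp
  qed
  have G_type: "exp_type_le G 1"
    unfolding exp_type_le_def
  proof (intro allI impI)
    fix e :: real assume e: "e > 0"
    then obtain C where C: "C > 0" "\<And>z. cmod (F z) \<le> C * exp ((2 * pi * 1 + e / 2) * cmod z)"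
      using type[unfolded exp_type_le_def, rule_format, of "e / 2"] by auto
    have "cmod (G z) \<le> (C * (2 / e)) * exp ((2 * pi * 1 + e) * cmod z)" for z
    proof -
      have "cmod (G z - G 0) \<le> C * exp ((2 * pi * 1 + e / 2) * cmod z) * cmod (z - 0)"
      proof (rule field_differentiable_bound[where S = "cball 0 (cmod z)" and f' = F])
        fix w :: complex assume "w \<in> cball 0 (cmod z)"
        then have "(2 * pi * 1 + e / 2) * cmod w \<le> (2 * pi * 1 + e / 2) * cmod z"
          using e by (intro mult_left_mono) (auto intro: add_nonneg_nonneg)
        then have "C * exp ((2 * pi * 1 + e / 2) * cmod w) \<le> C * exp ((2 * pi * 1 + e / 2) * cmod z)"
          using C(1) by (intro mult_left_mono) auto
        then show "cmod (F w) \<le> C * exp ((2 * pi * 1 + e / 2) * cmod z)" using C(2)[of w] by linarith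
      qed (use G in auto)
      then have "cmod (G z) \<le> C * exp ((2 * pi * 1 + e / 2) * cmod z) * cmod z" by (simp add: G_def)
      \<comment> \<open>The factor \<open>cmod z\<close>, the length of the path of integration, is
        absorbed by the spare half of \<open>e\<close>.\<close>
      moreover have "cmod z \<le> (2 / e) * exp (e / 2 * cmod z)"
      proof -
        have "e / 2 * cmod z \<le> exp (e / 2 * cmod z)" using exp_ge_add_one_self[of "e / 2 * cmod z"] by linarith
        then show ?thesis using e by (simp add: field_simps)
      qed
      then have "C * exp ((2 * pi * 1 + e / 2) * cmod z) * cmod z
          \<le> C * exp ((2 * pi * 1 + e / 2) * cmod z) * ((2 / e) * exp (e / 2 * cmod z))"
        using C(1) by (intro mult_left_mono) auto
      ultimately have "cmod (G z) \<le> C * exp ((2 * pi * 1 + e / 2) * cmod z) * ((2 / e) * exp (e / 2 * cmod z))"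
        by (rule order_trans)
      also have "\<dots> = (C * (2 / e)) * exp ((2 * pi * 1 + e / 2) * cmod z + e / 2 * cmod z)"
        unfolding exp_add by (simp only: mult_ac)
      also have "(2 * pi * 1 + e / 2) * cmod z + e / 2 * cmod z = (2 * pi * 1 + e) * cmod z"
        by (simp add: algebra_simps)
      finally show ?thesis .
    qed
    moreover have "C * (2 / e) > 0" using C e by simp
    ultimately show "\<exists>C>0. \<forall>z. cmod (G z) \<le> C * exp ((2 * pi * 1 + e) * cmod z)" by blast
  qed
  note G_bound = exp_type_le_bounded_real[OF G_hol G_type G_real N]
  have "cmod (F z) \<le> (N * exp (2 * pi)) * exp (2 * pi * \<bar>Im z\<bar>)" for z
  proof -
    have "cmod ((deriv ^^ 1) G z) \<le> fact 1 * (N * exp (2 * pi * (\<bar>Im z\<bar> + 1))) / 1 ^ 1"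
    proof (rule Cauchy_inequality)
      show "G holomorphic_on ball z 1" by (rule holomorphic_on_subset[OF G_hol]) simp
      show "continuous_on (cball z 1) G"
        by (rule holomorphic_on_imp_continuous_on[OF holomorphic_on_subset[OF G_hol]]) simp
      fix w assume "cmod (z - w) = 1"
      then have "\<bar>Im w\<bar> \<le> \<bar>Im z\<bar> + 1" using abs_Im_le_cmod[of "z - w"] by simp
      then have "N * exp (2 * pi * \<bar>Im w\<bar>) \<le> N * exp (2 * pi * (\<bar>Im z\<bar> + 1))"
        using N by (intro mult_left_mono) auto
      then show "cmod (G w) \<le> N * exp (2 * pi * (\<bar>Im z\<bar> + 1))" using G_bound[of w] by linarith
    qed simp
    moreover have "(deriv ^^ 1) G z = F z" using DERIV_imp_deriv[OF G[of z UNIV]] by simp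
    ultimately show ?thesis by (simp add: distrib_left exp_add mult_ac)
  qed
  then show ?thesis using that[of "N * exp (2 * pi)"] N by simp
qed

text \<open>Poisson summation holds for \<open>F (r z) * (csinc (h z))\<^sup>2\<close> with \<open>r + h < 1\<close>, whose type is strictly
  below \<open>2 \<pi>\<close>; all terms of the sum of \<open>\<phi> - F\<close> are nonnegative, so any single one of them is at most the sum,
  and then \<open>r \<rightarrow> 1\<close>.\<close>

lemma quadrature_bound:
  fixes F :: "complex \<Rightarrow> complex" and phi :: "real \<Rightarrow> real"
  defines "f \<equiv> \<lambda>x. Re (F (of_real x))"
  assumes hol: "F holomorphic_on UNIV" and type: "exp_type_le F 1"
    and real: "\<And>x::real. F (of_real x) \<in> \<real>" and int: "integrable lborel f"
    and le: "\<And>x. f x \<le> phi x" and phi: "\<And>x. (1 + x\<^sup>2) * \<bar>phi x\<bar> \<le> C"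
    and phi_lim: "\<And>m r. m \<in> \<int> \<Longrightarrow> r \<longlonglongrightarrow> 1 \<Longrightarrow> (\<lambda>j. phi (r j * m)) \<longlonglongrightarrow> phi m"
    and m: "m \<in> \<int>"
  shows "phi m - f m \<le> (\<Sum>n. phi (real n) + phi (- real (Suc n))) - (\<integral>x. f x \<partial>lborel)"
proof -
  define r where "r j = real (Suc j) / real (Suc (Suc j))" for j
  \<comment> \<open>With this choice \<open>r j + h j\<close> is the midpoint of \<open>r j\<close>
    and 1, and \<open>h j\<close> tends to 0, so the sinc factor tends to 1.\<close>
  define h where "h j = (1 - r j) / 2" for j
  note r = dilation_sequence[folded r_def]
  have r0: "r j > 0" for j using r(1)[of j] by linarith
  have h: "h j > 0" "h j \<le> 1" for j using r(1,2)[of j] by (auto simp: h_def)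
  have h_lim: "h \<longlonglongrightarrow> 0"
  proof -
    have "(\<lambda>j. (1 - r j) / 2) \<longlonglongrightarrow> (1 - 1) / 2" by (intro tendsto_intros r) simp
    then show ?thesis by (simp add: h_def[abs_def])
  qed
  have F_real: "F (of_real x) = of_real (f x)" for x
    using real[of x] by (simp add: f_def of_real_Re)
  have intF: "integrable lborel (\<lambda>x. F (of_real x))"
    unfolding F_real using int by (rule integrable_of_real)
  obtain M where M: "M > 0" "\<And>z. cmod (F z) \<le> M * exp (2 * pi * \<bar>Im z\<bar>)"
    using exp_type_le_integrable_real[OF hol type intF] by blast
  have f_cont: "isCont f x" for x
  proof -
    have "isCont F (of_real x)"
      using holomorphic_on_imp_continuous_on[OF hol] by (simp add: continuous_on_eq_continuous_at)
    moreover have "isCont complex_of_real x" by (intro continuous_intros)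
    ultimately have "isCont (\<lambda>x. F (of_real x)) x" by (rule isCont_o2[rotated])
    then show ?thesis unfolding f_def isCont_def by (rule tendsto_Re)
  qed
  have [measurable]: "f \<in> borel_measurable borel"
    by (intro borel_measurable_continuous_onI continuous_at_imp_continuous_on ballI f_cont)
  have [measurable]: "sinc_sq \<in> borel_measurable borel"
    by (intro borel_measurable_continuous_onI continuous_at_imp_continuous_on ballI sinc_sq_props)
  define B where "B j = (\<integral>x. f (r j * x) * sinc_sq (h j * x) \<partial>lborel)" for j
  have poisson: "(\<lambda>n. f (r j * real n) * sinc_sq (h j * real n) + f (r j * - real (Suc n)) * sinc_sq (h j * - real (Suc n))) sums B j" for j
  proof -
    define E where "E z = F (of_real (r j) * z) * (csinc (of_real (h j) * z))\<^sup>2" for z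
    have E_hol: "E holomorphic_on UNIV"
      unfolding E_def
      by (intro holomorphic_intros holomorphic_on_compose_gen[OF _ csinc_holomorphic, unfolded o_def]
          holomorphic_on_compose_gen[OF _ hol, unfolded o_def]) auto
    \<comment> \<open>On horizontal lines \<open>F\<close> is only known to be bounded; the squared
      \<open>csinc\<close> supplies the quadratic decay that Poisson summation needs. The constant
      may depend on \<open>j\<close>.\<close>
    have bound: "(1 + (Re z)\<^sup>2) * cmod (E z) \<le> (M * (2 / (h j)\<^sup>2)) * exp (2 * pi * (r j + h j) * \<bar>Im z\<bar>)" for z
    proof -
      define w where "w = of_real (h j) * z"
      have hj: "(h j)\<^sup>2 \<noteq> 0" "(h j)\<^sup>2 \<le> 1" using h[of j] power_mono[of "h j" 1 2] by auto
      have "(1 + (Re z)\<^sup>2) \<le> (1 + (cmod w)\<^sup>2) / (h j)\<^sup>2"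
      proof -
        have "(h j)\<^sup>2 * (Re z)\<^sup>2 \<le> (h j)\<^sup>2 * (cmod z)\<^sup>2"
          by (intro mult_left_mono) (auto simp: cmod_power2)
        then have "(1 + (Re z)\<^sup>2) * (h j)\<^sup>2 \<le> 1 + (cmod w)\<^sup>2"
        proof -
          have "(1 + (Re z)\<^sup>2) * (h j)\<^sup>2 = (h j)\<^sup>2 + (h j)\<^sup>2 * (Re z)\<^sup>2" by (simp add: algebra_simps)
          moreover have "(cmod w)\<^sup>2 = (h j)\<^sup>2 * (cmod z)\<^sup>2" by (simp add: w_def norm_mult power_mult_distrib)
          ultimately show ?thesis using \<open>(h j)\<^sup>2 * (Re z)\<^sup>2 \<le> (h j)\<^sup>2 * (cmod z)\<^sup>2\<close> hj(2) by linarith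
        qed
        then show ?thesis using hj by (simp add: pos_le_divide_eq)
      qed
      then have "(1 + (Re z)\<^sup>2) * (cmod (csinc w))\<^sup>2 \<le> (1 + (cmod w)\<^sup>2) / (h j)\<^sup>2 * (cmod (csinc w))\<^sup>2"
        by (intro mult_right_mono) auto
      also have "\<dots> = (1 + (cmod w)\<^sup>2) * (cmod (csinc w))\<^sup>2 / (h j)\<^sup>2" by simp
      also have "\<dots> \<le> 2 * exp (2 * pi * \<bar>Im w\<bar>) / (h j)\<^sup>2"
        by (intro divide_right_mono csinc_squared_decay) auto
      finally have 1: "(1 + (Re z)\<^sup>2) * (cmod (csinc w))\<^sup>2 \<le> 2 / (h j)\<^sup>2 * exp (2 * pi * (h j * \<bar>Im z\<bar>))"
        using h[of j] by (simp add: w_def abs_mult)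
      have 2: "cmod (F (of_real (r j) * z)) \<le> M * exp (2 * pi * (r j * \<bar>Im z\<bar>))"
        using M(2)[of "of_real (r j) * z"] r0[of j] by (simp add: abs_mult)
      have "(1 + (Re z)\<^sup>2) * cmod (E z) = cmod (F (of_real (r j) * z)) * ((1 + (Re z)\<^sup>2) * (cmod (csinc w))\<^sup>2)"
        by (simp add: E_def w_def norm_mult norm_power)
      also have "\<dots> \<le> (M * exp (2 * pi * (r j * \<bar>Im z\<bar>))) * (2 / (h j)\<^sup>2 * exp (2 * pi * (h j * \<bar>Im z\<bar>)))"
        using M(1) by (intro mult_mono 1 2) auto
      also have "\<dots> = (M * (2 / (h j)\<^sup>2)) * exp (2 * pi * (r j * \<bar>Im z\<bar>) + 2 * pi * (h j * \<bar>Im z\<bar>))"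
        unfolding exp_add by (simp only: mult_ac)
      also have "2 * pi * (r j * \<bar>Im z\<bar>) + 2 * pi * (h j * \<bar>Im z\<bar>) = 2 * pi * (r j + h j) * \<bar>Im z\<bar>"
        by (simp add: algebra_simps)
      finally show ?thesis .
    qed
    have rho: "r j + h j < 1" using r(2)[of j] by (simp add: h_def field_simps)
    have Er: "E (of_real u) = of_real (f (r j * u) * sinc_sq (h j * u))" for u
      unfolding E_def by (simp add: sinc_sq_of_real[symmetric] F_real[symmetric])
    have e: "(\<integral>x. E (of_real x) \<partial>lborel) = of_real (B j)"
      unfolding Er B_def by (rule integral_complex_of_real)
    have "(\<lambda>n. E (of_real (real n)) + E (of_real (- real (Suc n)))) sums of_real (B j)"
      using poisson_strict_type(1)[OF E_hol bound rho] unfolding e by (simp del: of_nat_Suc)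
    then have "(\<lambda>n. complex_of_real (f (r j * real n) * sinc_sq (h j * real n) + f (r j * - real (Suc n)) * sinc_sq (h j * - real (Suc n)))) sums of_real (B j)"
      unfolding Er of_real_add .
    then show ?thesis by (simp only: sums_of_real_iff)
  qed
  let ?a = "\<lambda>n j. phi (r j * real n) * sinc_sq (h j * real n) + phi (r j * - real (Suc n)) * sinc_sq (h j * - real (Suc n))"
  let ?M = "\<lambda>n. 8 * C * (1 / (1 + (real n)\<^sup>2))"
  have phi_b: "\<bar>phi (r j * y) * sinc_sq (h j * y)\<bar> \<le> 4 * C * (1 / (1 + y\<^sup>2))" for j y
  proof -
    have "(1 + y\<^sup>2) * \<bar>phi (r j * y)\<bar> \<le> 4 * C"
      by (rule quadratic_decay_scaled[OF r(1)]) (use phi in auto)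
    then have "\<bar>phi (r j * y)\<bar> \<le> 4 * C * (1 / (1 + y\<^sup>2))" by (rule le_inverse_square_if_decay)
    moreover have "\<bar>phi (r j * y) * sinc_sq (h j * y)\<bar> \<le> \<bar>phi (r j * y)\<bar>"
      using sinc_sq_props(1,2)[of "h j * y"] by (simp add: abs_mult mult_left_le)
    ultimately show ?thesis by linarith
  qed
  have C: "C \<ge> 0" using phi[of 0] by simp
  have a_le: "norm (?a n j) \<le> ?M n" for n j
  proof -
    have "4 * C * (1 / (1 + (- real (Suc n))\<^sup>2)) \<le> 4 * C * (1 / (1 + (real n)\<^sup>2))"
      unfolding power2_minus using C by (intro mult_left_mono inverse_square_Suc_le) auto
    then have "\<bar>phi (r j * - real (Suc n)) * sinc_sq (h j * - real (Suc n))\<bar> \<le> 4 * C * (1 / (1 + (real n)\<^sup>2))"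
      using phi_b[of j "- real (Suc n)"] by linarith
    then have "norm (?a n j) \<le> 4 * C * (1 / (1 + (real n)\<^sup>2)) + 4 * C * (1 / (1 + (real n)\<^sup>2))"
      unfolding real_norm_def using phi_b[of j "real n"] by (intro order_trans[OF abs_triangle_ineq] add_mono)
    then show ?thesis by simp
  qed
  have sM: "summable ?M" by (intro summable_mult summable_inverse_square_plus)
  have sinc_lim: "(\<lambda>j. sinc_sq (h j * y)) \<longlonglongrightarrow> 1" for y
  proof -
    have "(\<lambda>j. sinc_sq (h j * y)) \<longlonglongrightarrow> sinc_sq (0 * y)"
      by (intro isCont_tendsto_compose[OF sinc_sq_props(4)] tendsto_mult h_lim tendsto_const)
    then show ?thesis by (simp add: sinc_sq_props(5))
  qed
  \<comment> \<open>A jump of \<open>phi\<close> at 0 does no harm: limits are taken only along the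
    dilations \<open>r j * m\<close>, which are constant for \<open>m = 0\<close>.\<close>
  have a_lim: "(\<lambda>j. ?a n j) \<longlonglongrightarrow> phi (real n) * 1 + phi (- real (Suc n)) * 1" for n
    by (intro tendsto_add tendsto_mult sinc_lim phi_lim r) auto
  have A_lim: "(\<lambda>j. \<Sum>n. ?a n j) \<longlonglongrightarrow> (\<Sum>n. phi (real n) * 1 + phi (- real (Suc n)) * 1)"
    by (rule tendsto_suminf_dominated[OF a_lim a_le sM])
  have a_sum: "summable (\<lambda>n. ?a n j)" for j
    by (rule summable_comparison_test'[OF sM a_le])
  have B_lim: "B \<longlonglongrightarrow> (\<integral>x. f x \<partial>lborel) / 1"
  proof -
    \<comment> \<open>Substitution moves the dilation from \<open>f\<close> to the sinc factor, so
      \<open>\<bar>f\<bar>\<close> dominates for all \<open>j\<close>.\<close>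
    have B_eq: "B j = (\<integral>x. f x * sinc_sq (h j / r j * x) \<partial>lborel) / r j" for j
    proof -
      have "B j = \<bar>1 / r j\<bar> *\<^sub>R (\<integral>x. f (r j * (0 + 1 / r j * x)) * sinc_sq (h j * (0 + 1 / r j * x)) \<partial>lborel)"
        unfolding B_def using r0[of j] by (intro lborel_integral_real_affine) simp
      moreover have "f (r j * (0 + 1 / r j * x)) * sinc_sq (h j * (0 + 1 / r j * x)) = f x * sinc_sq (h j / r j * x)" for x
        using r0[of j] by simp
      ultimately show ?thesis using r0[of j] by simp
    qed
    have "(\<lambda>j. \<integral>x. f x * sinc_sq (h j / r j * x) \<partial>lborel) \<longlonglongrightarrow> (\<integral>x. f x \<partial>lborel)"
    proof (rule integral_dominated_convergence[where w = "\<lambda>x. \<bar>f x\<bar>"])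
      show "AE x in lborel. (\<lambda>j. f x * sinc_sq (h j / r j * x)) \<longlonglongrightarrow> f x"
      proof (intro AE_I2)
        fix x
        have "(\<lambda>j. f x * sinc_sq (h j / r j * x)) \<longlonglongrightarrow> f x * sinc_sq (0 / 1 * x)"
          by (intro tendsto_mult tendsto_const isCont_tendsto_compose[OF sinc_sq_props(4)] tendsto_divide h_lim r) simp
        then show "(\<lambda>j. f x * sinc_sq (h j / r j * x)) \<longlonglongrightarrow> f x" by (simp add: sinc_sq_props(5))
      qed
      show "AE x in lborel. norm (f x * sinc_sq (h j / r j * x)) \<le> \<bar>f x\<bar>" for j
        using sinc_sq_props(1,2) by (intro AE_I2) (simp add: abs_mult mult_left_le)
    qed (use int in auto)
    then show ?thesis unfolding B_eq by (intro tendsto_divide r) auto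
  qed
  have single: "(phi (r j * m) - f (r j * m)) * sinc_sq (h j * m) \<le> (\<Sum>n. ?a n j) - B j" for j
  proof -
    define d where "d y = (phi (r j * y) - f (r j * y)) * sinc_sq (h j * y)" for y
    have d0: "0 \<le> d y" for y unfolding d_def using le sinc_sq_props(1) by (intro mult_nonneg_nonneg) auto
    have "(\<lambda>n. ?a n j - (f (r j * real n) * sinc_sq (h j * real n) + f (r j * - real (Suc n)) * sinc_sq (h j * - real (Suc n)))) sums ((\<Sum>n. ?a n j) - B j)"
      by (intro sums_diff summable_sums a_sum poisson)
    moreover have "?a n j - (f (r j * real n) * sinc_sq (h j * real n) + f (r j * - real (Suc n)) * sinc_sq (h j * - real (Suc n))) = d (real n) + d (- real (Suc n))" for n
      unfolding d_def by (simp add: left_diff_distrib del: of_nat_Suc)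
    ultimately have s: "(\<lambda>n. d (real n) + d (- real (Suc n))) sums ((\<Sum>n. ?a n j) - B j)"
      by (simp only:)
    obtain n where "m = real n \<or> m = - real (Suc n)"
    proof -
      obtain k :: int where k: "m = of_int k" using m by (auto elim: Ints_cases)
      show ?thesis
      proof (cases k rule: int_cases)
        case (nonneg n)
        then show ?thesis using that[of n] k by simp
      next
        case (neg n)
        then have "m = - real (Suc n)" using k by simp
        then show ?thesis using that[of n] by blast
      qed
    qed
    then have "d m \<le> d (real n) + d (- real (Suc n))" using d0[of "real n"] d0[of "- real (Suc n)"] by auto
    also have "\<dots> \<le> (\<Sum>n. d (real n) + d (- real (Suc n)))"
      using sum_le_suminf[of "\<lambda>n. d (real n) + d (- real (Suc n))" "{n}"] s d0 by (simp add: sums_iff)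
    also have "\<dots> = (\<Sum>n. ?a n j) - B j" using s by (simp add: sums_iff)
    finally show ?thesis by (simp add: d_def)
  qed
  have "(\<lambda>j. (phi (r j * m) - f (r j * m)) * sinc_sq (h j * m)) \<longlonglongrightarrow> (phi m - f (1 * m)) * 1"
    by (intro tendsto_mult tendsto_diff phi_lim m r sinc_lim isCont_tendsto_compose[OF f_cont] tendsto_const)
  moreover have "(\<lambda>j. (\<Sum>n. ?a n j) - B j) \<longlonglongrightarrow> (\<Sum>n. phi (real n) * 1 + phi (- real (Suc n)) * 1) - (\<integral>x. f x \<partial>lborel) / 1"
    by (intro tendsto_diff A_lim B_lim)
  ultimately have "(phi m - f (1 * m)) * 1 \<le> (\<Sum>n. phi (real n) * 1 + phi (- real (Suc n)) * 1) - (\<integral>x. f x \<partial>lborel) / 1"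
    using single by (intro LIMSEQ_le) auto
  then show ?thesis by simp
qed

section \<open>Uniqueness of the interpolating function\<close>

lemma integral_sin_squared_unit:
  "((\<lambda>x. (sin (pi * x))\<^sup>2) has_integral 1 / 2) {real n..real (Suc n)}"
proof -
  let ?G = "\<lambda>x. x / 2 - sin (2 * pi * x) / (4 * pi)"
  have "((\<lambda>x. (sin (pi * x))\<^sup>2) has_integral (?G (real (Suc n)) - ?G (real n))) {real n..real (Suc n)}"
  proof (rule fundamental_theorem_of_calculus)
    fix x :: real
    have "(?G has_real_derivative 1 / 2 - cos (2 * pi * x) * (2 * pi) / (4 * pi)) (at x within {real n..real (Suc n)})"
      by (auto intro!: derivative_eq_intros)
    moreover have "1 / 2 - cos (2 * pi * x) * (2 * pi) / (4 * pi) = (sin (pi * x))\<^sup>2"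
      using cos_double_sin[of "pi * x"] by (simp add: mult.assoc diff_divide_distrib)
    ultimately show "(?G has_vector_derivative (sin (pi * x))\<^sup>2) (at x within {real n..real (Suc n)})"
      by (simp only: has_real_derivative_iff_has_vector_derivative)
  qed simp
  moreover have "sin (2 * pi * real k) = 0" for k
    using sin_npi[of "2 * k"] by (simp add: mult_ac)
  ultimately show ?thesis by (simp add: add_divide_distrib del: of_nat_Suc) (simp add: add_divide_distrib diff_divide_distrib)
qed

text \<open>A nonzero linear factor has modulus at least some \<open>c > 0\<close> from
  \<open>N0\<close> on, so \<open>cmod (f x)\<close> is at least
  \<open>c * (sin (pi * x))^2 / x\<close> there, and the integrals over unit intervals dominate
  \<open>c / 2\<close> times the harmonic series.\<close>

lemma linear_factor_not_integrable:
  fixes f :: "real \<Rightarrow> complex"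
  assumes int: "integrable lborel f" and cont: "continuous_on UNIV f"
    and eq: "\<And>x. of_real x * f x = (al + be * of_real x) * of_real ((sin (pi * x))\<^sup>2)"
  shows "al = 0 \<and> be = 0"
proof (rule ccontr)
  assume ne: "\<not> (al = 0 \<and> be = 0)"
  obtain c N0 where c: "c > 0" "\<And>x. real N0 \<le> x \<Longrightarrow> c \<le> cmod (al + be * of_real x)"
  proof (cases "be = 0")
    case True
    then show ?thesis using ne that[of "cmod al" 0] by simp
  next
    case False
    obtain N0 where N0: "(cmod al + 1) / cmod be \<le> real N0" using real_arch_simple by blast
    show ?thesis
    proof (rule that[of 1 N0])
      fix x assume "real N0 \<le> x"
      then have x: "(cmod al + 1) / cmod be \<le> x" using N0 by linarith
      then have "cmod al + 1 \<le> cmod be * x" using False by (simp add: pos_divide_le_eq mult.commute)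
      moreover have "0 \<le> x" using x by (rule order_trans[rotated]) simp
      then have "cmod be * x = cmod (be * of_real x)" by (simp add: norm_mult)
      moreover have "cmod (be * of_real x) \<le> cmod (al + be * of_real x) + cmod al"
        using norm_triangle_ineq4[of "al + be * of_real x" al] by simp
      ultimately show "1 \<le> cmod (al + be * of_real x)" by linarith
    qed simp
  qed
  define a where "a n = integral {real n..real (Suc n)} (\<lambda>x. cmod (f x))" for n
  have ci: "(\<lambda>x. cmod (f x)) integrable_on {p..q}" for p q
    by (intro integrable_continuous_interval continuous_intros continuous_on_subset[OF cont]) simp
  have partial: "(\<Sum>n<N. a n) \<le> (\<integral>x. cmod (f x) \<partial>lborel)" for N
  proof -
    have "(\<Sum>n<N. a n) = integral {0..real N} (\<lambda>x. cmod (f x))"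
    proof (induction N)
      case (Suc N)
      have "integral {0..real (Suc N)} (\<lambda>x. cmod (f x)) = integral {0..real N} (\<lambda>x. cmod (f x)) + a N"
        unfolding a_def by (intro Henstock_Kurzweil_Integration.integral_combine[symmetric] ci) auto
      then show ?case using Suc.IH by simp
    qed simp
    also have "\<dots> = (\<integral>x. indicator {0..real N} x *\<^sub>R cmod (f x) \<partial>lborel)"
      using set_borel_integral_eq_integral(2)[of "{0..real N}" "\<lambda>x. cmod (f x)"]
        integrable_mult_indicator[of "{0..real N}" lborel "\<lambda>x. cmod (f x)"] int
      by (simp add: set_integrable_def set_lebesgue_integral_def)
    also have "\<dots> \<le> (\<integral>x. cmod (f x) \<partial>lborel)"
      using integrable_mult_indicator[of "{0..real N}" lborel "\<lambda>x. cmod (f x)"] int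
      by (intro integral_mono) (simp_all split: split_indicator)
    finally show ?thesis .
  qed
  have a0: "0 \<le> a n" for n unfolding a_def by (intro Henstock_Kurzweil_Integration.integral_nonneg ci) auto
  have "summable a"
    using partial by (intro summableI_nonneg_bounded a0)
  moreover have "norm (c / 2 * inverse (real (Suc n))) \<le> a n" if n: "n \<ge> N0" for n
  proof -
    have "((\<lambda>x. c / real (Suc n) * (sin (pi * x))\<^sup>2) has_integral c / real (Suc n) * (1 / 2)) {real n..real (Suc n)}"
      by (intro has_integral_mult_right integral_sin_squared_unit)
    then have "c / real (Suc n) * (1 / 2) \<le> a n"
      unfolding a_def
    proof (rule has_integral_le[OF _ integrable_integral[OF ci]])
      fix x assume x: "x \<in> {real n..real (Suc n)}"
      have "c * (sin (pi * x))\<^sup>2 \<le> cmod (al + be * of_real x) * (sin (pi * x))\<^sup>2"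
        using x n by (intro mult_right_mono c) auto
      also have "\<dots> = cmod (of_real x * f x)" unfolding eq by (simp add: norm_mult norm_power)
      also have "\<dots> \<le> real (Suc n) * cmod (f x)" unfolding norm_mult using x by (intro mult_right_mono) auto
      finally show "c / real (Suc n) * (sin (pi * x))\<^sup>2 \<le> cmod (f x)" by (simp add: divide_le_eq mult.commute)
    qed
    moreover have "norm (c / 2 * inverse (real (Suc n))) = c / real (Suc n) * (1 / 2)"
      using c(1) by (simp add: abs_mult inverse_eq_divide del: of_nat_Suc)
    ultimately show ?thesis by (simp only:)
  qed
  ultimately have s: "summable (\<lambda>n. c / 2 * inverse (real (Suc n)))"
    by (rule summable_comparison_test'[where N = N0])
  have "(\<lambda>n. 2 / c * (c / 2 * inverse (real (Suc n)))) = (\<lambda>n. inverse (real (Suc n)))"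
    using c(1) by (simp add: fun_eq_iff del: of_nat_Suc)
  with summable_mult[OF s, of "2 / c"] have "summable (\<lambda>n. inverse (real (Suc n)))"
    by (simp only:)
  then have "summable (\<lambda>n. inverse (real n))"
    using summable_Suc_iff[of "\<lambda>n. inverse (real n)"] by (simp only:)
  moreover have "\<not> summable (\<lambda>n. inverse (real n))"
    by (rule not_summable_harmonic)
  ultimately show False by contradiction
qed

text \<open>The derivative at 0 is not prescribed, so \<open>E\<close> may have a simple zero there;
  \<open>z * E z\<close> has double zeros at all integers. It is a linear factor times the squared
  sine, and integrability of \<open>E\<close> forces the factor to vanish.\<close>

lemma exp_type_le_interpolation_unique:
  fixes E :: "complex \<Rightarrow> complex"
  assumes hol: "E holomorphic_on UNIV" and type: "exp_type_le E 1"
    and int: "integrable lborel (\<lambda>x. E (of_real x))"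
    and zero: "\<And>n. n \<in> \<int> \<Longrightarrow> E n = 0" "\<And>n. n \<in> \<int> \<Longrightarrow> n \<noteq> 0 \<Longrightarrow> deriv E n = 0"
  shows "E z = 0"
proof -
  obtain M where M: "M > 0" "\<And>z. cmod (E z) \<le> M * exp (2 * pi * \<bar>Im z\<bar>)"
    using exp_type_le_integrable_real[OF hol type int] by blast
  define g where "g z = z * E z" for z
  have g_hol: "g holomorphic_on UNIV" unfolding g_def by (intro holomorphic_intros hol)
  have "deriv g n = 0" if "n \<in> \<int>" for n
  proof (rule DERIV_imp_deriv)
    have "(E has_field_derivative deriv E n) (at n)"
      using holomorphic_on_imp_differentiable_at[OF hol] by (simp add: DERIV_deriv_iff_field_differentiable)
    then have "(g has_field_derivative E n + deriv E n * n) (at n)"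
      unfolding g_def by (auto intro!: derivative_eq_intros)
    then show "(g has_field_derivative 0) (at n)" using zero that by (cases "n = 0") auto
  qed
  moreover have "cmod (g z) \<le> (0 + M * cmod z) * exp (2 * pi * \<bar>Im z\<bar>)" for z
    using mult_left_mono[OF M(2)[of z], of "cmod z"] by (simp add: g_def norm_mult mult_ac)
  moreover have "g n = 0" if "n \<in> \<int>" for n using zero(1)[OF that] by (simp add: g_def)
  ultimately obtain al be where g: "\<And>z. g z = (al + be * z) * (sin (of_real pi * z))\<^sup>2"
    using double_zeros_linear_factor[OF g_hol, of 0 M] M(1) by (metis less_imp_le order_refl)
  have "al = 0 \<and> be = 0"
  proof (rule linear_factor_not_integrable[OF int])
    show "continuous_on UNIV (\<lambda>x. E (of_real x))"
      using holomorphic_on_imp_continuous_on[OF hol]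
      by (rule continuous_on_compose2) (auto intro!: continuous_intros)
    show "of_real x * E (of_real x) = (al + be * of_real x) * of_real ((sin (pi * x))\<^sup>2)" for x
      using g[of "of_real x"] by (simp add: g_def sin_of_real[symmetric])
  qed
  then have "z * E z = 0" using g[of z] by (simp add: g_def)
  then show ?thesis using zero(1)[of 0] by (cases "z = 0") auto
qed

section \<open>Truncated Gaussians and the extremal problem\<close>

lemma has_bochner_integral_even_half:
  fixes h :: "real \<Rightarrow> real"
  assumes h: "has_bochner_integral lborel h c" and even: "\<And>y. h (- y) = h y"
  shows "has_bochner_integral lborel (\<lambda>x. indicator {0<..} x * h x) (c / 2)"
proof -
  have int: "integrable lborel h" and c: "integral\<^sup>L lborel h = c" using h by (auto simp: has_bochner_integral_iff)
  have [measurable]: "h \<in> borel_measurable borel" using int by auto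
  define P where "P = (\<integral>y. indicator {0<..} y * h y \<partial>lborel)"
  have ind: "integrable lborel (\<lambda>y. indicator A y * h y)" if "A \<in> sets borel" for A
    using integrable_mult_indicator[of A lborel h] that int by simp
  have "(\<integral>y. h y \<partial>lborel) = (\<integral>y. indicator {0<..} y * h y + indicator {..<0} y * h y \<partial>lborel)"
  proof (rule integral_cong_AE)
    have "AE y in lborel. y \<noteq> (0::real)" by (rule AE_lborel_singleton)
    then show "AE y in lborel. h y = indicator {0<..} y * h y + indicator {..<0} y * h y"
      by eventually_elim (auto simp: indicator_def)
  qed auto
  also have "\<dots> = P + (\<integral>y. indicator {..<0} y * h y \<partial>lborel)"
    unfolding P_def by (intro Bochner_Integration.integral_add ind) auto
  also have "(\<integral>y. indicator {..<0} y * h y \<partial>lborel) = (\<integral>y. indicator {..<0} (0 + (-1) * y) * h (0 + (-1) * y) \<partial>lborel)"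
    by (subst lborel_integral_real_affine[of "-1" _ 0]) auto
  also have "\<dots> = P"
    unfolding P_def by (intro Bochner_Integration.integral_cong) (auto simp: indicator_def even)
  finally have "P = c / 2" using c by simp
  then show ?thesis using ind[of "{0<..}"] by (simp add: has_bochner_integral_iff P_def)
qed

text \<open>The integers split into 0 and two copies of the positive integers, and
  \<open>pi * lam * n^2\<close> is \<open>a * n^2 / 2\<close> for
  \<open>a = 2 * pi * lam\<close>.\<close>

lemma theta3_eq_theta_tail:
  assumes lam: "lam > 0"
  shows "Re (theta3 0 (\<i> * of_real lam)) = 1 + 2 * theta_tail (2 * pi * lam)"
proof -
  define f where "f n = exp (- pi * lam * (of_int n)\<^sup>2)" for n :: int
  define g where "g n = exp (- (2 * pi * lam) * (real (Suc n))\<^sup>2 / 2)" for n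
  have g: "(g has_sum theta_tail (2 * pi * lam)) UNIV"
  proof (rule norm_summable_imp_has_sum)
    have "summable g"
      unfolding g_def using lam by (intro summable_theta_tail) auto
    moreover have "theta_tail (2 * pi * lam) = suminf g"
      unfolding theta_tail_def g_def ..
    moreover have "norm (g n) = g n" for n by (simp add: g_def)
    ultimately show "g sums theta_tail (2 * pi * lam)" "summable (\<lambda>n. norm (g n))"
      by (simp_all only: summable_sums)
  qed
  have 1: "(f has_sum theta_tail (2 * pi * lam)) (range (\<lambda>n. int (Suc n)))"
  proof (subst has_sum_reindex)
    show "(f \<circ> (\<lambda>n. int (Suc n)) has_sum theta_tail (2 * pi * lam)) UNIV"
      by (rule has_sum_cong[THEN iffD1, OF _ g]) (simp add: f_def g_def o_def del: of_nat_Suc)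
  qed (auto simp: inj_on_def)
  have 2: "(f has_sum theta_tail (2 * pi * lam)) (range (\<lambda>n. - int (Suc n)))"
  proof (subst has_sum_reindex)
    show "(f \<circ> (\<lambda>n. - int (Suc n)) has_sum theta_tail (2 * pi * lam)) UNIV"
      by (rule has_sum_cong[THEN iffD1, OF _ g]) (simp add: f_def g_def o_def del: of_nat_Suc)
  qed (auto simp: inj_on_def)
  have 3: "(f has_sum 1) {0}" by (rule has_sum_finiteI) (auto simp: f_def)
  have "(f has_sum (1 + theta_tail (2 * pi * lam) + theta_tail (2 * pi * lam)))
      ({0} \<union> range (\<lambda>n. int (Suc n)) \<union> range (\<lambda>n. - int (Suc n)))"
    by (intro has_sum_Un_disjoint 1 2 3) (auto simp: image_iff)
  moreover have "{0} \<union> range (\<lambda>n. int (Suc n)) \<union> range (\<lambda>n. - int (Suc n)) = UNIV"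
  proof (intro equalityI subsetI)
    fix k :: int
    show "k \<in> {0} \<union> range (\<lambda>n. int (Suc n)) \<union> range (\<lambda>n. - int (Suc n))"
    proof (cases k rule: int_cases)
      case (nonneg n)
      then show ?thesis by (cases n) auto
    next
      case (neg n)
      then show ?thesis by blast
    qed
  qed auto
  ultimately have "infsum f UNIV = 1 + 2 * theta_tail (2 * pi * lam)"
    by (simp add: infsumI)
  then show ?thesis unfolding theta3_i_eq f_def by simp
qed

text \<open>The value at 0 is left open: it will be 0 for minorants, 1 for majorants and
  \<open>1 / 2\<close> for \<open>trunc_gauss\<close>. Among the conclusions it shows only in the
  lattice sum.\<close>

lemma truncation_properties:
  fixes phi :: "real \<Rightarrow> real"
  assumes lam: "lam > 0" and pos: "\<And>x. x > 0 \<Longrightarrow> phi x = exp (- pi * lam * x\<^sup>2)"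
    and neg: "\<And>x. x < 0 \<Longrightarrow> phi x = 0" and zero: "0 \<le> phi 0" "phi 0 \<le> 1"
  shows "\<And>x. (1 + x\<^sup>2) * \<bar>phi x\<bar> \<le> 1 + 1 / (pi * lam)"
    and "\<And>x. x \<noteq> 0 \<Longrightarrow> \<exists>D. (phi has_real_derivative D) (at x)"
    and "\<And>m r. r \<longlonglongrightarrow> 1 \<Longrightarrow> (\<lambda>j. phi (r j * m)) \<longlonglongrightarrow> phi m"
    and "has_bochner_integral lborel phi (1 / (2 * sqrt lam))"
    and "(\<Sum>n. phi (real n) + phi (- real (Suc n))) = phi 0 + theta_tail (2 * pi * lam)"
proof -
  define b where "b = pi * lam"
  have b: "b > 0" using lam by (simp add: b_def)
  define G where "G x = exp (- b * x\<^sup>2)" for x :: real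
  have pos': "phi x = G x" if "x > 0" for x using pos[OF that] by (simp add: G_def b_def mult.assoc)
  show "(1 + x\<^sup>2) * \<bar>phi x\<bar> \<le> 1 + 1 / (pi * lam)" for x
  proof -
    have "\<bar>phi x\<bar> \<le> G x"
      using pos'[of x] neg[of x] zero by (cases x "0::real" rule: linorder_cases) (auto simp: G_def)
    then have "(1 + x\<^sup>2) * \<bar>phi x\<bar> \<le> (1 + x\<^sup>2) * G x" by (intro mult_left_mono) auto
    also have "\<dots> \<le> ((1 + 1 / b) * exp (b * x\<^sup>2)) * G x"
    proof (intro mult_right_mono)
      have "1 + x\<^sup>2 \<le> (1 + 1 / b) * (1 + b * x\<^sup>2)" using b by (simp add: field_simps)
      also have "\<dots> \<le> (1 + 1 / b) * exp (b * x\<^sup>2)"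
        using b by (intro mult_left_mono exp_ge_add_one_self) auto
      finally show "1 + x\<^sup>2 \<le> (1 + 1 / b) * exp (b * x\<^sup>2)" .
    qed (simp add: G_def)
    also have "\<dots> = 1 + 1 / b" by (simp add: G_def mult.assoc flip: exp_add)
    finally show ?thesis by (simp add: b_def)
  qed
  show der: "\<exists>D. (phi has_real_derivative D) (at x)" if "x \<noteq> 0" for x
  proof (cases "x > 0")
    case True
    have "(G has_real_derivative (- b * (2 * x) * exp (- b * x\<^sup>2))) (at x)"
      unfolding G_def by (auto intro!: derivative_eq_intros)
    then have "(phi has_real_derivative (- b * (2 * x) * exp (- b * x\<^sup>2))) (at x)"
      by (rule has_field_derivative_transform_within_open[of _ _ _ "{0<..}"]) (use True pos' in auto)
    then show ?thesis by blast
  next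
    case False
    have "((\<lambda>_. 0) has_real_derivative 0) (at x)" by simp
    then have "(phi has_real_derivative 0) (at x)"
      by (rule has_field_derivative_transform_within_open[of _ _ _ "{..<0}"]) (use False that neg in auto)
    then show ?thesis by blast
  qed
  show "(\<lambda>j. phi (r j * m)) \<longlonglongrightarrow> phi m" if r: "r \<longlonglongrightarrow> 1" for m r
  proof (cases "m = 0")
    case False
    then have "isCont phi m" using der DERIV_isCont by blast
    moreover have "(\<lambda>j. r j * m) \<longlonglongrightarrow> 1 * m" by (intro tendsto_mult r tendsto_const)
    ultimately show ?thesis using isCont_tendsto_compose by fastforce
  qed simp
  have "has_bochner_integral lborel (\<lambda>y. exp (- (2 * b) * y\<^sup>2 / 2)) (sqrt (2 * pi / (2 * b)))"
    using b by (intro gauss_integral) auto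
  moreover have "sqrt (2 * pi / (2 * b)) = 1 / sqrt lam" by (simp add: b_def real_sqrt_divide)
  ultimately have "has_bochner_integral lborel G (1 / sqrt lam)"
    by (simp add: G_def[abs_def])
  then have half: "has_bochner_integral lborel (\<lambda>x. indicator {0<..} x * G x) (1 / sqrt lam / 2)"
    by (rule has_bochner_integral_even_half) (simp add: G_def)
  define c0 where "c0 = phi 0"
  have phi_eq: "phi x = indicator {0<..} x * G x + c0 * indicator {0} x" for x
    using c0_def pos'[of x] neg[of x] by (cases x "0::real" rule: linorder_cases) (auto simp: indicator_def)
  have [measurable]: "G \<in> borel_measurable borel" unfolding G_def[abs_def] by measurable
  have phi_meas: "phi \<in> borel_measurable borel"
    unfolding phi_eq[abs_def] by measurable
  have "AE x in lborel. x \<noteq> (0::real)" by (rule AE_lborel_singleton)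
  then have "AE x in lborel. phi x = indicator {0<..} x * G x"
    by eventually_elim (simp add: phi_eq indicator_def)
  then show "has_bochner_integral lborel phi (1 / (2 * sqrt lam))"
    using half phi_meas by (subst has_bochner_integral_cong_AE[where g = "\<lambda>x. indicator {0<..} x * G x"]) (auto simp: mult.commute)
  have s: "summable (\<lambda>n. phi (real (Suc n)))"
    and e: "(\<Sum>n. phi (real (Suc n))) = theta_tail (2 * pi * lam)"
  proof -
    have "phi (real (Suc n)) = exp (- (2 * pi * lam) * (real (Suc n))\<^sup>2 / 2)" for n
      using pos[of "real (Suc n)"] by (simp del: of_nat_Suc)
    then show "summable (\<lambda>n. phi (real (Suc n)))" "(\<Sum>n. phi (real (Suc n))) = theta_tail (2 * pi * lam)"
      using summable_theta_tail(1)[of "2 * pi * lam"] lam by (simp_all only: theta_tail_def) auto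
  qed
  have n0: "phi (- real (Suc n)) = 0" for n using neg[of "- real (Suc n)"] by simp
  have "summable (\<lambda>n. phi (real n))"
    using s summable_Suc_iff[of "\<lambda>n. phi (real n)"] by (simp only:)
  from suminf_split_head[OF this] e
  show "(\<Sum>n. phi (real n) + phi (- real (Suc n))) = phi 0 + theta_tail (2 * pi * lam)"
    unfolding n0 by (simp del: of_nat_Suc)
qed

lemma entire_isCont_of_real:
  assumes "F holomorphic_on UNIV"
  shows "isCont (\<lambda>x. F (complex_of_real x)) x"
proof -
  have "isCont complex_of_real x" by (intro continuous_intros)
  moreover have "isCont F (of_real x)"
    using holomorphic_on_imp_continuous_on[OF assms] by (simp add: continuous_on_eq_continuous_at)
  ultimately show ?thesis by (rule isCont_o2)
qed

text \<open>Here \<open>I\<close> is the integral of \<open>phi\<close> and \<open>S\<close> its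
  lattice sum. By the last claim \<open>I - S\<close> bounds the integral of \<open>phi - f\<close>
  from below, and the excess over it bounds \<open>phi - f\<close> at every integer. Finiteness of
  the nonnegative integral makes \<open>f\<close> integrable, as \<open>quadrature_bound\<close>
  requires.\<close>

lemma extremal_dichotomy:
  fixes F :: "complex \<Rightarrow> complex" and phi :: "real \<Rightarrow> real"
  defines "f \<equiv> \<lambda>x. Re (F (of_real x))"
  assumes hol: "F holomorphic_on UNIV" and type: "exp_type_le F 1"
    and real: "\<And>x::real. F (of_real x) \<in> \<real>"
    and le: "\<And>x. f x \<le> phi x" and phi: "\<And>x. (1 + x\<^sup>2) * \<bar>phi x\<bar> \<le> C"
    and phi_lim: "\<And>m r. r \<longlonglongrightarrow> 1 \<Longrightarrow> (\<lambda>j. phi (r j * m)) \<longlonglongrightarrow> phi m"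
    and phi_int: "has_bochner_integral lborel phi I"
    and sum: "(\<Sum>n. phi (real n) + phi (- real (Suc n))) = S"
    and fin: "(\<integral>\<^sup>+x. ennreal (phi x - f x) \<partial>lborel) \<noteq> \<infinity>"
  shows "integrable lborel f"
    and "(\<integral>\<^sup>+x. ennreal (phi x - f x) \<partial>lborel) = ennreal (\<integral>x. phi x - f x \<partial>lborel)"
    and "0 \<le> (\<integral>x. phi x - f x \<partial>lborel)"
    and "m \<in> \<int> \<Longrightarrow> phi m - f m \<le> (\<integral>x. phi x - f x \<partial>lborel) - (I - S)"
proof -
  have fm[measurable]: "f \<in> borel_measurable borel"
    unfolding f_def
    by (intro borel_measurable_continuous_onI continuous_at_imp_continuous_on ballI)
       (simp add: isCont_def tendsto_Re entire_isCont_of_real[OF hol, unfolded isCont_def])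
  have pm[measurable]: "phi \<in> borel_measurable borel" and pint: "integrable lborel phi" "integral\<^sup>L lborel phi = I"
    using phi_int by (auto simp: has_bochner_integral_iff)
  have diff: "integrable lborel (\<lambda>x. phi x - f x)"
  proof (rule integrableI_nonneg)
    show "(\<integral>\<^sup>+x. ennreal (phi x - f x) \<partial>lborel) < \<infinity>" using fin by (simp add: less_top)
  qed (use le in auto)
  have "integrable lborel (\<lambda>x. phi x - (phi x - f x))" by (intro Bochner_Integration.integrable_diff pint diff)
  then show int: "integrable lborel f" by simp
  show "(\<integral>\<^sup>+x. ennreal (phi x - f x) \<partial>lborel) = ennreal (\<integral>x. phi x - f x \<partial>lborel)"
    using le by (intro nn_integral_eq_integral diff) auto
  show "0 \<le> (\<integral>x. phi x - f x \<partial>lborel)" using le by (intro Bochner_Integration.integral_nonneg) auto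
  assume m: "m \<in> \<int>"
  have "phi m - f m \<le> S - (\<integral>x. f x \<partial>lborel)"
    using quadrature_bound[OF hol type real int[unfolded f_def] le[unfolded f_def] phi phi_lim m]
    unfolding sum f_def by simp
  moreover have "(\<integral>x. phi x - f x \<partial>lborel) = I - (\<integral>x. f x \<partial>lborel)"
    using Bochner_Integration.integral_diff[OF pint(1) int] pint(2) by simp
  ultimately show "phi m - f m \<le> (\<integral>x. phi x - f x \<partial>lborel) - (I - S)" by simp
qed

text \<open>The function \<open>phi - Re F\<close> is nonnegative and vanishes at the integers, so
  it has a minimum there, and the derivatives agree wherever \<open>phi\<close> is differentiable,
  in particular off 0. Hence \<open>F - F0\<close> meets the conditions of
  \<open>exp_type_le_interpolation_unique\<close>.\<close>

lemma extremal_unique: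
  fixes F F0 :: "complex \<Rightarrow> complex" and phi :: "real \<Rightarrow> real"
  assumes F: "F holomorphic_on UNIV" "exp_type_le F 1" "\<And>x::real. F (of_real x) \<in> \<real>"
      "\<And>x. Re (F (of_real x)) \<le> phi x" "integrable lborel (\<lambda>x. Re (F (of_real x)))"
      "\<And>m. m \<in> \<int> \<Longrightarrow> Re (F (of_real m)) = phi m"
    and F0: "F0 holomorphic_on UNIV" "exp_type_le F0 1" "\<And>x::real. F0 (of_real x) \<in> \<real>"
      "\<And>x. Re (F0 (of_real x)) \<le> phi x" "integrable lborel (\<lambda>x. Re (F0 (of_real x)))"
      "\<And>m. m \<in> \<int> \<Longrightarrow> Re (F0 (of_real m)) = phi m"
    and der: "\<And>x. x \<noteq> 0 \<Longrightarrow> \<exists>D. (phi has_real_derivative D) (at x)"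
  shows "F = F0"
proof -
  \<comment> \<open>\<open>SOME\<close> names the derivative of \<open>phi\<close> at
    \<open>m\<close>, so that \<open>F\<close> and \<open>F0\<close> are compared with the same
    number.\<close>
  have touch: "H (of_real m) = of_real (phi m) \<and> (m \<noteq> 0 \<longrightarrow> deriv H (of_real m) = of_real (SOME D. (phi has_real_derivative D) (at m)))"
    if m: "m \<in> \<int>" and H: "H holomorphic_on UNIV" "\<And>x::real. H (of_real x) \<in> \<real>"
      "\<And>x. Re (H (of_real x)) \<le> phi x" "\<And>m. m \<in> \<int> \<Longrightarrow> Re (H (of_real m)) = phi m" for H and m :: real
  proof (intro conjI impI)
    show "H (of_real m) = of_real (phi m)"
      using H(2)[of m] H(4)[OF m] by (simp add: complex_is_Real_iff complex_eq_iff)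
    assume m0: "m \<noteq> 0"
    define D where "D = (SOME D. (phi has_real_derivative D) (at m))"
    have D: "(phi has_real_derivative D) (at m)" unfolding D_def by (rule someI_ex) (rule der[OF m0])
    have "(H has_field_derivative deriv H (of_real m)) (at (of_real m))"
      using holomorphic_on_imp_differentiable_at[OF H(1)] by (simp add: DERIV_deriv_iff_field_differentiable)
    then have "((\<lambda>x. H (of_real x)) has_vector_derivative (1 * deriv H (of_real m))) (at m)"
      by (intro field_vector_diff_chain_at[of of_real, unfolded o_def]) (auto intro!: derivative_eq_intros)
    then have v: "((\<lambda>x. H (of_real x)) has_vector_derivative deriv H (of_real m)) (at m)" by simp
    have "((\<lambda>x. Re (H (of_real x))) has_real_derivative Re (deriv H (of_real m))) (at m)"
      using bounded_linear.has_vector_derivative[OF bounded_linear_Re v]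
      by (simp add: has_real_derivative_iff_has_vector_derivative)
    from DERIV_diff[OF D this] have "((\<lambda>x. phi x - Re (H (of_real x))) has_real_derivative D - Re (deriv H (of_real m))) (at m)" .
    then have "D - Re (deriv H (of_real m)) = 0"
      by (rule DERIV_local_min[where d = 1]) (use H(3) H(4)[OF m] in auto)
    moreover have "Im (deriv H (of_real m)) = 0"
    proof -
      have "((\<lambda>x. Im (H (of_real x))) has_real_derivative Im (deriv H (of_real m))) (at m)"
        using bounded_linear.has_vector_derivative[OF bounded_linear_Im v]
        by (simp add: has_real_derivative_iff_has_vector_derivative)
      moreover have "(\<lambda>x. Im (H (of_real x))) = (\<lambda>_. 0)" using H(2) by (simp add: complex_is_Real_iff)
      ultimately show ?thesis using DERIV_unique[OF _ DERIV_const[of "0::real" "at m"]] by simp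
    qed
    ultimately show "deriv H (of_real m) = of_real (SOME D. (phi has_real_derivative D) (at m))"
      by (simp add: D_def[symmetric] complex_eq_iff)
  qed
  define E where "E z = F z - F0 z" for z
  have E_int: "integrable lborel (\<lambda>x. E (of_real x))"
  proof -
    have "E (of_real x) = of_real (Re (F (of_real x)) - Re (F0 (of_real x)))" for x
      using F(3)[of x] F0(3)[of x] by (simp add: E_def of_real_Re)
    then show ?thesis using F(5) F0(5) by (simp only: integrable_of_real Bochner_Integration.integrable_diff)
  qed
  have "E z = 0" for z
  proof (rule exp_type_le_interpolation_unique[OF _ _ E_int])
    show "E holomorphic_on UNIV" unfolding E_def by (intro holomorphic_intros F F0)
    have "exp_type_le (\<lambda>z. - F0 z) 1" using F0(2) by (simp add: exp_type_le_def)
    from exp_type_le_add[OF F(2) this] show "exp_type_le E 1" by (simp add: E_def[abs_def])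
    fix n :: complex assume "n \<in> \<int>"
    then obtain k :: int where k: "n = of_real (of_int k)" by (auto elim!: Ints_cases)
    note t = touch[of "of_int k" F, OF _ F(1,3,4,6)] touch[of "of_int k" F0, OF _ F0(1,3,4,6)]
    show "E n = 0" using t by (simp add: E_def k)
    assume "n \<noteq> 0"
    then have "deriv F n = deriv F0 n" using t by (simp add: k)
    moreover have "deriv E n = deriv F n - deriv F0 n"
      unfolding E_def using holomorphic_on_imp_differentiable_at F(1) F0(1) by (intro deriv_diff) auto
    ultimately show "deriv E n = 0" by simp
  qed
  then show ?thesis by (auto simp: E_def)
qed

section \<open>The inequalities for \<open>L_plus\<close> and \<open>M_plus\<close>\<close>

text \<open>The partition of unity \<open>sinc_sq_sums\<close>, divided by
  \<open>(sin (pi * x))^2 / pi^2\<close>, with the term at 0 moved to the right.\<close>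

lemma inverse_square_lattice_sum:
  fixes x :: real
  assumes x: "x \<notin> \<int>"
  shows "(\<lambda>n. 1 / (x - real (Suc n))\<^sup>2 + 1 / (x + real (Suc n))\<^sup>2) sums (pi\<^sup>2 / (sin (pi * x))\<^sup>2 - 1 / x\<^sup>2)"
proof -
  define s where "s = (sin (pi * x))\<^sup>2"
  have "of_real x \<notin> (\<int> :: complex set)" using x by (auto elim!: Ints_cases)
  then have "sin (of_real pi * of_real x :: complex) \<noteq> 0" by (simp add: sin_pi_eq_0_iff)
  then have s: "s \<noteq> 0" unfolding s_def by (metis of_real_0 of_real_mult power_zero_numeral sin_of_real zero_eq_power2)
  have sq: "sinc_sq (x - k) = s / pi\<^sup>2 * (1 / (x - k)\<^sup>2)" if "k \<in> \<int>" for k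
  proof -
    have "x - k \<noteq> 0" using x that by auto
    then have "sinc_sq (x - k) = (sin (pi * (x - k)))\<^sup>2 / (pi\<^sup>2 * (x - k)\<^sup>2)" by (rule sinc_sq_props(8))
    also have "(sin (pi * (x - k)))\<^sup>2 = s"
    proof -
      have "(of_real k :: complex) \<in> \<int>" using that by (auto elim!: Ints_cases)
      from sin_pi_squared_shift[OF this, of "of_real x"]
      have "complex_of_real ((sin (pi * (x - k)))\<^sup>2) = of_real s" by (simp add: s_def sin_of_real[symmetric])
      then show ?thesis by (simp only: of_real_eq_iff)
    qed
    finally show ?thesis by simp
  qed
  define p q where "p n = 1 / (x - real n)\<^sup>2" and "q n = 1 / (x + real (Suc n))\<^sup>2" for n
  have "(\<lambda>n. s / pi\<^sup>2 * (p n + q n)) sums 1"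
    using sinc_sq_sums[of x] sq[of "real n" for n] sq[of "- real (Suc n)" for n]
    by (simp add: p_def q_def distrib_left del: of_nat_Suc)
  from sums_mult[OF this, of "pi\<^sup>2 / s"] have pq: "(\<lambda>n. p n + q n) sums (pi\<^sup>2 / s)" using s by simp
  \<comment> \<open>The two halves are summed separately, since dropping the term at 0 shifts the
    index of \<open>p\<close> but not of \<open>q\<close>.\<close>
  have "summable p" "summable q"
    by (rule summable_comparison_test'[OF sums_summable[OF pq], of 0]; simp add: p_def q_def)+
  then have "(\<lambda>n. p (Suc n)) sums (suminf p - p 0)" "q sums suminf q"
    using sums_split_initial_segment[of p "suminf p" 1] by (auto simp: summable_sums)
  from sums_add[OF this] have "(\<lambda>n. p (Suc n) + q n) sums (suminf p + suminf q - p 0)"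
    by (simp only: diff_add_eq)
  moreover have "suminf p + suminf q = pi\<^sup>2 / s"
    using suminf_add[OF \<open>summable p\<close> \<open>summable q\<close>] pq by (simp add: sums_iff)
  ultimately show ?thesis by (simp add: p_def q_def s_def)
qed

text \<open>For \<open>x > 0\<close> the gap is \<open>s / pi^2\<close> times the quantity in
  \<open>right_tail_bounds\<close> with \<open>Z = pi^2 / s\<close>. For \<open>x < 0\<close> the
  truncated Gaussian vanishes, and the gap is \<open>- s / pi^2\<close> times the series of
  \<open>left_tail_bounds\<close> at \<open>t = - x\<close>, divided by \<open>t\<close>. The upper
  bound \<open>sinc_sq x\<close> is the difference between \<open>M_plus\<close> and
  \<open>L_plus\<close>.\<close>

lemma L_plus_gap:
  assumes lam: "lam > 0" and x: "x \<notin> \<int>"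
  shows "L_plus lam (of_real x) \<in> \<real>"
    and "0 \<le> trunc_gauss lam x - Re (L_plus lam (of_real x))"
    and "trunc_gauss lam x - Re (L_plus lam (of_real x)) \<le> sinc_sq x"
proof -
  define a where "a = 2 * pi * lam"
  have a: "a > 0" using lam by (simp add: a_def)
  have x0: "x \<noteq> 0" using x by auto
  define s where "s = (sin (pi * x))\<^sup>2"
  define R where "R n = exp (- a * (real (Suc n))\<^sup>2 / 2) * (1 / (x - real (Suc n))\<^sup>2 - a * (real (Suc n))\<^sup>2 / (x * (x - real (Suc n))))" for n
  have cx: "complex_of_real x \<notin> \<int>" using x by (auto elim!: Ints_cases)
  have s0: "s \<noteq> 0"
  proof -
    have "sin (of_real pi * of_real x :: complex) \<noteq> 0" using cx by (simp add: sin_pi_eq_0_iff)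
    then show ?thesis unfolding s_def by (metis of_real_0 of_real_mult power_zero_numeral sin_of_real zero_eq_power2)
  qed
  have s_nonneg: "0 \<le> s" by (simp add: s_def)
  have sinc: "sinc_sq x = s / pi\<^sup>2 * (1 / x\<^sup>2)" using sinc_sq_props(8)[OF x0] by (simp add: s_def)
  have term_eq: "gauss lam (of_nat (Suc n)) / (of_real x - of_nat (Suc n))\<^sup>2
         + deriv (gauss lam) (of_nat (Suc n)) / (of_real x - of_nat (Suc n))
         - deriv (gauss lam) (of_nat (Suc n)) / of_real x = of_real (R n)" for n
  proof -
    define m where "m = real (Suc n)"
    have m: "of_nat (Suc n) = complex_of_real m" by (simp add: m_def)
    have ne: "x - m \<noteq> 0" using x by (auto simp: m_def)
    have G: "gauss lam (of_real m) = of_real (exp (- a * m\<^sup>2 / 2))"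
      by (simp add: gauss_def a_def mult_ac flip: exp_of_real)
    define g where "g = exp (- a * m\<^sup>2 / 2)"
    have "g / (x - m)\<^sup>2 + (- a * m * g) / (x - m) - (- a * m * g) / x = R n"
    proof -
      have "1 / (x - m) - 1 / x = m / (x * (x - m))" using ne x0 by (simp add: field_simps)
      then have "(- a * m * g) * (1 / (x - m) - 1 / x) = (- a * m * g) * (m / (x * (x - m)))" by simp
      then show ?thesis
        unfolding R_def m_def[symmetric] g_def[symmetric]
        by (simp add: right_diff_distrib power2_eq_square mult_ac)
    qed
    moreover have "gauss lam (of_real m) / (of_real x - of_real m)\<^sup>2
         + deriv (gauss lam) (of_real m) / (of_real x - of_real m)
         - deriv (gauss lam) (of_real m) / of_real x
       = complex_of_real (g / (x - m)\<^sup>2 + (- a * m * g) / (x - m) - (- a * m * g) / x)"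
      unfolding deriv_gauss G g_def[symmetric] by (simp add: a_def mult_ac)
    ultimately show ?thesis unfolding m by simp
  qed
  have L: "L_plus lam (of_real x) = of_real (s / pi\<^sup>2 * suminf R)" if "summable R"
    unfolding L_plus_eq[OF lam cx] term_eq suminf_of_real[OF that, symmetric]
    by (simp add: s_def sin_of_real[symmetric])
  have main: "summable R \<and> 0 \<le> trunc_gauss lam x - s / pi\<^sup>2 * suminf R \<and> trunc_gauss lam x - s / pi\<^sup>2 * suminf R \<le> sinc_sq x"
  proof (cases "x > 0")
    case True
    define Z where "Z = pi\<^sup>2 / s"
    have "(\<lambda>n. 1 / (x - real (Suc n))\<^sup>2 + 1 / (x + real (Suc n))\<^sup>2) sums (Z - 1 / x\<^sup>2)"
      unfolding Z_def s_def by (rule inverse_square_lattice_sum[OF x])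
    note b = right_tail_bounds[OF a True x this, folded R_def]
    have G: "exp (- a * x\<^sup>2 / 2) = trunc_gauss lam x" using True by (simp add: trunc_gauss_def a_def)
    have eq: "trunc_gauss lam x - s / pi\<^sup>2 * suminf R = s / pi\<^sup>2 * (trunc_gauss lam x * Z - suminf R)"
      using s0 by (simp add: Z_def right_diff_distrib)
    have "0 \<le> s / pi\<^sup>2 * (trunc_gauss lam x * Z - suminf R)"
      using b(2) s_nonneg unfolding G by (intro mult_nonneg_nonneg) auto
    moreover have "s / pi\<^sup>2 * (trunc_gauss lam x * Z - suminf R) \<le> s / pi\<^sup>2 * (1 / x\<^sup>2)"
      using b(3) s_nonneg unfolding G by (intro mult_left_mono) auto
    ultimately show ?thesis unfolding eq sinc using b(1) by simp
  next
    case False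
    define t where "t = - x"
    have t: "t > 0" "t \<notin> \<int>" using False x0 x by (auto simp: t_def)
    define v where "v n = exp (- a * (real (Suc n))\<^sup>2 / 2) * (t / (t + real (Suc n))\<^sup>2 - a * (real (Suc n))\<^sup>2 / (t + real (Suc n)))" for n
    note b = left_tail_bounds[OF a t, folded v_def]
    have R: "R n = v n / t" for n
    proof -
      define m where "m = real (Suc n)"
      define g where "g = exp (- a * m\<^sup>2 / 2)"
      have m: "m > 0" by (simp add: m_def)
      have e: "(x - m)\<^sup>2 = (t + m)\<^sup>2" "x * (x - m) = t * (t + m)"
        by (simp_all add: t_def power2_eq_square algebra_simps)
      have "g * (1 / A - B / (t * C)) = g * (t / A - B / C) / t" for A B C :: real
        using t(1) by (simp add: right_diff_distrib diff_divide_distrib)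
      then show ?thesis
        unfolding R_def v_def m_def[symmetric] e g_def[symmetric] .
    qed
    have sR: "summable R" unfolding R[abs_def] by (rule summable_divide[OF b(1)])
    have sumR: "suminf R = suminf v / t" unfolding R[abs_def] by (rule suminf_divide[OF b(1)])
    have up: "suminf R \<le> 0" unfolding sumR using b(3) t(1) by (simp add: divide_nonpos_pos)
    have "- 1 \<le> gauss_sum a" using gauss_sum_ge[OF a] by simp
    then have "- 1 / t / t \<le> gauss_sum a / t / t" using t(1) by (intro divide_right_mono) auto
    also have "\<dots> \<le> suminf R" unfolding sumR using b(2) t(1) by (intro divide_right_mono) auto
    finally have lo: "- suminf R \<le> 1 / x\<^sup>2" by (simp add: t_def power2_eq_square)
    have T: "trunc_gauss lam x = 0" using False x0 by (simp add: trunc_gauss_def)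
    have "s / pi\<^sup>2 * (- suminf R) \<le> s / pi\<^sup>2 * (1 / x\<^sup>2)"
      using lo s_nonneg by (intro mult_left_mono) auto
    moreover have "0 \<le> s / pi\<^sup>2 * (- suminf R)" using up s_nonneg by (intro mult_nonneg_nonneg) auto
    ultimately show ?thesis unfolding T sinc using sR by simp
  qed
  then show "L_plus lam (of_real x) \<in> \<real>"
    "0 \<le> trunc_gauss lam x - Re (L_plus lam (of_real x))"
    "trunc_gauss lam x - Re (L_plus lam (of_real x)) \<le> sinc_sq x"
    using L by (simp_all del: of_real_mult of_real_divide)
qed

lemma eventually_not_Ints_real: "eventually (\<lambda>w. w \<notin> \<int>) (at (z::real))"
proof -
  have "\<not> z islimpt \<int>"
    by (intro discrete_imp_not_islimpt[of 1]) (auto elim!: Ints_cases simp: dist_of_int)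
  then show ?thesis by (simp add: islimpt_iff_eventually)
qed

lemma M_plus_of_real:
  assumes "lam > 0" "x \<noteq> 0"
  shows "M_plus lam (of_real x) = L_plus lam (of_real x) + of_real (sinc_sq x)"
  using M_plus_eq[OF assms(1), of "of_real x"] csinc_squared_eq[of "of_real x"] assms(2)
  by (simp add: sinc_sq_of_real[symmetric])

lemma entire_real_if_real_off_Ints:
  assumes hol: "F holomorphic_on UNIV" and real: "\<And>x::real. x \<notin> \<int> \<Longrightarrow> F (of_real x) \<in> \<real>"
  shows "F (of_real x) \<in> \<real>"
proof -
  have lim: "((\<lambda>y. Im (F (of_real y))) \<longlongrightarrow> Im (F (of_real x))) (at x)"
    using entire_isCont_of_real[OF hol, of x] unfolding isCont_def by (rule tendsto_Im)
  have "eventually (\<lambda>y. Im (F (of_real y)) = 0) (at x)"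
    using eventually_not_Ints_real by eventually_elim (use real in \<open>simp add: complex_is_Real_iff\<close>)
  then have "((\<lambda>y. Im (F (of_real y))) \<longlongrightarrow> 0) (at x)" by (rule tendsto_eventually)
  from tendsto_unique[OF at_neq_bot lim this] have "Im (F (of_real x)) = 0" .
  then show ?thesis by (simp add: complex_is_Real_iff)
qed

text \<open>By continuity from the left, the jump forces a minorant down to the left limit
  0.\<close>

lemma minorant_nonpos_at_0:
  assumes hol: "F holomorphic_on UNIV" and le: "\<And>x::real. x < 0 \<Longrightarrow> Re (F (of_real x)) \<le> 0"
  shows "Re (F 0) \<le> 0"
proof -
  have "((\<lambda>y. Re (F (of_real y))) \<longlongrightarrow> Re (F (of_real 0))) (at_left 0)"
    using entire_isCont_of_real[OF hol, of 0] unfolding isCont_def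
    by (rule tendsto_Re[OF tendsto_within_subset]) simp
  moreover have "eventually (\<lambda>y. Re (F (of_real y)) \<le> 0) (at_left (0::real))"
    using le by (intro eventually_at_leftI[of "- 1"]) auto
  ultimately have "Re (F (of_real 0)) \<le> 0" by (intro tendsto_upperbound) auto
  then show ?thesis by simp
qed

text \<open>By continuity from the right, a majorant is at least the right limit 1.\<close>

lemma majorant_ge_1_at_0:
  assumes hol: "F holomorphic_on UNIV"
    and ge: "\<And>x::real. x > 0 \<Longrightarrow> exp (- pi * lam * x\<^sup>2) \<le> Re (F (of_real x))"
  shows "1 \<le> Re (F 0)"
proof -
  have "((\<lambda>y. Re (F (of_real y))) \<longlongrightarrow> Re (F (of_real 0))) (at_right 0)"
    using entire_isCont_of_real[OF hol, of 0] unfolding isCont_def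
    by (rule tendsto_Re[OF tendsto_within_subset]) simp
  moreover have "((\<lambda>y. exp (- pi * lam * y\<^sup>2)) \<longlongrightarrow> exp (- pi * lam * 0\<^sup>2)) (at_right 0)"
    by (intro tendsto_intros)
  moreover have "eventually (\<lambda>y. exp (- pi * lam * y\<^sup>2) \<le> Re (F (of_real y))) (at_right (0::real))"
    using ge by (intro eventually_at_rightI[of _ 1]) auto
  ultimately have "exp (- pi * lam * 0\<^sup>2) \<le> Re (F (of_real 0))"
    by (intro tendsto_le[OF trivial_limit_at_right_real])
  then show ?thesis by simp
qed

text \<open>The gap estimates hold off the integers. Continuity extends them to the nonzero
  integers, where \<open>trunc_gauss\<close> is continuous too; at 0 the one-sided limits 0 and 1
  enclose the value \<open>1 / 2\<close>.\<close>

lemma L_plus_M_plus_bounds: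
  assumes lam: "lam > 0"
  shows "L_plus lam (of_real x) \<in> \<real>" "M_plus lam (of_real x) \<in> \<real>"
    and "Re (L_plus lam (of_real x)) \<le> trunc_gauss lam x"
    and "trunc_gauss lam x \<le> Re (M_plus lam (of_real x))"
proof -
  note Lh = L_plus_holomorphic[OF lam] and Mh = M_plus_holomorphic[OF lam]
  show "L_plus lam (of_real x) \<in> \<real>"
    by (rule entire_real_if_real_off_Ints[OF Lh L_plus_gap(1)[OF lam]])
  show "M_plus lam (of_real x) \<in> \<real>"
  proof (rule entire_real_if_real_off_Ints[OF Mh])
    fix y :: real assume y: "y \<notin> \<int>"
    then have "y \<noteq> 0" by auto
    then show "M_plus lam (of_real y) \<in> \<real>"
      using L_plus_gap(1)[OF lam y] by (simp add: M_plus_of_real[OF lam])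
  qed
  have off0: "Re (L_plus lam (of_real y)) \<le> trunc_gauss lam y \<and> trunc_gauss lam y \<le> Re (M_plus lam (of_real y))"
    if y: "y \<noteq> 0" for y
  proof -
    have T: "(trunc_gauss lam \<longlongrightarrow> trunc_gauss lam y) (at y)"
    proof -
      obtain D where "(trunc_gauss lam has_real_derivative D) (at y)"
        using truncation_properties(2)[of lam "trunc_gauss lam", OF lam _ _ _ _ y] by (auto simp: trunc_gauss_def)
      then show ?thesis using DERIV_isCont isCont_def by blast
    qed
    have Lc: "((\<lambda>z. Re (L_plus lam (of_real z))) \<longlongrightarrow> Re (L_plus lam (of_real y))) (at y)"
      using entire_isCont_of_real[OF Lh, of y] unfolding isCont_def by (rule tendsto_Re)
    have Mc: "((\<lambda>z. Re (M_plus lam (of_real z))) \<longlongrightarrow> Re (M_plus lam (of_real y))) (at y)"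
      using entire_isCont_of_real[OF Mh, of y] unfolding isCont_def by (rule tendsto_Re)
    have "eventually (\<lambda>z. Re (L_plus lam (of_real z)) \<le> trunc_gauss lam z) (at y)"
      using eventually_not_Ints_real by eventually_elim (use L_plus_gap(2)[OF lam] in simp)
    moreover have "eventually (\<lambda>z. trunc_gauss lam z \<le> Re (M_plus lam (of_real z))) (at y)"
      using eventually_not_Ints_real
    proof eventually_elim
      case (elim z)
      then have "z \<noteq> 0" by auto
      then show ?case using L_plus_gap(3)[OF lam elim] by (simp add: M_plus_of_real[OF lam])
    qed
    ultimately show ?thesis
      using tendsto_le[OF _ T Lc] tendsto_le[OF _ Mc T] by auto
  qed
  have "Re (L_plus lam 0) \<le> 0"
  proof (rule minorant_nonpos_at_0[OF Lh])
    show "Re (L_plus lam (of_real y)) \<le> 0" if "y < 0" for y :: real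
      using off0[of y] that by (simp add: trunc_gauss_def)
  qed
  then show "Re (L_plus lam (of_real x)) \<le> trunc_gauss lam x"
    using off0[of x] by (cases "x = 0") (auto simp: trunc_gauss_def)
  have "1 \<le> Re (M_plus lam 0)"
  proof (rule majorant_ge_1_at_0[OF Mh])
    show "exp (- pi * lam * y\<^sup>2) \<le> Re (M_plus lam (of_real y))" if "y > 0" for y
      using off0[of y] that by (simp add: trunc_gauss_def)
  qed
  then show "trunc_gauss lam x \<le> Re (M_plus lam (of_real x))"
    using off0[of x] by (cases "x = 0") (auto simp: trunc_gauss_def)
qed

section \<open>The optimal integrals and the case of equality\<close>

text \<open>Replacing \<open>trunc_gauss\<close> by \<open>phi\<close> with \<open>phi 0 = 0\<close>
  changes a null set, so the integral \<open>d\<close> stays the same, while the lattice sum becomes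
  \<open>theta_tail (2 * pi * lam)\<close>, half of \<open>theta3 - 1\<close>; this explains
  \<open>c\<close>. The excess \<open>d - c\<close> bounds the distance to \<open>phi\<close> at
  each integer, so \<open>d = c\<close> forces interpolation.\<close>

lemma minorant_integral:
  fixes L :: "complex \<Rightarrow> complex"
  assumes lam: "lam > 0" and hol: "L holomorphic_on UNIV" and type: "exp_type_le L 1"
    and real: "\<And>x::real. L (of_real x) \<in> \<real>" and le: "\<And>x::real. Re (L (of_real x)) \<le> trunc_gauss lam x"
  defines "phi \<equiv> \<lambda>x. if x > 0 then exp (- pi * lam * x\<^sup>2) else 0"
    and "c \<equiv> - Re (theta3 0 (\<i> * of_real lam)) / 2 + 1 / 2 + 1 / (2 * sqrt lam)"
    and "d \<equiv> (\<integral>x. trunc_gauss lam x - Re (L (of_real x)) \<partial>lborel)"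
  assumes fin: "(\<integral>\<^sup>+x. ennreal (trunc_gauss lam x - Re (L (of_real x))) \<partial>lborel) \<noteq> \<infinity>"
  shows "(\<integral>\<^sup>+x. ennreal (trunc_gauss lam x - Re (L (of_real x))) \<partial>lborel) = ennreal d" "c \<le> d" "0 \<le> d"
    and "integrable lborel (\<lambda>x. Re (L (of_real x)))" "\<And>x. Re (L (of_real x)) \<le> phi x"
    and "\<And>m. d = c \<Longrightarrow> m \<in> \<int> \<Longrightarrow> Re (L (of_real m)) = phi m"
proof -
  have le': "Re (L (of_real x)) \<le> phi x" for x
  proof (cases "x = 0")
    case True
    have "Re (L 0) \<le> 0"
    proof (rule minorant_nonpos_at_0[OF hol])
      show "Re (L (of_real y)) \<le> 0" if "y < 0" for y :: real
        using le[of y] that by (simp add: trunc_gauss_def)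
    qed
    then show ?thesis using True by (simp add: phi_def)
  next
    case False
    then show ?thesis using le[of x] by (auto simp: phi_def trunc_gauss_def)
  qed
  note tp = truncation_properties[of lam phi, OF lam]
  have tp': "\<And>x. (1 + x\<^sup>2) * \<bar>phi x\<bar> \<le> 1 + 1 / (pi * lam)"
    "\<And>m r. r \<longlonglongrightarrow> 1 \<Longrightarrow> (\<lambda>j. phi (r j * m)) \<longlonglongrightarrow> phi m"
    "has_bochner_integral lborel phi (1 / (2 * sqrt lam))"
    "(\<Sum>n. phi (real n) + phi (- real (Suc n))) = phi 0 + theta_tail (2 * pi * lam)"
    by (rule tp; simp add: phi_def)+
  have "AE x in lborel. x \<noteq> (0::real)" by (rule AE_lborel_singleton)
  then have ae: "AE x in lborel. trunc_gauss lam x = phi x"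
    by eventually_elim (auto simp: trunc_gauss_def phi_def)
  have [measurable]: "trunc_gauss lam \<in> borel_measurable borel"
    using truncation_properties(4)[of lam "trunc_gauss lam", OF lam] by (auto simp: trunc_gauss_def has_bochner_integral_iff)
  have [measurable]: "phi \<in> borel_measurable borel" using tp'(3) by (auto simp: has_bochner_integral_iff)
  have [measurable]: "(\<lambda>x. Re (L (of_real x))) \<in> borel_measurable borel"
    by (intro borel_measurable_continuous_onI continuous_at_imp_continuous_on ballI)
       (simp add: isCont_def tendsto_Re entire_isCont_of_real[OF hol, unfolded isCont_def])
  have nn: "(\<integral>\<^sup>+x. ennreal (trunc_gauss lam x - Re (L (of_real x))) \<partial>lborel) = (\<integral>\<^sup>+x. ennreal (phi x - Re (L (of_real x))) \<partial>lborel)"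
    using ae by (intro nn_integral_cong_AE) auto
  have d: "d = (\<integral>x. phi x - Re (L (of_real x)) \<partial>lborel)"
    unfolding d_def
    using ae by (intro integral_cong_AE) auto
  note D = extremal_dichotomy[OF hol type real le' tp' fin[unfolded nn]]
  have c: "c = 1 / (2 * sqrt lam) - (phi 0 + theta_tail (2 * pi * lam))"
    unfolding c_def theta3_eq_theta_tail[OF lam] by (simp add: phi_def field_simps)
  have gap: "phi m - Re (L (of_real m)) \<le> d - c" if "m \<in> \<int>" for m
    using D(4)[OF _ that] by (simp add: d c)
  show "(\<integral>\<^sup>+x. ennreal (trunc_gauss lam x - Re (L (of_real x))) \<partial>lborel) = ennreal d"
    unfolding nn d by (rule D(2))
  show "0 \<le> d" unfolding d by (rule D(3))
  show "c \<le> d" using gap[of 0] le'[of 0] by simp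
  show "integrable lborel (\<lambda>x. Re (L (of_real x)))" by (rule D(1))
  show "Re (L (of_real x)) \<le> phi x" for x by (rule le')
  show "Re (L (of_real m)) = phi m" if "d = c" "m \<in> \<int>" for m
    using gap[OF that(2)] le'[of m] that(1) by simp
qed

text \<open>Negation turns a majorant into a minorant of \<open>- phi\<close>. Now
  \<open>phi 0 = 1\<close>, so the lattice sum of \<open>phi\<close> is
  \<open>1 + theta_tail (2 * pi * lam)\<close>.\<close>

lemma majorant_integral:
  fixes M :: "complex \<Rightarrow> complex"
  assumes lam: "lam > 0" and hol: "M holomorphic_on UNIV" and type: "exp_type_le M 1"
    and real: "\<And>x::real. M (of_real x) \<in> \<real>" and ge: "\<And>x::real. trunc_gauss lam x \<le> Re (M (of_real x))"
  defines "phi \<equiv> \<lambda>x. if x \<ge> 0 then exp (- pi * lam * x\<^sup>2) else 0"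
    and "c \<equiv> Re (theta3 0 (\<i> * of_real lam)) / 2 + 1 / 2 - 1 / (2 * sqrt lam)"
    and "d \<equiv> (\<integral>x. Re (M (of_real x)) - trunc_gauss lam x \<partial>lborel)"
  assumes fin: "(\<integral>\<^sup>+x. ennreal (Re (M (of_real x)) - trunc_gauss lam x) \<partial>lborel) \<noteq> \<infinity>"
  shows "(\<integral>\<^sup>+x. ennreal (Re (M (of_real x)) - trunc_gauss lam x) \<partial>lborel) = ennreal d" "c \<le> d" "0 \<le> d"
    and "integrable lborel (\<lambda>x. Re (M (of_real x)))" "\<And>x. phi x \<le> Re (M (of_real x))"
    and "\<And>m. d = c \<Longrightarrow> m \<in> \<int> \<Longrightarrow> Re (M (of_real m)) = phi m"
proof -
  have ge': "phi x \<le> Re (M (of_real x))" for x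
  proof (cases "x = 0")
    case True
    have "1 \<le> Re (M 0)"
    proof (rule majorant_ge_1_at_0[OF hol])
      show "exp (- pi * lam * y\<^sup>2) \<le> Re (M (of_real y))" if "y > 0" for y
        using ge[of y] that by (simp add: trunc_gauss_def)
    qed
    then show ?thesis using True by (simp add: phi_def)
  next
    case False
    then show ?thesis using ge[of x] by (auto simp: phi_def trunc_gauss_def)
  qed
  note tp = truncation_properties[of lam phi, OF lam]
  have tp': "\<And>x. (1 + x\<^sup>2) * \<bar>phi x\<bar> \<le> 1 + 1 / (pi * lam)"
    "\<And>m r. r \<longlonglongrightarrow> 1 \<Longrightarrow> (\<lambda>j. phi (r j * m)) \<longlonglongrightarrow> phi m"
    "has_bochner_integral lborel phi (1 / (2 * sqrt lam))"
    "(\<Sum>n. phi (real n) + phi (- real (Suc n))) = phi 0 + theta_tail (2 * pi * lam)"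
    by (rule tp; simp add: phi_def)+
  define psi where "psi x = - phi x" for x
  define F where "F z = - M z" for z
  have F: "F holomorphic_on UNIV" "exp_type_le F 1" "\<And>x::real. F (of_real x) \<in> \<real>" "\<And>x::real. Re (F (of_real x)) \<le> psi x"
    unfolding F_def psi_def using hol type real ge' by (auto intro!: holomorphic_intros simp: exp_type_le_def)
  have psi: "\<And>x. (1 + x\<^sup>2) * \<bar>psi x\<bar> \<le> 1 + 1 / (pi * lam)"
    "\<And>m r. r \<longlonglongrightarrow> 1 \<Longrightarrow> (\<lambda>j. psi (r j * m)) \<longlonglongrightarrow> psi m"
    "has_bochner_integral lborel psi (- (1 / (2 * sqrt lam)))"
    unfolding psi_def using tp'(1) by (auto intro!: tendsto_minus tp'(2) has_bochner_integral_minus tp'(3))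
  \<comment> \<open>Pulling the sign out of the series requires its summability, which the value in
    \<open>tp'\<close> does not include.\<close>
  have sum_psi: "(\<Sum>n. psi (real n) + psi (- real (Suc n))) = - (phi 0 + theta_tail (2 * pi * lam))"
  proof -
    have n0: "phi (- real (Suc n)) = 0" for n by (simp add: phi_def)
    have "summable (\<lambda>n. phi (real (Suc n)))"
    proof -
      have "phi (real (Suc n)) = exp (- (2 * pi * lam) * (real (Suc n))\<^sup>2 / 2)" for n
        by (simp add: phi_def del: of_nat_Suc)
      then show ?thesis using summable_theta_tail(1)[of "2 * pi * lam"] lam by (simp only:) auto
    qed
    then have "summable (\<lambda>n. phi (real n))"
      using summable_Suc_iff[of "\<lambda>n. phi (real n)"] by (simp only:)
    then have "summable (\<lambda>n. phi (real n) + phi (- real (Suc n)))" unfolding n0 by simp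
    from suminf_minus[OF this] show ?thesis unfolding tp'(4) psi_def by (simp del: of_nat_Suc)
  qed
  have "AE x in lborel. x \<noteq> (0::real)" by (rule AE_lborel_singleton)
  then have ae: "AE x in lborel. trunc_gauss lam x = phi x"
    by eventually_elim (auto simp: trunc_gauss_def phi_def)
  have [measurable]: "trunc_gauss lam \<in> borel_measurable borel"
    using truncation_properties(4)[of lam "trunc_gauss lam", OF lam] by (auto simp: trunc_gauss_def has_bochner_integral_iff)
  have [measurable]: "phi \<in> borel_measurable borel" using tp'(3) by (auto simp: has_bochner_integral_iff)
  have [measurable]: "(\<lambda>x. Re (M (of_real x))) \<in> borel_measurable borel"
    by (intro borel_measurable_continuous_onI continuous_at_imp_continuous_on ballI)
       (simp add: isCont_def tendsto_Re entire_isCont_of_real[OF hol, unfolded isCont_def])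
  have FM: "psi x - Re (F (of_real x)) = Re (M (of_real x)) - phi x" for x by (simp add: psi_def F_def)
  have nn: "(\<integral>\<^sup>+x. ennreal (Re (M (of_real x)) - trunc_gauss lam x) \<partial>lborel) = (\<integral>\<^sup>+x. ennreal (psi x - Re (F (of_real x))) \<partial>lborel)"
    unfolding FM using ae by (intro nn_integral_cong_AE) auto
  have d: "d = (\<integral>x. psi x - Re (F (of_real x)) \<partial>lborel)"
    unfolding d_def FM using ae by (intro integral_cong_AE) auto
  note D = extremal_dichotomy[OF F psi sum_psi fin[unfolded nn]]
  have c: "c = - (1 / (2 * sqrt lam)) - - (phi 0 + theta_tail (2 * pi * lam))"
    unfolding c_def theta3_eq_theta_tail[OF lam] by (simp add: phi_def field_simps)
  have gap: "Re (M (of_real m)) - phi m \<le> d - c" if "m \<in> \<int>" for m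
    using D(4)[OF _ that] unfolding FM d c by simp
  show "(\<integral>\<^sup>+x. ennreal (Re (M (of_real x)) - trunc_gauss lam x) \<partial>lborel) = ennreal d"
    unfolding nn d by (rule D(2))
  show "0 \<le> d" unfolding d by (rule D(3))
  show "c \<le> d" using gap[of 0] ge'[of 0] by simp
  show "integrable lborel (\<lambda>x. Re (M (of_real x)))"
    using D(1) by (simp add: F_def)
  show "phi x \<le> Re (M (of_real x))" for x by (rule ge')
  show "Re (M (of_real m)) = phi m" if "d = c" "m \<in> \<int>" for m
    using gap[OF that(2)] ge'[of m] that(1) by simp
qed

text \<open>Nonnegative integrals make a non-integrable gap count as infinite, where a Bochner
  integral would be 0; \<open>enn2ereal\<close> allows comparison with a real constant whose sign is
  not evident.\<close>

theorem theorem2: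
  fixes lam :: real
  assumes "lam > 0"
  shows "(\<forall>x::real. L_plus lam (of_real x) \<in> \<real> \<and> M_plus lam (of_real x) \<in> \<real> \<and>
            Re (L_plus lam (of_real x)) \<le> trunc_gauss lam x \<and>
            trunc_gauss lam x \<le> Re (M_plus lam (of_real x)))
    \<and> (\<forall>L. L holomorphic_on UNIV \<longrightarrow> exp_type_le L 1 \<longrightarrow>
          (\<forall>x::real. L (of_real x) \<in> \<real> \<and> Re (L (of_real x)) \<le> trunc_gauss lam x) \<longrightarrow>
          enn2ereal (\<integral>\<^sup>+x. ennreal (trunc_gauss lam x - Re (L (of_real x))) \<partial>lborel)
            \<ge> ereal (- Re (theta3 0 (\<i> * of_real lam)) / 2 + 1 / 2 + 1 / (2 * sqrt lam))
        \<and> (enn2ereal (\<integral>\<^sup>+x. ennreal (trunc_gauss lam x - Re (L (of_real x))) \<partial>lborel)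
            = ereal (- Re (theta3 0 (\<i> * of_real lam)) / 2 + 1 / 2 + 1 / (2 * sqrt lam))
           \<longleftrightarrow> L = L_plus lam))
    \<and> (\<forall>M. M holomorphic_on UNIV \<longrightarrow> exp_type_le M 1 \<longrightarrow>
          (\<forall>x::real. M (of_real x) \<in> \<real> \<and> trunc_gauss lam x \<le> Re (M (of_real x))) \<longrightarrow>
          enn2ereal (\<integral>\<^sup>+x. ennreal (Re (M (of_real x)) - trunc_gauss lam x) \<partial>lborel)
            \<ge> ereal (Re (theta3 0 (\<i> * of_real lam)) / 2 + 1 / 2 - 1 / (2 * sqrt lam))
        \<and> (enn2ereal (\<integral>\<^sup>+x. ennreal (Re (M (of_real x)) - trunc_gauss lam x) \<partial>lborel)
            = ereal (Re (theta3 0 (\<i> * of_real lam)) / 2 + 1 / 2 - 1 / (2 * sqrt lam))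
           \<longleftrightarrow> M = M_plus lam))"
proof -
  note lam = assms
  define cL where "cL = - Re (theta3 0 (\<i> * of_real lam)) / 2 + 1 / 2 + 1 / (2 * sqrt lam)"
  define cM where "cM = Re (theta3 0 (\<i> * of_real lam)) / 2 + 1 / 2 - 1 / (2 * sqrt lam)"
  define IL where "IL L = (\<integral>\<^sup>+x. ennreal (trunc_gauss lam x - Re (L (of_real x))) \<partial>lborel)" for L :: "complex \<Rightarrow> complex"
  define IM where "IM M = (\<integral>\<^sup>+x. ennreal (Re (M (of_real x)) - trunc_gauss lam x) \<partial>lborel)" for M :: "complex \<Rightarrow> complex"
  define pL where "pL x = (if x > 0 then exp (- pi * lam * x\<^sup>2) else 0)" for x :: real
  define pM where "pM x = (if x \<ge> 0 then exp (- pi * lam * x\<^sup>2) else 0)" for x :: real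
  note bounds = L_plus_M_plus_bounds[OF lam]
  \<comment> \<open>Nonnegativity of the constants matters: \<open>ennreal\<close> maps negative
    reals to 0, so \<open>ennreal d = ennreal cL\<close> gives \<open>d = cL\<close> only together
    with the signs.\<close>
  have attained: "IL (L_plus lam) = ennreal cL" "0 \<le> cL" "IM (M_plus lam) = ennreal cM" "0 \<le> cM"
    and intL: "integrable lborel (\<lambda>x. Re (L_plus lam (of_real x)))"
    and intM: "integrable lborel (\<lambda>x. Re (M_plus lam (of_real x)))"
    and L_le: "\<And>x. Re (L_plus lam (of_real x)) \<le> pL x"
    and M_ge: "\<And>x. pM x \<le> Re (M_plus lam (of_real x))"
    and L_touch: "\<And>m. m \<in> \<int> \<Longrightarrow> Re (L_plus lam (of_real m)) = pL m"
    and M_touch: "\<And>m. m \<in> \<int> \<Longrightarrow> Re (M_plus lam (of_real m)) = pM m"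
  proof -
    have "AE x in lborel. x \<noteq> (0::real)" by (rule AE_lborel_singleton)
    \<comment> \<open>Both gaps are nonnegative, so each is almost everywhere at most
      \<open>sinc_sq\<close> and has a finite integral.\<close>
    then have ae: "AE x in lborel. (trunc_gauss lam x - Re (L_plus lam (of_real x)))
        + (Re (M_plus lam (of_real x)) - trunc_gauss lam x) = sinc_sq x"
      by eventually_elim (simp add: M_plus_of_real[OF lam])
    have fin: "(\<integral>\<^sup>+x. ennreal (sinc_sq x) \<partial>lborel) \<noteq> \<infinity>"
      using sinc_sq_integral[unfolded has_bochner_integral_iff]
      by (simp add: nn_integral_eq_integral sinc_sq_props(1))
    have "IL (L_plus lam) \<le> (\<integral>\<^sup>+x. ennreal (sinc_sq x) \<partial>lborel)"
      unfolding IL_def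
    proof (rule nn_integral_mono_AE)
      show "AE x in lborel. ennreal (trunc_gauss lam x - Re (L_plus lam (of_real x))) \<le> ennreal (sinc_sq x)"
        using ae
      proof eventually_elim
        case (elim x)
        then show ?case using bounds(4)[of x] by (intro ennreal_leI) linarith
      qed
    qed
    with fin have finL: "IL (L_plus lam) \<noteq> \<infinity>" by (auto simp: top_unique)
    have "IM (M_plus lam) \<le> (\<integral>\<^sup>+x. ennreal (sinc_sq x) \<partial>lborel)"
      unfolding IM_def
    proof (rule nn_integral_mono_AE)
      show "AE x in lborel. ennreal (Re (M_plus lam (of_real x)) - trunc_gauss lam x) \<le> ennreal (sinc_sq x)"
        using ae
      proof eventually_elim
        case (elim x)
        then show ?case using bounds(3)[of x] by (intro ennreal_leI) linarith
      qed
    qed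
    with fin have finM: "IM (M_plus lam) \<noteq> \<infinity>" by (auto simp: top_unique)
    define dL where "dL = (\<integral>x. trunc_gauss lam x - Re (L_plus lam (of_real x)) \<partial>lborel)"
    have dL: "IL (L_plus lam) = ennreal dL" "cL \<le> dL" "0 \<le> dL"
        "integrable lborel (\<lambda>x. Re (L_plus lam (of_real x)))" "\<And>x. Re (L_plus lam (of_real x)) \<le> pL x"
        "\<And>m. dL = cL \<Longrightarrow> m \<in> \<int> \<Longrightarrow> Re (L_plus lam (of_real m)) = pL m"
      unfolding IL_def cL_def pL_def dL_def
      by (rule minorant_integral[OF lam L_plus_holomorphic[OF lam] exp_type_le_L_plus[OF lam] bounds(1,3) finL[unfolded IL_def]]; assumption)+
    define dM where "dM = (\<integral>x. Re (M_plus lam (of_real x)) - trunc_gauss lam x \<partial>lborel)"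
    have dM: "IM (M_plus lam) = ennreal dM" "cM \<le> dM" "0 \<le> dM"
        "integrable lborel (\<lambda>x. Re (M_plus lam (of_real x)))" "\<And>x. pM x \<le> Re (M_plus lam (of_real x))"
        "\<And>m. dM = cM \<Longrightarrow> m \<in> \<int> \<Longrightarrow> Re (M_plus lam (of_real m)) = pM m"
      unfolding IM_def cM_def pM_def dM_def
      by (rule majorant_integral[OF lam M_plus_holomorphic[OF lam] exp_type_le_M_plus[OF lam] bounds(2,4) finM[unfolded IM_def]]; assumption)+
    have tint: "integrable lborel (trunc_gauss lam)"
      using truncation_properties(4)[of lam "trunc_gauss lam", OF lam] by (auto simp: trunc_gauss_def has_bochner_integral_iff)
    have "dL + dM = (\<integral>x. (trunc_gauss lam x - Re (L_plus lam (of_real x)))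
        + (Re (M_plus lam (of_real x)) - trunc_gauss lam x) \<partial>lborel)"
      unfolding dL_def dM_def
      by (intro Bochner_Integration.integral_add[symmetric] Bochner_Integration.integrable_diff tint dL(4) dM(4))
    also have "\<dots> = (\<integral>x. sinc_sq x \<partial>lborel)"
      using tint dL(4) dM(4) sinc_sq_integral[unfolded has_bochner_integral_iff] by (intro integral_cong_AE ae) auto
    also have "\<dots> = cL + cM" using sinc_sq_integral[unfolded has_bochner_integral_iff] by (simp add: cL_def cM_def)
    finally have eq: "dL = cL" "dM = cM" using dL(2) dM(2) by linarith+
    show "IL (L_plus lam) = ennreal cL" "0 \<le> cL" using dL(1,3) eq(1) by simp_all
    show "IM (M_plus lam) = ennreal cM" "0 \<le> cM" using dM(1,3) eq(2) by simp_all
    show "Re (L_plus lam (of_real m)) = pL m" "Re (M_plus lam (of_real m)) = pM m" if "m \<in> \<int>" for m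
      using dL(6)[OF eq(1) that] dM(6)[OF eq(2) that] by simp_all
    show "integrable lborel (\<lambda>x. Re (L_plus lam (of_real x)))" "integrable lborel (\<lambda>x. Re (M_plus lam (of_real x)))"
      by (fact dL(4) dM(4))+
    show "Re (L_plus lam (of_real x)) \<le> pL x" "pM x \<le> Re (M_plus lam (of_real x))" for x
      by (fact dL(5) dM(5))+
  qed
  \<comment> \<open>A minorant may have an infinite gap; then the inequality is strict and
    \<open>L\<close> differs from \<open>L_plus\<close>, whose gap is finite.\<close>
  have minorant: "enn2ereal (IL L) \<ge> ereal cL \<and> (enn2ereal (IL L) = ereal cL \<longleftrightarrow> L = L_plus lam)"
    if L: "L holomorphic_on UNIV" "exp_type_le L 1" "\<And>x::real. L (of_real x) \<in> \<real>"
      "\<And>x::real. Re (L (of_real x)) \<le> trunc_gauss lam x" for L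
  proof (cases "IL L = \<infinity>")
    case True
    then have "enn2ereal (IL L) = \<infinity>" by simp
    moreover have "L \<noteq> L_plus lam" using True attained(1) by auto
    ultimately show ?thesis by simp
  next
    case False
    define d where "d = (\<integral>x. trunc_gauss lam x - Re (L (of_real x)) \<partial>lborel)"
    have d: "IL L = ennreal d" "cL \<le> d" "0 \<le> d"
        "integrable lborel (\<lambda>x. Re (L (of_real x)))" "\<And>x. Re (L (of_real x)) \<le> pL x"
        "\<And>m. d = cL \<Longrightarrow> m \<in> \<int> \<Longrightarrow> Re (L (of_real m)) = pL m"
      unfolding IL_def cL_def pL_def d_def
      by (rule minorant_integral[OF lam L False[unfolded IL_def]]; assumption)+
    have "L = L_plus lam" if "d = cL"
    proof (rule extremal_unique[OF L(1,2,3) d(5,4) d(6)[OF that]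
        L_plus_holomorphic[OF lam] exp_type_le_L_plus[OF lam] bounds(1) L_le intL L_touch])
      show "\<exists>D. (pL has_real_derivative D) (at x)" if "x \<noteq> 0" for x
        by (rule truncation_properties(2)[OF lam _ _ _ _ that]) (auto simp: pL_def)
    qed
    moreover have "d = cL" if "L = L_plus lam"
      using d(1,3) attained(1,2) that by simp
    ultimately show ?thesis using d(1-3) by (auto simp: enn2ereal_ennreal)
  qed
  have majorant: "enn2ereal (IM M) \<ge> ereal cM \<and> (enn2ereal (IM M) = ereal cM \<longleftrightarrow> M = M_plus lam)"
    if M: "M holomorphic_on UNIV" "exp_type_le M 1" "\<And>x::real. M (of_real x) \<in> \<real>"
      "\<And>x::real. trunc_gauss lam x \<le> Re (M (of_real x))" for M
  proof (cases "IM M = \<infinity>")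
    case True
    then have "enn2ereal (IM M) = \<infinity>" by simp
    moreover have "M \<noteq> M_plus lam" using True attained(3) by auto
    ultimately show ?thesis by simp
  next
    case False
    define d where "d = (\<integral>x. Re (M (of_real x)) - trunc_gauss lam x \<partial>lborel)"
    have d: "IM M = ennreal d" "cM \<le> d" "0 \<le> d"
        "integrable lborel (\<lambda>x. Re (M (of_real x)))" "\<And>x. pM x \<le> Re (M (of_real x))"
        "\<And>m. d = cM \<Longrightarrow> m \<in> \<int> \<Longrightarrow> Re (M (of_real m)) = pM m"
      unfolding IM_def cM_def pM_def d_def
      by (rule majorant_integral[OF lam M False[unfolded IM_def]]; assumption)+
    have "M = M_plus lam" if eq: "d = cM"
    proof -
      \<comment> \<open>\<open>extremal_unique\<close> is about minorants, so it is applied to the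
        negated functions below \<open>- pM\<close>.\<close>
      have "(\<lambda>z. - M z) = (\<lambda>z. - M_plus lam z)"
      proof (rule extremal_unique[where phi = "\<lambda>x. - pM x"])
        show "\<exists>D. ((\<lambda>x. - pM x) has_real_derivative D) (at x)" if "x \<noteq> 0" for x
        proof -
          have "\<exists>D. (pM has_real_derivative D) (at x)"
            by (rule truncation_properties(2)[OF lam _ _ _ _ that]) (auto simp: pM_def)
          then show ?thesis by (blast intro: DERIV_minus)
        qed
        show "exp_type_le (\<lambda>z. - M z) 1" "exp_type_le (\<lambda>z. - M_plus lam z) 1"
          using M(2) exp_type_le_M_plus[OF lam] by (simp_all add: exp_type_le_def)
        show "(\<lambda>z. - M z) holomorphic_on UNIV" "(\<lambda>z. - M_plus lam z) holomorphic_on UNIV"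
          using M(1) M_plus_holomorphic[OF lam] by (auto intro!: holomorphic_intros)
      qed (use M(3) bounds(2) d(4,5) d(6)[OF eq] M_ge intM M_touch in simp_all)
      then show ?thesis by (auto simp: fun_eq_iff)
    qed
    moreover have "d = cM" if "M = M_plus lam"
      using d(1,3) attained(3,4) that by simp
    ultimately show ?thesis using d(1-3) by (auto simp: enn2ereal_ennreal)
  qed
  show ?thesis
    using bounds minorant majorant unfolding IL_def IM_def cL_def cM_def by blast
qed

end
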